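(* Let $\mu\in\mathbb{C}^n$ be generic, let $\lambda=(\lambda_\mu,c_0,c_1,c_2,c_3)\in\mathbb{C}^5$, and let $V(\lambda)$ be the irreducible highest weight module of $\mathbf{HVir}(n)_\mu$ with highest weight $\lambda$ (with respect to the triangular decomposition defined by the lexicographic order on $\mathbb{Z}^n$). Then there exists $\alpha\in\mathrm{supp}(V(\lambda))$ such that the weight space $V(\lambda)_\alpha$ is infinite-dimensional. The same assertion holds for the irreducible lowest weight module $V(\lambda)^\vee$: there exists $\alpha\in\mathrm{supp}(V(\lambda)^\vee)$ such that $(V(\lambda)^\vee)_\alpha$ is infinite-dimensional.
   Context: For $\mu=(\mu_1,\ldots,\mu_n)\in\mathbb{C}^n$ and $\alpha\in\mathbb{Z}^n$ put $\mu\cdot\alpha=\sum_{i=1}^n\mu_i\alpha_i$; $\mu$ is generic if $\mu\cdot\alpha\ne0$ for all $\alpha\in\mathbb{Z}^n\setminus\{\overrightarrow{0}\}$. The solenoidal Heisenberg-Virasoro algebra $\mathbf{HVir}(n)_\mu$ is the complex Lie algebra with basis $\{e_{\mu\cdot\alpha},h_\alpha:\alpha\in\mathbb{Z}^n\}\cup\{c_{\mu,1},c_{\mu,2},c_{\mu,3}\}$, where $c_{\mu,1},c_{\mu,2},c_{\mu,3}$ are central and $$[e_{\mu\cdot\alpha},e_{\mu\cdot\beta}]=\mu\cdot(\beta-\alpha)e_{\mu\cdot(\alpha+\beta)}+\delta_{\alpha,-\beta}\tfrac{(\mu\cdot\alpha)^3-(\mu\cdot\alpha)}{12}c_{\mu,1},$$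 $$[e_{\mu\cdot\alpha},h_\beta]=(\mu\cdot\beta)h_{\alpha+\beta}+\delta_{\alpha,-\beta}\big((\mu\cdot\alpha)^2-(\mu\cdot\alpha)\big)c_{\mu,2},$$ $$[h_\alpha,h_\beta]=\delta_{\alpha,-\beta}\tfrac{\mu\cdot\alpha}{3}c_{\mu,3}.$$ Write $d_\mu=e_{\mu\cdot0}$. For a module $V$ and $\alpha\in\mathbb{C}$, the weight space is $V_\alpha=\{v\in V: d_\mu v=\alpha v\}$, and $\mathrm{supp}(V)=\{\alpha\in\mathbb{C}:V_\alpha\ne0\}$. Let $<_{lex}$ be the lexicographic order on $\mathbb{Z}^n$, $\Delta^+=\{\alpha\in\mathbb{Z}^n:\overrightarrow{0}<_{lex}\alpha\}$, $\Delta^-=\{\alpha\in\mathbb{Z}^n:\alpha<_{lex}\overrightarrow{0}\}$. The triangular decomposition is $\mathbf{HVir}(n)_\mu=(\mathbf{HVir}(n)_\mu)_+\oplus(\mathbf{HVir}(n)_\mu)_0\oplus(\mathbf{HVir}(n)_\mu)_-$ with $(\mathbf{HVir}(n)_\mu)_\pm=\bigoplus_{\alpha\in\Delta^\pm}(\mathbb{C}e_{\mu\cdot\alpha}\oplus\mathbb{C}h_\alpha)$ and $(\mathbf{HVir}(n)_\mu)_0=\mathbb{C}e_{\mu\cdot0}\oplus\mathbb{C}h_0\oplus\mathbb{C}c_{\mu,1}\oplus\mathbb{C}c_{\mu,2}\oplus\mathbb{C}c_{\mu,3}$. Let $\mathbb{C}_\lambda=\mathbb{C}1_\lambda$ be the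 one-dimensional module over $\mathbf{HB}(n)_+=(\mathbf{HVir}(n)_\mu)_0\oplus(\mathbf{HVir}(n)_\mu)_+$ on which $(\mathbf{HVir}(n)_\mu)_+$ acts by $0$ and $e_{\mu\cdot0},h_0,c_{\mu,1},c_{\mu,2},c_{\mu,3}$ act by $\lambda_\mu,c_0,c_1,c_2,c_3$ respectively. The Verma module is $M(\lambda)=U(\mathbf{HVir}(n)_\mu)\otimes_{U(\mathbf{HB}(n)_+)}\mathbb{C}_\lambda$, and $V(\lambda)$ is its irreducible quotient by its maximal proper submodule. The lowest weight module $V(\lambda)^\vee$ is constructed in the same manner with the roles of $(\mathbf{HVir}(n)_\mu)_+$ and $(\mathbf{HVir}(n)_\mu)_-$ exchanged.
   Formalization: The formal theorem assumes n ≥ 2 and λ ≠ (0,0,0,0,0), since the claim fails otherwise: for n = 1 all weight spaces of V(λ) and V(λ)^∨ are finite-dimensional, and for λ = 0 both modules are trivial and one-dimensional. *)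

theory Defs
  imports
    "HOL-Analysis.Finite_Cartesian_Product"
    "HOL-Library.Poly_Mapping"
    "HOL-Algebra.QuotRing"
    "HOL-Algebra.Free_Abelian_Groups"
    "Jordan_Normal_Form.Missing_VectorSpace"
begin

section \<open>The lattice\<close>

text \<open>
  \<open>\<int>\<^sup>n\<close> is \<^typ>\<open>int ^ 'n\<close>, where \<open>n\<close> is the cardinality of the finite, linearly ordered index
  type \<open>'n\<close>. The linear order on \<open>'n\<close> is needed for the lexicographic order.
\<close>

definition mu_dot :: "complex ^ 'n \<Rightarrow> int ^ 'n \<Rightarrow> complex" where
  "mu_dot \<mu> \<alpha> = (\<Sum>i\<in>UNIV. \<mu> $ i * of_int (\<alpha> $ i))"

definition generic :: "complex ^ 'n \<Rightarrow> bool" where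
  "generic \<mu> \<longleftrightarrow> (\<forall>\<alpha>. \<alpha> \<noteq> 0 \<longrightarrow> mu_dot \<mu> \<alpha> \<noteq> 0)"

definition lex_less :: "int ^ ('n::{finite,linorder}) \<Rightarrow> int ^ ('n::{finite,linorder}) \<Rightarrow> bool" where
  "lex_less \<alpha> \<beta> \<longleftrightarrow> (\<exists>i. \<alpha> $ i < \<beta> $ i \<and> (\<forall>j<i. \<alpha> $ j = \<beta> $ j))"

definition Delta_pos :: "(int ^ ('n::{finite,linorder})) set" where
  "Delta_pos = {\<alpha>. lex_less 0 \<alpha>}"

definition Delta_neg :: "(int ^ ('n::{finite,linorder})) set" where
  "Delta_neg = {\<alpha>. lex_less \<alpha> 0}"


section \<open>The solenoidal Heisenberg-Virasoro algebra\<close>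

text \<open>
  \<open>E \<alpha>\<close> stands for \<open>e\<^bsub>\<mu>\<cdot>\<alpha>\<^esub>\<close> and \<open>H \<alpha>\<close> for \<open>h\<^bsub>\<alpha>\<^esub>\<close>. The Lie algebra is the vector space of
  finitely supported complex functions on this basis; the parameter \<open>\<mu>\<close> only enters through the
  bracket.
\<close>

datatype 'n hv_basis = E "int ^ 'n" | H "int ^ 'n" | C1 | C2 | C3

type_synonym 'n hvir = "'n hv_basis \<Rightarrow>\<^sub>0 complex"

abbreviation cscale :: "complex \<Rightarrow> ('b \<Rightarrow>\<^sub>0 complex) \<Rightarrow> ('b \<Rightarrow>\<^sub>0 complex)" where
  "cscale c \<equiv> Poly_Mapping.map (\<lambda>z. c * z)"

fun basis_bracket :: "complex ^ 'n \<Rightarrow> 'n hv_basis \<Rightarrow> 'n hv_basis \<Rightarrow> 'n hvir" where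
  "basis_bracket \<mu> (E \<alpha>) (E \<beta>) =
     Poly_Mapping.single (E (\<alpha> + \<beta>)) (mu_dot \<mu> (\<beta> - \<alpha>)) +
     (if \<alpha> = - \<beta> then Poly_Mapping.single C1 ((mu_dot \<mu> \<alpha> ^ 3 - mu_dot \<mu> \<alpha>) / 12) else 0)"
| "basis_bracket \<mu> (E \<alpha>) (H \<beta>) =
     Poly_Mapping.single (H (\<alpha> + \<beta>)) (mu_dot \<mu> \<beta>) +
     (if \<alpha> = - \<beta> then Poly_Mapping.single C2 (mu_dot \<mu> \<alpha> ^ 2 - mu_dot \<mu> \<alpha>) else 0)"
| "basis_bracket \<mu> (H \<beta>) (E \<alpha>) =
     - (Poly_Mapping.single (H (\<alpha> + \<beta>)) (mu_dot \<mu> \<beta>) +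
        (if \<alpha> = - \<beta> then Poly_Mapping.single C2 (mu_dot \<mu> \<alpha> ^ 2 - mu_dot \<mu> \<alpha>) else 0))"
| "basis_bracket \<mu> (H \<alpha>) (H \<beta>) =
     (if \<alpha> = - \<beta> then Poly_Mapping.single C3 (mu_dot \<mu> \<alpha> / 3) else 0)"
| "basis_bracket \<mu> _ _ = 0"

definition bracket :: "complex ^ 'n \<Rightarrow> 'n hvir \<Rightarrow> 'n hvir \<Rightarrow> 'n hvir" where
  "bracket \<mu> x y =
     (\<Sum>a\<in>Poly_Mapping.keys x. \<Sum>b\<in>Poly_Mapping.keys y.
        cscale (Poly_Mapping.lookup x a * Poly_Mapping.lookup y b) (basis_bracket \<mu> a b))"

definition d_mu :: "('n::finite) hvir" where
  "d_mu = Poly_Mapping.single (E 0) 1"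


section \<open>Universal enveloping algebras\<close>

text \<open>A type-class ring as a \<open>HOL-Algebra\<close> ring record.\<close>

abbreviation type_ring :: "'a::{times,plus,one,zero} ring" where
  "type_ring \<equiv>
     \<lparr>carrier = UNIV, monoid.mult = (*), monoid.one = 1, ring.zero = 0, ring.add = (+)\<rparr>"

text \<open>
  The tensor algebra of a vector space with basis \<open>'b\<close> is the free associative algebra on \<open>'b\<close>,
  i.e. the monoid algebra of the free monoid. As \<open>Poly_Mapping\<close> takes an additively written
  monoid, \<open>+\<close> on words is concatenation and \<open>0\<close> is the empty word.
\<close>

datatype 'b free_word = Word (letters: "'b list")

instantiation free_word :: (type) monoid_add
begin

definition zero_free_word :: "'a free_word" where
  "zero_free_word = Word []"

definition plus_free_word :: "'a free_word \<Rightarrow> 'a free_word \<Rightarrow> 'a free_word" where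
  "plus_free_word u v = Word (letters u @ letters v)"

instance
  by standard (simp_all add: zero_free_word_def plus_free_word_def)

end

type_synonym 'n hv_tensor = "'n hv_basis free_word \<Rightarrow>\<^sub>0 complex"

text \<open>The inclusion of the Lie algebra into its tensor algebra.\<close>

definition iota :: "'n hvir \<Rightarrow> 'n hv_tensor" where
  "iota x = (\<Sum>a\<in>Poly_Mapping.keys x.
     Poly_Mapping.single (Word [a]) (Poly_Mapping.lookup x a))"

text \<open>
  For a set \<open>S\<close> of basis vectors spanning a Lie subalgebra, \<open>UEA \<mu> S\<close> is the universal enveloping
  algebra of that subalgebra: its tensor algebra modulo the two-sided ideal generated by all
  \<open>x \<otimes> y - y \<otimes> x - [x, y]\<close>. Hence \<open>UEA \<mu> UNIV\<close> is the enveloping algebra of the whole Lie algebra.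
\<close>

definition tensor_alg :: "'n hv_basis set \<Rightarrow> 'n hv_tensor ring" where
  "tensor_alg S = type_ring\<lparr>carrier := {t. \<forall>w\<in>Poly_Mapping.keys t. set (letters w) \<subseteq> S}\<rparr>"

definition UEA_ideal :: "complex ^ 'n \<Rightarrow> 'n hv_basis set \<Rightarrow> 'n hv_tensor set" where
  "UEA_ideal \<mu> S = genideal (tensor_alg S)
     {iota x * iota y - iota y * iota x - iota (bracket \<mu> x y) | x y.
        Poly_Mapping.keys x \<subseteq> S \<and> Poly_Mapping.keys y \<subseteq> S}"

definition UEA :: "complex ^ 'n \<Rightarrow> 'n hv_basis set \<Rightarrow> 'n hv_tensor set ring" where
  "UEA \<mu> S = tensor_alg S Quot UEA_ideal \<mu> S"

definition UEA_class :: "complex ^ 'n \<Rightarrow> 'n hv_tensor \<Rightarrow> 'n hv_tensor set" where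
  "UEA_class \<mu> t = UEA_ideal \<mu> UNIV +>\<^bsub>tensor_alg UNIV\<^esub> t"

text \<open>
  The canonical homomorphism from the enveloping algebra of a subalgebra to that of the whole
  algebra: a coset of the smaller ideal is enlarged to the coset of the bigger ideal containing it.
\<close>

definition UEA_incl :: "complex ^ 'n \<Rightarrow> 'n hv_tensor set \<Rightarrow> 'n hv_tensor set" where
  "UEA_incl \<mu> B = UEA_ideal \<mu> UNIV <+>\<^bsub>tensor_alg UNIV\<^esub> B"


section \<open>Modules over the Lie algebra\<close>

text \<open>
  Modules are \<open>HOL-Algebra\<close> module records over the field \<open>type_ring\<close> of complex numbers together
  with an action of the Lie algebra. The fields \<open>mult\<close> and \<open>one\<close>, inherited from rings, carry
  no meaning for modules.
\<close>

record ('g, 'v) lie_module = "(complex, 'v) module" +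
  act :: "'g \<Rightarrow> 'v \<Rightarrow> 'v"

definition lie_submodule :: "'v set \<Rightarrow> ('g, 'v) lie_module \<Rightarrow> bool" where
  "lie_submodule N M \<longleftrightarrow> submodule type_ring N M \<and> (\<forall>x. \<forall>v\<in>N. act M x v \<in> N)"

definition maximal_proper_submodule :: "'v set \<Rightarrow> ('g, 'v) lie_module \<Rightarrow> bool" where
  "maximal_proper_submodule N M \<longleftrightarrow>
     lie_submodule N M \<and> N \<noteq> carrier M \<and>
     (\<forall>N'. lie_submodule N' M \<and> N \<subseteq> N' \<longrightarrow> N' = N \<or> N' = carrier M)"

definition quotient_module :: "('g, 'v) lie_module \<Rightarrow> 'v set \<Rightarrow> ('g, 'v set) lie_module" where
  "quotient_module M N =
     \<lparr>carrier = a_rcosets\<^bsub>M\<^esub> N, monoid.mult = (\<lambda>_ _. undefined), monoid.one = undefined,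
      ring.zero = N, ring.add = set_add M,
      smult = (\<lambda>c A. N <+>\<^bsub>M\<^esub> ((\<lambda>v. c \<odot>\<^bsub>M\<^esub> v) ` A)),
      act = (\<lambda>x A. N <+>\<^bsub>M\<^esub> (act M x ` A))\<rparr>"

definition irreducible_quotient :: "('g, 'v) lie_module \<Rightarrow> ('g, 'v set) lie_module" where
  "irreducible_quotient M = quotient_module M (THE N. maximal_proper_submodule N M)"

definition weight_space :: "(('n::finite) hvir, 'v) lie_module \<Rightarrow> complex \<Rightarrow> 'v set" where
  "weight_space V a = {v \<in> carrier V. act V d_mu v = a \<odot>\<^bsub>V\<^esub> v}"

definition supp :: "(('n::finite) hvir, 'v) lie_module \<Rightarrow> complex set" where
  "supp V = {a. weight_space V a \<noteq> {\<zero>\<^bsub>V\<^esub>}}"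

definition infinite_dim_weight_space :: "(('n::finite) hvir, 'v) lie_module \<Rightarrow> complex \<Rightarrow> bool" where
  "infinite_dim_weight_space V a \<longleftrightarrow>
     \<not> vectorspace.fin_dim type_ring (V\<lparr>carrier := weight_space V a\<rparr>)"


section \<open>Verma modules and their irreducible quotients\<close>

text \<open>
  A weight is \<open>(\<lambda>\<^bsub>\<mu>\<^esub>, c\<^bsub>0\<^esub>, c\<^bsub>1\<^esub>, c\<^bsub>2\<^esub>, c\<^bsub>3\<^esub>)\<close>. The parameter \<open>P\<close> below is either \<^const>\<open>Delta_pos\<close>, which
  gives highest weight modules, or \<^const>\<open>Delta_neg\<close>, which gives lowest weight modules.
\<close>

type_synonym hv_weight = "complex \<times> complex \<times> complex \<times> complex \<times> complex"

definition borel_basis :: "(int ^ 'n) set \<Rightarrow> 'n hv_basis set" where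
  "borel_basis P = E ` (insert 0 P) \<union> H ` (insert 0 P) \<union> {C1, C2, C3}"

fun weight_char :: "hv_weight \<Rightarrow> ('n::finite) hv_basis \<Rightarrow> complex" where
  "weight_char (l, c0, c1, c2, c3) (E \<alpha>) = (if \<alpha> = 0 then l else 0)"
| "weight_char (l, c0, c1, c2, c3) (H \<alpha>) = (if \<alpha> = 0 then c0 else 0)"
| "weight_char (l, c0, c1, c2, c3) C1 = c1"
| "weight_char (l, c0, c1, c2, c3) C2 = c2"
| "weight_char (l, c0, c1, c2, c3) C3 = c3"

text \<open>
  The action of a tensor on the one-dimensional module \<open>\<complex>\<^bsub>\<lambda>\<^esub>\<close> is multiplication by \<open>tensor_char\<close>.
  This is constant on every coset of \<open>UEA_ideal \<mu> (borel_basis P)\<close>, and \<open>borel_action\<close> is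
  the induced action of the enveloping algebra of the subalgebra spanned by \<open>borel_basis P\<close>.
\<close>

definition tensor_char :: "hv_weight \<Rightarrow> ('n::finite) hv_tensor \<Rightarrow> complex" where
  "tensor_char lam t = (\<Sum>w\<in>Poly_Mapping.keys t.
     Poly_Mapping.lookup t w * prod_list (map (weight_char lam) (letters w)))"

definition borel_action :: "hv_weight \<Rightarrow> ('n::finite) hv_tensor set \<Rightarrow> complex \<Rightarrow> complex" where
  "borel_action lam B z = the_elem (tensor_char lam ` B) * z"

text \<open>
  The tensor product of a right module \<open>U\<close> and a left module \<open>W\<close> over a ring \<open>R\<close>, with actions
  \<open>ract\<close> and \<open>lact\<close>, is the free abelian group on pairs modulo \<open>tensor_relators\<close>.
\<close>

definition tensor_free ::
  "('u, 'a) ring_scheme \<Rightarrow> ('w, 'b) ring_scheme \<Rightarrow> ('u \<times> 'w \<Rightarrow>\<^sub>0 int) monoid" where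
  "tensor_free U W = free_Abelian_group (carrier U \<times> carrier W)"

definition tensor_relators ::
  "('u, 'a) ring_scheme \<Rightarrow> ('r, 'c) ring_scheme \<Rightarrow> ('w, 'b) ring_scheme \<Rightarrow>
   ('u \<Rightarrow> 'r \<Rightarrow> 'u) \<Rightarrow> ('r \<Rightarrow> 'w \<Rightarrow> 'w) \<Rightarrow> ('u \<times> 'w \<Rightarrow>\<^sub>0 int) set" where
  "tensor_relators U R W ract lact = generate (tensor_free U W)
     ({frag_of (u \<oplus>\<^bsub>U\<^esub> u', w) - frag_of (u, w) - frag_of (u', w) | u u' w.
         u \<in> carrier U \<and> u' \<in> carrier U \<and> w \<in> carrier W} \<union>
      {frag_of (u, w \<oplus>\<^bsub>W\<^esub> w') - frag_of (u, w) - frag_of (u, w') | u w w'.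
         u \<in> carrier U \<and> w \<in> carrier W \<and> w' \<in> carrier W} \<union>
      {frag_of (ract u r, w) - frag_of (u, lact r w) | u r w.
         u \<in> carrier U \<and> r \<in> carrier R \<and> w \<in> carrier W})"

text \<open>
  The endomorphism \<open>u \<otimes> w \<mapsto> f u \<otimes> w\<close> of a tensor product given as a quotient by \<open>K\<close>, applied to a
  coset \<open>A\<close>.
\<close>

definition tensor_map ::
  "('u \<times> 'w \<Rightarrow>\<^sub>0 int) monoid \<Rightarrow> ('u \<times> 'w \<Rightarrow>\<^sub>0 int) set \<Rightarrow> ('u \<Rightarrow> 'u) \<Rightarrow>
   ('u \<times> 'w \<Rightarrow>\<^sub>0 int) set \<Rightarrow> ('u \<times> 'w \<Rightarrow>\<^sub>0 int) set" where
  "tensor_map F K f A = K <#>\<^bsub>F\<^esub> (frag_extend (\<lambda>(u, w). frag_of (f u, w)) ` A)"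

type_synonym 'n verma_space = "('n hv_tensor set \<times> complex \<Rightarrow>\<^sub>0 int) set"

definition Verma ::
  "complex ^ 'n \<Rightarrow> (int ^ 'n) set \<Rightarrow> hv_weight \<Rightarrow> ('n hvir, 'n verma_space) lie_module" where
  "Verma \<mu> P lam =
     (let U = UEA \<mu> UNIV;
          F = tensor_free U (type_ring :: complex ring);
          K = tensor_relators U (UEA \<mu> (borel_basis P)) (type_ring :: complex ring)
                (\<lambda>u B. u \<otimes>\<^bsub>U\<^esub> UEA_incl \<mu> B) (borel_action lam)
      in \<lparr>carrier = carrier (F Mod K), monoid.mult = (\<lambda>_ _. undefined), monoid.one = undefined,
          ring.zero = \<one>\<^bsub>F Mod K\<^esub>, ring.add = monoid.mult (F Mod K),
          smult = (\<lambda>c. tensor_map F K (\<lambda>u. UEA_class \<mu> (Poly_Mapping.single 0 c) \<otimes>\<^bsub>U\<^esub> u)),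
          act = (\<lambda>x. tensor_map F K (\<lambda>u. UEA_class \<mu> (iota x) \<otimes>\<^bsub>U\<^esub> u))\<rparr>)"

definition highest_weight_module ::
  "complex ^ ('n::{finite,linorder}) \<Rightarrow> hv_weight \<Rightarrow> ('n hvir, 'n verma_space set) lie_module" where
  "highest_weight_module \<mu> lam = irreducible_quotient (Verma \<mu> Delta_pos lam)"

definition lowest_weight_module ::
  "complex ^ ('n::{finite,linorder}) \<Rightarrow> hv_weight \<Rightarrow> ('n hvir, 'n verma_space set) lie_module" where
  "lowest_weight_module \<mu> lam = irreducible_quotient (Verma \<mu> Delta_neg lam)"

text \<open>
  Pitfall: these modules are not always infinite-dimensional in some weight. For the zero weight
  they are the trivial one-dimensional module, and for \<open>n = 1\<close> all their weight spaces are
  finite-dimensional, as for any highest weight module of a rank one Heisenberg-Virasoro algebra.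
\<close>

end

theory Submission
  imports Defs "HOL-Computational_Algebra.Polynomial"
begin

text \<open>
  Let \<open>v\<close> be the generator of the Verma module. There is no need for the Poincare-Birkhoff-Witt theorem
  to see that \<open>v \<noteq> 0\<close>: the coefficient \<open>\<psi> t\<close> of \<open>v\<close> in \<open>t v\<close>, for a word \<open>t\<close> in the basis vectors, must
  vanish if \<open>t\<close> begins with a letter outside the Borel subalgebra, and a first letter \<open>x\<close> of the Borel
  subalgebra can be commuted to the right until it acts on \<open>v\<close> by its character. This determines \<open>\<psi>\<close> by
  recursion on the length, and the Jacobi identity shows that \<open>\<psi>\<close> respects the relations. The maximal
  proper submodule consists of all \<open>t v\<close> with \<open>\<psi> (s t) = 0\<close> for all \<open>s\<close>, so vectors of the irreducible
  quotient are told apart by the functionals \<open>t \<mapsto> \<psi> (w t)\<close>.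

  Choose \<open>\<beta>\<close> and \<open>\<gamma>\<close> such that \<open>\<beta>\<close> and all \<open>\<gamma> + k \<beta>\<close> with \<open>k \<in> \<int>\<close> are positive. All vectors
  \<open>x\<^bsub>k \<beta> - \<gamma>\<^esub> y\<^bsub>- k \<beta>\<^esub> v\<close> with \<open>x, y \<in> {e, h}\<close> and \<open>k > 0\<close> have the same weight. Their pairings with the words
  \<open>z\<^bsub>j \<beta>\<^esub> z'\<^bsub>\<gamma> - j \<beta>\<^esub>\<close> are computed explicitly: if some component of the highest weight is nonzero, then
  for a suitable choice of the letters the pairing matrix (after taking third differences in \<open>j\<close>
  when all letters are \<open>e\<close>) is triangular with only finitely many zeros on the diagonal.
\<close>

section \<open>Scalars and linear extension\<close>

text \<open>The weight found is \<open>l - mu_dot \<mu> \<gamma>\<close>. Its space is large because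
  the lexicographic order is not Archimedean once there are two coordinates: - \<gamma> is the sum
  of the negative weights k \<beta> - \<gamma> and - k \<beta> for every k > 0. Three families of
  vectors and functionals are needed because each Gram matrix sees only part of the highest weight:
  e against e detects l and c1, h against h detects c3, and e against h detects c0 and c2, the last
  being triangular when c3 = 0. In the first family the entries beyond the diagonal do not vanish
  but are quadratic in j, which is why differences of order three appear. Genericity separates the
  eigenvalue of \<open>d_mu\<close> on the highest weight vector from those of all other lattice
  weights, and it makes the relevant values of \<open>mu_dot \<mu>\<close> nonzero. Everything is
  computed in the tensor algebra. A module enters only through a quotient map from it, so the coset
  constructions of the Verma module are dealt with once, for both signs.\<close>

definition scal :: "complex \<Rightarrow> ('b \<Rightarrow>\<^sub>0 complex) \<Rightarrow> 'b \<Rightarrow>\<^sub>0 complex" where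
  "scal c s = cscale c s"

lemma lookup_scal: "Poly_Mapping.lookup (scal c s) k = c * Poly_Mapping.lookup s k"
  unfolding scal_def by transfer (simp add: when_def)

lemma scal_simps [simp]:
  "scal 0 s = 0" "scal 1 s = s" "scal c 0 = 0"
  "scal c (scal d s) = scal (c * d) s"
  "scal c (Poly_Mapping.single a d) = Poly_Mapping.single a (c * d)"
  by (auto intro!: poly_mapping_eqI simp: lookup_scal lookup_single when_def)

lemma scal_add: "scal c (s + t) = scal c s + scal c t"
  by (rule poly_mapping_eqI) (simp add: lookup_scal lookup_add algebra_simps)

lemma scal_add_left: "scal (c + d) s = scal c s + scal d s"
  by (rule poly_mapping_eqI) (simp add: lookup_scal lookup_add algebra_simps)

lemma scal_minus: "scal c (- s) = - scal c s" "scal (- c) s = - scal c s"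
  by (auto intro!: poly_mapping_eqI simp: lookup_scal)

lemma scal_diff: "scal c (s - t) = scal c s - scal c t"
  by (rule poly_mapping_eqI) (simp add: lookup_scal lookup_minus algebra_simps)

lemma scal_sum: "scal c (sum f A) = (\<Sum>a\<in>A. scal c (f a))"
  by (induction A rule: infinite_finite_induct) (auto simp: scal_add)

lemma scal_eq_single_mult: "scal c t = Poly_Mapping.single 0 c * (t :: 'b :: monoid_add \<Rightarrow>\<^sub>0 complex)"
  using mult_map_scale_conv_mult[of c t] by (simp add: scal_def)

text \<open>The algebra is not commutative, but scalars sit at the neutral element of the monoid.
  The induction builds \<open>t\<close> up by one new key at a time.\<close>

lemma single_0_mult_commute:
  "Poly_Mapping.single 0 c * t = t * Poly_Mapping.single 0 (c :: complex)"
  for t :: "'b :: monoid_add \<Rightarrow>\<^sub>0 complex"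
proof (induction t rule: update_induct)
  case const then show ?case by simp
next
  case (update f a b)
  have "Poly_Mapping.update a b f = f + Poly_Mapping.single a b"
    using update by (auto intro!: poly_mapping_eqI simp: lookup_update lookup_add lookup_single in_keys_iff)
  then show ?case
    by (simp add: update.IH distrib_left distrib_right mult_single mult.commute)
qed

lemma scal_mult:
  fixes s t :: "'b :: monoid_add \<Rightarrow>\<^sub>0 complex"
  shows "scal c s * t = scal c (s * t)" "s * scal c t = scal c (s * t)"
  by (simp add: scal_eq_single_mult mult.assoc) (simp add: scal_eq_single_mult single_0_mult_commute[of c] mult.assoc)

text \<open>\<open>is_linear\<close> is relative to a scaling \<open>sc\<close> of the target, so that it covers both scalar-valued
  and vector-valued maps.\<close>

definition is_linear :: "(complex \<Rightarrow> 'c \<Rightarrow> 'c) \<Rightarrow> (('b \<Rightarrow>\<^sub>0 complex) \<Rightarrow> 'c :: ab_group_add) \<Rightarrow> bool" where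
  "is_linear sc F \<longleftrightarrow> (\<forall>s t. F (s + t) = F s + F t) \<and> (\<forall>c s. F (scal c s) = sc c (F s))"

lemma is_linearI:
  assumes "\<And>s t. F (s + t) = F s + F t" "\<And>c s. F (scal c s) = sc c (F s)"
  shows "is_linear sc F"
  using assms by (simp add: is_linear_def)

lemma is_linear_add: "is_linear sc F \<Longrightarrow> F (s + t) = F s + F t"
  and is_linear_scal: "is_linear sc F \<Longrightarrow> F (scal c s) = sc c (F s)"
  by (simp_all add: is_linear_def)

lemma is_linear_0: "is_linear sc F \<Longrightarrow> F 0 = 0"
  using is_linear_add[of sc F 0 0] by simp

lemma is_linear_minus: "is_linear sc F \<Longrightarrow> F (- s) = - F s"
  using is_linear_add[of sc F s "- s"] is_linear_0[of sc F] by (simp add: eq_neg_iff_add_eq_0 add.commute)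

lemma is_linear_diff: "is_linear sc F \<Longrightarrow> F (s - t) = F s - F t"
  using is_linear_add[of sc F s "- t"] is_linear_minus[of sc F t] by simp

lemma is_linear_sum: "is_linear sc F \<Longrightarrow> F (sum f A) = (\<Sum>a\<in>A. F (f a))"
  by (induction A rule: infinite_finite_induct) (auto simp: is_linear_add is_linear_0)

lemma sum_single: "(\<Sum>a\<in>Poly_Mapping.keys s. Poly_Mapping.single a (Poly_Mapping.lookup s a)) = s"
  for s :: "'b \<Rightarrow>\<^sub>0 complex"
proof (rule poly_mapping_eqI)
  fix k
  show "Poly_Mapping.lookup (\<Sum>a\<in>Poly_Mapping.keys s. Poly_Mapping.single a (Poly_Mapping.lookup s a)) k = Poly_Mapping.lookup s k"
    by (simp add: lookup_sum lookup_single when_def in_keys_iff)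
qed

lemma is_linear_expand:
  assumes "is_linear sc F"
  shows "F s = (\<Sum>a\<in>Poly_Mapping.keys s. sc (Poly_Mapping.lookup s a) (F (Poly_Mapping.single a 1)))"
proof -
  have "F s = F (\<Sum>a\<in>Poly_Mapping.keys s. scal (Poly_Mapping.lookup s a) (Poly_Mapping.single a 1))"
    by (simp add: sum_single)
  also have "\<dots> = (\<Sum>a\<in>Poly_Mapping.keys s. sc (Poly_Mapping.lookup s a) (F (Poly_Mapping.single a 1)))"
    by (simp only: is_linear_sum[OF assms] is_linear_scal[OF assms])
  finally show ?thesis .
qed

text \<open>Comparing only on the support of \<open>s\<close> lets hypotheses on that support enter,
  such as lying in the Borel subalgebra or having a given word length.\<close>

lemma is_linear_eq_on_keys:
  assumes "is_linear sc F" "is_linear sc G"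
    and "\<And>a. a \<in> Poly_Mapping.keys s \<Longrightarrow> F (Poly_Mapping.single a 1) = G (Poly_Mapping.single a 1)"
  shows "F s = G s"
  by (simp add: is_linear_expand[OF assms(1), of s] is_linear_expand[OF assms(2), of s] assms(3))

lemma is_linear_ext:
  fixes sc :: "complex \<Rightarrow> 'c \<Rightarrow> 'c :: ab_group_add"
  assumes "\<And>c x y. sc c (x + y) = sc c x + sc c y" "\<And>c d x. sc (c + d) x = sc c x + sc d x"
    "\<And>c d x. sc c (sc d x) = sc (c * d) x" "\<And>c. sc c 0 = 0" "\<And>x. sc 0 x = 0"
  shows "is_linear sc (\<lambda>s. \<Sum>a\<in>Poly_Mapping.keys s. sc (Poly_Mapping.lookup s a) (f a))"
proof (rule is_linearI)
  fix s t :: "'a \<Rightarrow>\<^sub>0 complex" and c :: complex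
  have sc_sum: "sc c (sum g A) = (\<Sum>a\<in>A. sc c (g a))" for g :: "'b \<Rightarrow> 'c" and A
    by (induction A rule: infinite_finite_induct) (simp_all add: assms)
  show "(\<Sum>a\<in>Poly_Mapping.keys (s + t). sc (Poly_Mapping.lookup (s + t) a) (f a)) =
      (\<Sum>a\<in>Poly_Mapping.keys s. sc (Poly_Mapping.lookup s a) (f a)) +
      (\<Sum>a\<in>Poly_Mapping.keys t. sc (Poly_Mapping.lookup t a) (f a))"
    by (rule setsum_keys_plus_distrib) (simp_all add: assms)
  have sub: "Poly_Mapping.keys (scal c s) \<subseteq> Poly_Mapping.keys s"
    by (auto simp: in_keys_iff lookup_scal)
  have "(\<Sum>a\<in>Poly_Mapping.keys (scal c s). sc (Poly_Mapping.lookup (scal c s) a) (f a)) =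
      (\<Sum>a\<in>Poly_Mapping.keys s. sc (Poly_Mapping.lookup (scal c s) a) (f a))"
    using sub by (intro sum.mono_neutral_left) (auto simp: in_keys_iff assms)
  also have "\<dots> = (\<Sum>a\<in>Poly_Mapping.keys s. sc c (sc (Poly_Mapping.lookup s a) (f a)))"
    by (simp add: lookup_scal assms)
  also have "\<dots> = sc c (\<Sum>a\<in>Poly_Mapping.keys s. sc (Poly_Mapping.lookup s a) (f a))"
    by (rule sc_sum[symmetric])
  finally show "(\<Sum>a\<in>Poly_Mapping.keys (scal c s). sc (Poly_Mapping.lookup (scal c s) a) (f a)) =
      sc c (\<Sum>a\<in>Poly_Mapping.keys s. sc (Poly_Mapping.lookup s a) (f a))" .
qed

section \<open>The bracket\<close>

lemma is_linear_scalI: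
  "is_linear scal (\<lambda>s. \<Sum>a\<in>Poly_Mapping.keys s. scal (Poly_Mapping.lookup s a) (f a))"
  by (rule is_linear_ext) (simp_all add: scal_add scal_add_left)

lemma is_linear_timesI:
  "is_linear (*) (\<lambda>s. \<Sum>a\<in>Poly_Mapping.keys s. Poly_Mapping.lookup s a * f a)"
  for f :: "'a \<Rightarrow> complex"
  by (rule is_linear_ext) (simp_all add: algebra_simps)

lemma iota_scal: "iota x = (\<Sum>a\<in>Poly_Mapping.keys x. scal (Poly_Mapping.lookup x a) (Poly_Mapping.single (Word [a]) 1))"
  by (simp add: iota_def)

lemma is_linear_iota: "is_linear scal iota"
  unfolding iota_scal[abs_def] by (rule is_linear_scalI)

lemma iota_single: "iota (Poly_Mapping.single a c) = Poly_Mapping.single (Word [a]) c"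
  by (cases "c = 0") (simp_all add: iota_def)

lemma bracket_scal:
  "bracket \<mu> x y = (\<Sum>a\<in>Poly_Mapping.keys x. scal (Poly_Mapping.lookup x a)
     (\<Sum>b\<in>Poly_Mapping.keys y. scal (Poly_Mapping.lookup y b) (basis_bracket \<mu> a b)))"
  by (simp add: bracket_def scal_sum scal_def[symmetric])

lemma is_linear_bracket_left: "is_linear scal (\<lambda>x. bracket \<mu> x y)"
  unfolding bracket_scal[abs_def] by (rule is_linear_scalI)

lemma bracket_single_left:
  "bracket \<mu> (Poly_Mapping.single a 1) y = (\<Sum>b\<in>Poly_Mapping.keys y. scal (Poly_Mapping.lookup y b) (basis_bracket \<mu> a b))"
  by (simp add: bracket_scal)

text \<open>In \<open>bracket_scal\<close> the second argument is buried in the sum over the first,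
  so linearity is obtained for basis vectors on the left and then summed.\<close>

lemma is_linear_bracket_right: "is_linear scal (bracket \<mu> x)"
proof (rule is_linearI)
  fix s t c
  have 1: "is_linear scal (bracket \<mu> (Poly_Mapping.single a 1))" for a
    unfolding bracket_single_left[abs_def] by (rule is_linear_scalI)
  note e = is_linear_expand[OF is_linear_bracket_left, of \<mu> x]
  show "bracket \<mu> x (s + t) = bracket \<mu> x s + bracket \<mu> x t"
    by (simp add: e is_linear_add[OF 1] scal_add sum.distrib)
  show "bracket \<mu> x (scal c s) = scal c (bracket \<mu> x s)"
    by (simp add: e is_linear_scal[OF 1] scal_sum mult.commute)
qed

lemmas bracket_simps =
  is_linear_add[OF is_linear_bracket_left] is_linear_add[OF is_linear_bracket_right]
  is_linear_scal[OF is_linear_bracket_left] is_linear_scal[OF is_linear_bracket_right]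
  is_linear_minus[OF is_linear_bracket_left] is_linear_minus[OF is_linear_bracket_right]
  is_linear_diff[OF is_linear_bracket_left] is_linear_diff[OF is_linear_bracket_right]
  is_linear_0[OF is_linear_bracket_left] is_linear_0[OF is_linear_bracket_right]

lemmas iota_simps =
  is_linear_add[OF is_linear_iota] is_linear_scal[OF is_linear_iota]
  is_linear_minus[OF is_linear_iota] is_linear_diff[OF is_linear_iota] is_linear_0[OF is_linear_iota]

lemma bracket_single_single [simp]:
  "bracket \<mu> (Poly_Mapping.single a c) (Poly_Mapping.single b d) = scal (c * d) (basis_bracket \<mu> a b)"
  by (cases "c = 0"; cases "d = 0") (simp_all add: bracket_scal bracket_simps)

lemma mu_dot_simps [simp]:
  "mu_dot \<mu> (\<alpha> + \<beta>) = mu_dot \<mu> \<alpha> + mu_dot \<mu> \<beta>" "mu_dot \<mu> (\<alpha> - \<beta>) = mu_dot \<mu> \<alpha> - mu_dot \<mu> \<beta>"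
  "mu_dot \<mu> (- \<alpha>) = - mu_dot \<mu> \<alpha>" "mu_dot \<mu> 0 = 0" "mu_dot \<mu> (k *s \<alpha>) = of_int k * mu_dot \<mu> \<alpha>"
  by (simp_all add: mu_dot_def sum.distrib sum_subtractf sum_negf algebra_simps sum_distrib_left)

section \<open>Antisymmetry and the Jacobi identity\<close>

lemma basis_bracket_antisym: "basis_bracket \<mu> b a = - basis_bracket \<mu> a b"
proof (cases a; cases b)
  fix \<alpha> \<beta> assume *: "a = E \<alpha>" "b = E \<beta>"
  have "\<beta> = - \<alpha> \<longleftrightarrow> \<alpha> = - \<beta>" by auto
  then show ?thesis
    by (auto simp: * add.commute algebra_simps power3_eq_cube diff_divide_distrib simp flip: single_uminus single_diff single_add)
next
  fix \<alpha> \<beta> assume *: "a = H \<alpha>" "b = H \<beta>"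
  have "\<beta> = - \<alpha> \<longleftrightarrow> \<alpha> = - \<beta>" by auto
  then show ?thesis
    by (auto simp: * simp flip: single_uminus)
qed auto

definition jacobi :: "complex ^ 'n \<Rightarrow> 'n hvir \<Rightarrow> 'n hvir \<Rightarrow> 'n hvir \<Rightarrow> bool" where
  "jacobi \<mu> x y z \<longleftrightarrow> bracket \<mu> x (bracket \<mu> y z) = bracket \<mu> (bracket \<mu> x y) z + bracket \<mu> y (bracket \<mu> x z)"

lemma mu_dot_numeral [simp]: "mu_dot \<mu> (numeral k * \<beta>) = numeral k * mu_dot \<mu> \<beta>"
  "mu_dot \<mu> (\<beta> * numeral k) = mu_dot \<mu> \<beta> * numeral k"
proof -
  have "(numeral k :: int ^ 'a) $ i = numeral k" for i
    by (metis of_nat_index of_nat_numeral)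
  then show "mu_dot \<mu> (numeral k * \<beta>) = numeral k * mu_dot \<mu> \<beta>"
    "mu_dot \<mu> (\<beta> * numeral k) = mu_dot \<mu> \<beta> * numeral k"
    by (simp_all add: mu_dot_def sum_distrib_left sum_distrib_right algebra_simps)
qed

text \<open>Moves the case distinction of a cocycle into the coefficient, so that iterated brackets
  can be expanded before any case is split.\<close>

lemma if_single: "(if c then Poly_Mapping.single k x else 0) = Poly_Mapping.single k (if c then x else 0)"
  by simp

lemma basis_bracket_central:
  "a \<in> {C1, C2, C3} \<Longrightarrow> basis_bracket \<mu> a b = 0" "b \<in> {C1, C2, C3} \<Longrightarrow> basis_bracket \<mu> a b = 0"
   by (cases b; auto) (cases a; auto)

lemmas basis_bracket_single = basis_bracket.simps[unfolded if_single]

text \<open>If \<open>\<alpha> + \<beta> + \<gamma> = 0\<close> then only the cocycles matter, otherwise only the centreless part.\<close>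

lemma jacobi_EEE:
  "jacobi \<mu> (Poly_Mapping.single (E \<alpha>) 1) (Poly_Mapping.single (E \<beta>) 1) (Poly_Mapping.single (E \<gamma>) 1)"
proof (cases "\<alpha> + \<beta> + \<gamma> = 0")
  case True
  then have g: "\<gamma> = - \<alpha> - \<beta>" by (metis add.commute add_diff_cancel_left' diff_0 diff_diff_add)
  show ?thesis
    unfolding jacobi_def g
    apply (simp add: basis_bracket_single basis_bracket_central bracket_simps scal_add scal_diff algebra_simps del: basis_bracket.simps split del: if_split)
    apply (rule poly_mapping_eqI)
    apply (simp add: lookup_add lookup_single when_def field_simps power3_eq_cube)
    done
next
  case False
  then have "\<alpha> + \<beta> \<noteq> - \<gamma>" "\<alpha> \<noteq> - (\<beta> + \<gamma>)" "\<beta> \<noteq> - (\<alpha> + \<gamma>)"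
    by (auto simp: eq_neg_iff_add_eq_0 ac_simps)
  then show ?thesis unfolding jacobi_def
    by (simp add: bracket_simps scal_add scal_diff ac_simps flip: single_add) (simp add: algebra_simps)
qed

lemma jacobi_EEH:
  "jacobi \<mu> (Poly_Mapping.single (E \<alpha>) 1) (Poly_Mapping.single (E \<beta>) 1) (Poly_Mapping.single (H \<gamma>) 1)"
proof (cases "\<alpha> + \<beta> + \<gamma> = 0")
  case True
  then have g: "\<gamma> = - \<alpha> - \<beta>" by (metis add.commute add_diff_cancel_left' diff_0 diff_diff_add)
  show ?thesis
    unfolding jacobi_def g
    apply (simp add: basis_bracket_single basis_bracket_central bracket_simps scal_add scal_diff algebra_simps del: basis_bracket.simps split del: if_split)
    apply (rule poly_mapping_eqI)
    apply (simp add: lookup_add lookup_single when_def field_simps power2_eq_square)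
    done
next
  case False
  then have "\<alpha> + \<beta> \<noteq> - \<gamma>" "\<alpha> \<noteq> - (\<beta> + \<gamma>)" "\<beta> \<noteq> - (\<alpha> + \<gamma>)"
    by (auto simp: eq_neg_iff_add_eq_0 ac_simps)
  then show ?thesis unfolding jacobi_def
    by (simp add: bracket_simps scal_add scal_diff ac_simps flip: single_add) (simp add: algebra_simps)
qed

lemma jacobi_EHH:
  "jacobi \<mu> (Poly_Mapping.single (E \<alpha>) 1) (Poly_Mapping.single (H \<beta>) 1) (Poly_Mapping.single (H \<gamma>) 1)"
proof (cases "\<alpha> + \<beta> + \<gamma> = 0")
  case True
  then have g: "\<gamma> = - \<alpha> - \<beta>" by (metis add.commute add_diff_cancel_left' diff_0 diff_diff_add)
  show ?thesis
    unfolding jacobi_def g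
    apply (simp add: basis_bracket_single basis_bracket_central bracket_simps scal_add scal_diff algebra_simps del: basis_bracket.simps split del: if_split)
    apply (rule poly_mapping_eqI)
    apply (simp add: lookup_add lookup_single when_def field_simps power2_eq_square)
    done
next
  case False
  then have "\<alpha> + \<beta> \<noteq> - \<gamma>" "\<alpha> \<noteq> - (\<beta> + \<gamma>)" "\<beta> \<noteq> - (\<alpha> + \<gamma>)"
    by (auto simp: eq_neg_iff_add_eq_0 ac_simps)
  then show ?thesis unfolding jacobi_def
    by (simp add: bracket_simps scal_add scal_diff ac_simps flip: single_add)
qed

lemma bracket_antisym: "bracket \<mu> y x = - bracket \<mu> x y"
proof -
  have 1: "bracket \<mu> y (Poly_Mapping.single a 1) = - bracket \<mu> (Poly_Mapping.single a 1) y" for y a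
    by (rule is_linear_eq_on_keys[where sc = scal])
      (auto simp: bracket_simps basis_bracket_antisym[of _ a] scal_minus intro!: is_linearI)
  show ?thesis
    by (rule is_linear_eq_on_keys[where sc = scal])
      (auto simp: bracket_simps 1 scal_minus intro!: is_linearI)
qed

text \<open>By antisymmetry the identity is cyclic. Up to rotation, three letters of the two
  noncentral kinds have one arrangement for each number of \<open>H\<close> letters, so four
  computations suffice.\<close>

lemma jacobi_rotate: "jacobi \<mu> x y z \<Longrightarrow> jacobi \<mu> y z x"
  using bracket_antisym[of \<mu> z x] bracket_antisym[of \<mu> "bracket \<mu> y z" x]
    bracket_antisym[of \<mu> z "bracket \<mu> y x"] bracket_antisym[of \<mu> x y]
  by (simp add: jacobi_def bracket_simps algebra_simps)

lemma jacobi_central: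
  assumes "d \<in> {C1, C2, C3}"
  shows "jacobi \<mu> (Poly_Mapping.single d 1) x y"
proof -
  have z: "bracket \<mu> (Poly_Mapping.single d 1) x = 0" for x
    using assms by (simp add: bracket_scal basis_bracket_central)
  then show ?thesis by (simp add: jacobi_def bracket_simps)
qed

lemma jacobi_basis:
  "jacobi \<mu> (Poly_Mapping.single a 1) (Poly_Mapping.single b 1) (Poly_Mapping.single c 1)"
proof -
  have HHH: "jacobi \<mu> (Poly_Mapping.single (H \<alpha>) 1) (Poly_Mapping.single (H \<beta>) 1) (Poly_Mapping.single (H \<gamma>) 1)"
    for \<alpha> \<beta> \<gamma>
    by (simp add: jacobi_def bracket_simps basis_bracket_central)
  note J = jacobi_EEE jacobi_EEH jacobi_EHH HHH jacobi_central
  show ?thesis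
    by (cases a; cases b; cases c) (simp_all add: J J[THEN jacobi_rotate] J[THEN jacobi_rotate, THEN jacobi_rotate])
qed

lemma bracket_jacobi:
  "bracket \<mu> x (bracket \<mu> y z) = bracket \<mu> (bracket \<mu> x y) z + bracket \<mu> y (bracket \<mu> x z)"
proof -
  have lin: "is_linear scal (\<lambda>x. bracket \<mu> x (bracket \<mu> y z))" "is_linear scal (\<lambda>y. bracket \<mu> x (bracket \<mu> y z))"
    "is_linear scal (\<lambda>z. bracket \<mu> x (bracket \<mu> y z))"
    "is_linear scal (\<lambda>x. bracket \<mu> (bracket \<mu> x y) z + bracket \<mu> y (bracket \<mu> x z))"
    "is_linear scal (\<lambda>y. bracket \<mu> (bracket \<mu> x y) z + bracket \<mu> y (bracket \<mu> x z))"
    "is_linear scal (\<lambda>z. bracket \<mu> (bracket \<mu> x y) z + bracket \<mu> y (bracket \<mu> x z))" for x y z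
    by (auto intro!: is_linearI simp: bracket_simps scal_add)
  have 1: "bracket \<mu> (Poly_Mapping.single a 1) (bracket \<mu> (Poly_Mapping.single b 1) z) =
      bracket \<mu> (bracket \<mu> (Poly_Mapping.single a 1) (Poly_Mapping.single b 1)) z +
      bracket \<mu> (Poly_Mapping.single b 1) (bracket \<mu> (Poly_Mapping.single a 1) z)" for a b
    by (rule is_linear_eq_on_keys[OF lin(3,6)]) (rule jacobi_basis[unfolded jacobi_def])
  have 2: "bracket \<mu> (Poly_Mapping.single a 1) (bracket \<mu> y z) =
      bracket \<mu> (bracket \<mu> (Poly_Mapping.single a 1) y) z +
      bracket \<mu> y (bracket \<mu> (Poly_Mapping.single a 1) z)" for a
    by (rule is_linear_eq_on_keys[OF lin(2,5)]) (rule 1)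
  show ?thesis
    by (rule is_linear_eq_on_keys[OF lin(1,4)]) (rule 2)
qed

section \<open>Derivations of the tensor algebra\<close>

abbreviation wd :: "'b list \<Rightarrow> 'b free_word \<Rightarrow>\<^sub>0 complex" where
  "wd xs \<equiv> Poly_Mapping.single (Word xs) 1"

abbreviation bv :: "'n hv_basis \<Rightarrow> 'n hvir" where
  "bv a \<equiv> Poly_Mapping.single a 1"

lemma wd_Nil: "wd [] = 1"
  by (simp flip: zero_free_word_def)

lemma single_Word_mult:
  "Poly_Mapping.single (Word xs) c * Poly_Mapping.single (Word ys) d = Poly_Mapping.single (Word (xs @ ys)) (c * d)"
  for c d :: complex
  by (simp add: mult_single plus_free_word_def)

lemma wd_append: "wd (xs @ ys) = wd xs * wd ys"
  by (simp add: single_Word_mult iota_single)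

lemma wd_Cons: "wd (x # xs) = iota (bv x) * wd xs"
  by (simp add: single_Word_mult iota_single)

lemma tensor_eqI:
  assumes "is_linear sc F" "is_linear sc G" "\<And>xs. F (wd xs) = G (wd xs)"
  shows "F t = G t"
proof (rule is_linear_eq_on_keys[OF assms(1,2)])
  fix w
  show "F (Poly_Mapping.single w 1) = G (Poly_Mapping.single w 1)"
    using assms(3)[of "letters w"] by simp
qed

text \<open>The adjoint action of \<open>x\<close> extended by the Leibniz rule. Modulo the Lie
  relations it is the commutator with \<open>x\<close>, but written with words of unchanged
  length.\<close>

fun der_word :: "complex ^ 'n \<Rightarrow> 'n hvir \<Rightarrow> 'n hv_basis list \<Rightarrow> 'n hv_tensor" where
  "der_word \<mu> x [] = 0"
| "der_word \<mu> x (y # ys) = iota (bracket \<mu> x (bv y)) * wd ys + iota (bv y) * der_word \<mu> x ys"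

definition der :: "complex ^ 'n \<Rightarrow> 'n hvir \<Rightarrow> 'n hv_tensor \<Rightarrow> 'n hv_tensor" where
  "der \<mu> x t = (\<Sum>w\<in>Poly_Mapping.keys t. scal (Poly_Mapping.lookup t w) (der_word \<mu> x (letters w)))"

lemma is_linear_der: "is_linear scal (der \<mu> x)"
  unfolding der_def[abs_def] by (rule is_linear_scalI)

lemma der_wd [simp]: "der \<mu> x (wd xs) = der_word \<mu> x xs"
  by (simp add: der_def)

lemma der_wd_Cons:
  "der \<mu> x (iota (bv a) * wd xs) = iota (bracket \<mu> x (bv a)) * wd xs + iota (bv a) * der \<mu> x (wd xs)"
  unfolding wd_Cons[symmetric] der_wd by simp

lemma der_one [simp]: "der \<mu> x 1 = 0"
  by (simp flip: wd_Nil)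

lemmas der_simps = is_linear_add[OF is_linear_der] is_linear_scal[OF is_linear_der]
  is_linear_minus[OF is_linear_der] is_linear_diff[OF is_linear_der] is_linear_0[OF is_linear_der]

lemma is_linear_multI:
  fixes F G :: "('a \<Rightarrow>\<^sub>0 complex) \<Rightarrow> 'b :: monoid_add \<Rightarrow>\<^sub>0 complex"
  shows "is_linear scal F \<Longrightarrow> is_linear scal (\<lambda>t. F t * u)"
    "is_linear scal F \<Longrightarrow> is_linear scal (\<lambda>t. u * F t)"
    "is_linear scal F \<Longrightarrow> is_linear scal G \<Longrightarrow> is_linear scal (\<lambda>t. F t + G t)"
    "is_linear scal F \<Longrightarrow> is_linear scal G \<Longrightarrow> is_linear scal (\<lambda>t. F t - G t)"
    "is_linear scal (\<lambda>t. t)"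
  by (auto simp: is_linear_def algebra_simps scal_mult scal_add scal_diff)

lemma is_linear_comp: "is_linear sc F \<Longrightarrow> is_linear scal G \<Longrightarrow> is_linear sc (\<lambda>t. F (G t))"
  by (auto simp: is_linear_def)

lemma der_mult: "der \<mu> x (s * t) = der \<mu> x s * t + s * der \<mu> x t"
proof -
  have lin: "is_linear scal (\<lambda>t. der \<mu> x (s * t))" "is_linear scal (\<lambda>t. der \<mu> x s * t + s * der \<mu> x t)"
    "is_linear scal (\<lambda>s. der \<mu> x (s * t))" "is_linear scal (\<lambda>s. der \<mu> x s * t + s * der \<mu> x t)" for s t
    by (intro is_linear_multI is_linear_der is_linear_comp[OF is_linear_der])+
  have 1: "der \<mu> x (wd xs * wd ys) = der \<mu> x (wd xs) * wd ys + wd xs * der \<mu> x (wd ys)" for xs ys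
  proof (induction xs)
    case Nil then show ?case by (simp add: wd_Nil)
  next
    case (Cons a xs)
    have "der \<mu> x (wd (a # xs) * wd ys) = der \<mu> x (iota (bv a) * wd (xs @ ys))"
      by (simp add: wd_append wd_Cons mult.assoc)
    also have "\<dots> = iota (bracket \<mu> x (bv a)) * wd (xs @ ys) + iota (bv a) * der \<mu> x (wd xs * wd ys)"
      unfolding wd_append[symmetric] by (rule der_wd_Cons)
    also have "\<dots> = der \<mu> x (wd (a # xs)) * wd ys + wd (a # xs) * der \<mu> x (wd ys)"
      unfolding wd_append Cons wd_Cons der_wd_Cons by (simp add: algebra_simps)
    finally show ?case .
  qed
  have 2: "der \<mu> x (wd xs * t) = der \<mu> x (wd xs) * t + wd xs * der \<mu> x t" for xs
    by (rule tensor_eqI[OF lin(1,2)]) (rule 1)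
  show ?thesis by (rule tensor_eqI[OF lin(3,4)]) (rule 2)
qed

lemma der_iota: "der \<mu> x (iota y) = iota (bracket \<mu> x y)"
proof (rule is_linear_eq_on_keys[where F = "\<lambda>y. der \<mu> x (iota y)"])
  show "is_linear scal (\<lambda>y. der \<mu> x (iota y))" "is_linear scal (\<lambda>y. iota (bracket \<mu> x y))"
    by (rule is_linear_comp[OF is_linear_der is_linear_iota] is_linear_comp[OF is_linear_iota is_linear_bracket_right])+
  show "der \<mu> x (iota (bv a)) = iota (bracket \<mu> x (bv a))" for a
    using der_wd_Cons[of \<mu> x a "[]"] by (simp add: wd_Nil)
qed

lemma is_linear_der_left: "is_linear scal (\<lambda>x. der \<mu> x t)"
proof -
  have "is_linear scal (\<lambda>x. der_word \<mu> x xs)" for xs :: "'a hv_basis list"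
  proof (induction xs)
    case Nil show ?case by (simp add: is_linear_def)
  next
    case (Cons a xs) then show ?case
      by (simp) (intro is_linear_multI is_linear_comp[OF is_linear_iota] is_linear_bracket_left)
  qed
  then show ?thesis
    by (simp add: is_linear_def der_def scal_add sum.distrib scal_sum mult.commute)
qed

text \<open>The Jacobi identity on letters lifts to tensors because the commutator of two
  derivations is again a derivation.\<close>

lemma der_commutator: "der \<mu> x (der \<mu> y t) - der \<mu> y (der \<mu> x t) = der \<mu> (bracket \<mu> x y) t"
proof (rule tensor_eqI[where F = "\<lambda>t. der \<mu> x (der \<mu> y t) - der \<mu> y (der \<mu> x t)"])
  show "is_linear scal (\<lambda>t. der \<mu> x (der \<mu> y t) - der \<mu> y (der \<mu> x t))" "is_linear scal (der \<mu> (bracket \<mu> x y))"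
    by (intro is_linear_multI is_linear_der is_linear_comp[OF is_linear_der])+
  fix xs
  show "der \<mu> x (der \<mu> y (wd xs)) - der \<mu> y (der \<mu> x (wd xs)) = der \<mu> (bracket \<mu> x y) (wd xs)"
  proof (induction xs)
    case (Cons a xs)
    \<comment> \<open>The two mixed terms are exchanged when \<open>x\<close> and \<open>y\<close>
      are swapped, so they cancel in the commutator.\<close>
    have 1: "der \<mu> x (der \<mu> y (iota (bv a) * t)) =
        iota (bracket \<mu> x (bracket \<mu> y (bv a))) * t + iota (bracket \<mu> y (bv a)) * der \<mu> x t +
        iota (bracket \<mu> x (bv a)) * der \<mu> y t + iota (bv a) * der \<mu> x (der \<mu> y t)" for x y t
      by (simp add: der_mult der_iota der_simps algebra_simps)
    have 2: "iota (bracket \<mu> (bracket \<mu> x y) (bv a)) =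
        iota (bracket \<mu> x (bracket \<mu> y (bv a))) - iota (bracket \<mu> y (bracket \<mu> x (bv a)))"
      by (simp add: bracket_jacobi[of \<mu> x y] iota_simps)
    have "der \<mu> x (der \<mu> y (wd (a # xs))) - der \<mu> y (der \<mu> x (wd (a # xs))) =
        iota (bracket \<mu> (bracket \<mu> x y) (bv a)) * wd xs +
        iota (bv a) * (der \<mu> x (der \<mu> y (wd xs)) - der \<mu> y (der \<mu> x (wd xs)))"
      unfolding wd_Cons 1 2 by (simp only: algebra_simps)
    also have "\<dots> = der \<mu> (bracket \<mu> x y) (wd (a # xs))"
      unfolding Cons.IH wd_Cons der_mult der_iota by (rule refl)
    finally show ?case .
  qed (simp add: der_simps)
qed

section \<open>Homogeneity in the word length\<close>

definition homog :: "nat \<Rightarrow> 'n hv_tensor \<Rightarrow> bool" where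
  "homog n t \<longleftrightarrow> (\<forall>w\<in>Poly_Mapping.keys t. length (letters w) = n)"

lemma homog_add: "homog n s \<Longrightarrow> homog n t \<Longrightarrow> homog n (s + t)"
  using keys_add[of s t] by (auto simp: homog_def)

lemma homog_wd: "homog (length xs) (wd xs)"
  by (simp add: homog_def)

lemma homog_mult:
  assumes "homog m s" "homog n t"
  shows "homog (m + n) (s * t)"
  unfolding homog_def
proof
  fix w assume "w \<in> Poly_Mapping.keys (s * t)"
  then obtain u v where "w = u + v" "u \<in> Poly_Mapping.keys s" "v \<in> Poly_Mapping.keys t"
    using keys_mult[of s t] by auto
  then show "length (letters w) = m + n"
    using assms by (auto simp: homog_def plus_free_word_def)
qed

lemma keys_iota: "Poly_Mapping.keys (iota x) \<subseteq> (\<lambda>a. Word [a]) ` Poly_Mapping.keys x"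
  unfolding iota_def by (rule order_trans[OF keys_sum]) auto

lemma homog_iota: "homog 1 (iota x)"
  using keys_iota[of x] by (auto simp: homog_def)

text \<open>A bracket replaces one letter by a combination of letters. This gives the termination of
  \<open>psi_word\<close> and drives the inductions on length.\<close>

lemma homog_der_word: "homog (length xs) (der_word \<mu> x xs)"
proof (induction xs)
  case (Cons a xs)
  have "homog (1 + length xs) (iota (bracket \<mu> x (bv a)) * wd xs)"
    "homog (1 + length xs) (iota (bv a) * der_word \<mu> x xs)"
    by (intro homog_mult homog_iota homog_wd Cons)+
  then show ?case
    by (simp add: homog_add)
qed (simp add: homog_def)

section \<open>The vacuum expectation\<close>

text \<open>The sum over the support is written out so that each recursive call is on a single word,
  whose length can serve as the measure.\<close>

function psi_word :: "complex ^ ('n::finite) \<Rightarrow> (int ^ 'n) set \<Rightarrow> hv_weight \<Rightarrow> 'n hv_basis list \<Rightarrow> complex" where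
  "psi_word \<mu> P lam [] = 1"
| "psi_word \<mu> P lam (x # xs) = (if x \<in> borel_basis P then
     weight_char lam x * psi_word \<mu> P lam xs +
     (\<Sum>w\<in>Poly_Mapping.keys (der_word \<mu> (bv x) xs).
        Poly_Mapping.lookup (der_word \<mu> (bv x) xs) w * psi_word \<mu> P lam (letters w))
     else 0)"
  by pat_completeness auto
termination
proof (relation "measure (\<lambda>(\<mu>, P, lam, xs). length xs)")
  fix \<mu> :: "complex ^ ('n::finite)" and P lam x xs w
  assume "w \<in> Poly_Mapping.keys (der_word \<mu> (bv x) xs)"
  then show "((\<mu>, P, lam, letters w), (\<mu>, P, lam, x # xs)) \<in> measure (\<lambda>(\<mu>, P, lam, xs). length xs)"
    using homog_der_word[of xs \<mu> "bv x"] by (auto simp: homog_def)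
qed auto

definition psi :: "complex ^ ('n::finite) \<Rightarrow> (int ^ 'n) set \<Rightarrow> hv_weight \<Rightarrow> 'n hv_tensor \<Rightarrow> complex" where
  "psi \<mu> P lam t = (\<Sum>w\<in>Poly_Mapping.keys t. Poly_Mapping.lookup t w * psi_word \<mu> P lam (letters w))"

lemma is_linear_psi: "is_linear (*) (psi \<mu> P lam)"
  unfolding psi_def[abs_def] by (rule is_linear_timesI)

lemma psi_wd [simp]: "psi \<mu> P lam (wd xs) = psi_word \<mu> P lam xs"
  by (simp add: psi_def)

lemma psi_one [simp]: "psi \<mu> P lam 1 = 1"
  using psi_wd[of \<mu> P lam "[]"] by (simp add: wd_Nil)

lemmas psi_simps = is_linear_add[OF is_linear_psi] is_linear_scal[OF is_linear_psi]
  is_linear_minus[OF is_linear_psi] is_linear_diff[OF is_linear_psi] is_linear_0[OF is_linear_psi]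

lemma is_linear_timesI':
  fixes F G :: "('a \<Rightarrow>\<^sub>0 complex) \<Rightarrow> complex"
  shows "is_linear (*) F \<Longrightarrow> is_linear (*) (\<lambda>t. c * F t)"
    "is_linear (*) F \<Longrightarrow> is_linear (*) G \<Longrightarrow> is_linear (*) (\<lambda>t. F t + G t)"
    "is_linear (*) (\<lambda>t :: 'a \<Rightarrow>\<^sub>0 complex. 0 :: complex)"
  by (auto simp: is_linear_def algebra_simps)

lemma psi_borel_mult:
  assumes "x \<in> borel_basis P"
  shows "psi \<mu> P lam (iota (bv x) * t) = weight_char lam x * psi \<mu> P lam t + psi \<mu> P lam (der \<mu> (bv x) t)"
proof (rule tensor_eqI[where F = "\<lambda>t. psi \<mu> P lam (iota (bv x) * t)"])
  show "is_linear (*) (\<lambda>t. psi \<mu> P lam (iota (bv x) * t))"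
    "is_linear (*) (\<lambda>t. weight_char lam x * psi \<mu> P lam t + psi \<mu> P lam (der \<mu> (bv x) t))"
    by (intro is_linear_timesI' is_linear_psi is_linear_comp[OF is_linear_psi] is_linear_multI is_linear_der)+
  show "psi \<mu> P lam (iota (bv x) * wd xs) =
      weight_char lam x * psi \<mu> P lam (wd xs) + psi \<mu> P lam (der \<mu> (bv x) (wd xs))" for xs
    using assms by (simp flip: wd_Cons add: psi_def[of _ _ _ "der_word _ _ _"])
qed

lemma psi_non_borel_mult:
  assumes "x \<notin> borel_basis P"
  shows "psi \<mu> P lam (iota (bv x) * t) = 0"
proof (rule tensor_eqI[where F = "\<lambda>t. psi \<mu> P lam (iota (bv x) * t)"])
  show "is_linear (*) (\<lambda>t. psi \<mu> P lam (iota (bv x) * t))"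
    "is_linear (*) (\<lambda>t :: 'a hv_tensor. 0 :: complex)"
    by (intro is_linear_timesI' is_linear_psi is_linear_comp[OF is_linear_psi] is_linear_multI is_linear_der)+
  show "psi \<mu> P lam (iota (bv x) * wd xs) = 0" for xs
    using assms by (simp flip: wd_Cons)
qed

section \<open>Compatibility of the functional with the Lie relations\<close>

definition lie_rel :: "complex ^ 'n \<Rightarrow> 'n hvir \<Rightarrow> 'n hvir \<Rightarrow> 'n hv_tensor" where
  "lie_rel \<mu> x y = iota x * iota y - iota y * iota x - iota (bracket \<mu> x y)"

lemma is_linear_lie_rel: "is_linear scal (lie_rel \<mu> x)" "is_linear scal (\<lambda>x. lie_rel \<mu> x y)"
  by (auto intro!: is_linearI simp: lie_rel_def iota_simps bracket_simps algebra_simps scal_mult scal_diff scal_add)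

text \<open>By the Jacobi identity a derivation turns a relator into a sum of relators, so commuting
  a letter past a relator does not leave their span.\<close>

lemma der_lie_rel: "der \<mu> z (lie_rel \<mu> x y) = lie_rel \<mu> (bracket \<mu> z x) y + lie_rel \<mu> x (bracket \<mu> z y)"
  by (simp add: lie_rel_def der_simps der_mult der_iota bracket_jacobi[of \<mu> z x y] iota_simps algebra_simps)

lemma is_linear_zeroI:
  assumes "is_linear sc F" "\<And>a. a \<in> Poly_Mapping.keys s \<Longrightarrow> F (Poly_Mapping.single a 1) = 0"
    "\<And>c. sc c 0 = 0"
  shows "F s = 0"
  using is_linear_expand[OF assms(1), of s] assms(2,3) by simp

definition chi :: "hv_weight \<Rightarrow> ('n::finite) hvir \<Rightarrow> complex" where
  "chi lam x = (\<Sum>a\<in>Poly_Mapping.keys x. Poly_Mapping.lookup x a * weight_char lam a)"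

lemma is_linear_chi: "is_linear (*) (chi lam)"
  unfolding chi_def[abs_def] by (rule is_linear_timesI)

lemma chi_single: "chi lam (Poly_Mapping.single a c) = c * weight_char lam a"
  by (simp add: chi_def)

lemmas chi_simps = is_linear_add[OF is_linear_chi] is_linear_scal[OF is_linear_chi]
  is_linear_minus[OF is_linear_chi] is_linear_diff[OF is_linear_chi] is_linear_0[OF is_linear_chi]

lemma weight_char_E_neq_0: "\<alpha> \<noteq> 0 \<Longrightarrow> weight_char lam (E \<alpha>) = 0"
  and weight_char_H_neq_0: "\<alpha> \<noteq> 0 \<Longrightarrow> weight_char lam (H \<alpha>) = 0"
  by (cases lam; simp)+

text \<open>\<open>P\<close> is the positive cone of a total group order on the lattice.
  \<open>Delta_neg\<close> is the cone of the reversed lexicographic order, so lowest weight modules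
  are covered by the same argument.\<close>

locale hv_triangular =
  fixes \<mu> :: "complex ^ ('n::finite)" and P :: "(int ^ 'n) set" and lam :: hv_weight
  assumes gen: "generic \<mu>"
    and P_add: "\<alpha> \<in> P \<Longrightarrow> \<beta> \<in> P \<Longrightarrow> \<alpha> + \<beta> \<in> P"
    and P_zero: "0 \<notin> P"
    and P_total: "\<alpha> \<noteq> 0 \<Longrightarrow> \<alpha> \<in> P \<or> - \<alpha> \<in> P"
begin

abbreviation "\<psi> \<equiv> psi \<mu> P lam"
abbreviation "B \<equiv> borel_basis P"

lemma P_minus: "\<alpha> \<in> P \<Longrightarrow> - \<alpha> \<notin> P"
  using P_add[of \<alpha> "- \<alpha>"] P_zero by auto

lemma P_add_eq_0: "\<alpha> \<in> insert 0 P \<Longrightarrow> \<beta> \<in> insert 0 P \<Longrightarrow> \<alpha> + \<beta> = 0 \<Longrightarrow> \<alpha> = 0 \<and> \<beta> = 0"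
  using P_minus[of \<alpha>] P_zero by (auto simp: add_eq_0_iff)

lemma not_P: "\<alpha> \<notin> insert 0 P \<longleftrightarrow> - \<alpha> \<in> P"
  using P_total[of \<alpha>] P_minus[of \<alpha>] P_zero P_minus[of "- \<alpha>"] by auto

lemma P_add': "\<alpha> \<in> insert 0 P \<Longrightarrow> \<beta> \<in> insert 0 P \<Longrightarrow> \<alpha> + \<beta> \<in> insert 0 P"
  using P_add by auto

lemma not_P_add: "\<alpha> \<notin> insert 0 P \<Longrightarrow> \<beta> \<notin> insert 0 P \<Longrightarrow> \<alpha> + \<beta> \<notin> insert 0 P"
  unfolding not_P using P_add[of "- \<alpha>" "- \<beta>"] by simp

lemma B_simps [simp]: "E \<alpha> \<in> B \<longleftrightarrow> \<alpha> \<in> insert 0 P" "H \<alpha> \<in> B \<longleftrightarrow> \<alpha> \<in> insert 0 P" "C1 \<in> B" "C2 \<in> B" "C3 \<in> B"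
  by (auto simp: borel_basis_def)

text \<open>Two weights in \<open>insert 0 P\<close> cancel only if both are zero, and then every
  coefficient of the bracket contains \<open>mu_dot \<mu> 0\<close>. In all other cases the bracket
  is supported on letters where the character is zero.\<close>

lemma borel_bracket:
  assumes "a \<in> B" "b \<in> B"
  shows "Poly_Mapping.keys (basis_bracket \<mu> a b) \<subseteq> B" "chi lam (basis_bracket \<mu> a b) = 0"
proof -
  have *: "\<alpha> = 0 \<and> \<beta> = 0" if "\<alpha> \<in> insert 0 P" "\<beta> \<in> insert 0 P" "\<alpha> = - \<beta>" for \<alpha> \<beta>
    using P_add_eq_0[OF that(1,2)] that(3) by simp
  have **: "\<alpha> + \<beta> \<in> insert 0 P" "\<alpha> = - \<beta> \<longleftrightarrow> \<alpha> = 0 \<and> \<beta> = 0" "\<alpha> + \<beta> = 0 \<longleftrightarrow> \<alpha> = 0 \<and> \<beta> = 0"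
    if "\<alpha> \<in> insert 0 P" "\<beta> \<in> insert 0 P" for \<alpha> \<beta>
    using P_add'[OF that] *[OF that] P_add_eq_0[OF that] by auto
  note [simp del] = insert_iff
  show "Poly_Mapping.keys (basis_bracket \<mu> a b) \<subseteq> B"
    using assms by (cases a; cases b) (simp_all add: ** split: if_splits)
  show "chi lam (basis_bracket \<mu> a b) = 0"
    using assms by (cases a; cases b)
      (auto simp: ** chi_simps chi_single weight_char_E_neq_0 weight_char_H_neq_0)
qed

lemma non_borel_bracket:
  assumes "a \<notin> B" "b \<notin> B"
  shows "Poly_Mapping.keys (basis_bracket \<mu> a b) \<inter> B = {}"
proof -
  have **: "\<alpha> + \<beta> \<notin> insert 0 P" "\<alpha> \<noteq> - \<beta>"
    if "\<alpha> \<notin> insert 0 P" "\<beta> \<notin> insert 0 P" for \<alpha> \<beta>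
    using not_P_add[OF that] by auto
  note [simp del] = insert_iff
  show ?thesis
    using assms by (cases a; cases b) (simp_all add: **)
qed

lemma psi_borel:
  assumes "Poly_Mapping.keys x \<subseteq> B"
  shows "\<psi> (iota x * t) = chi lam x * \<psi> t + \<psi> (der \<mu> x t)"
proof (rule is_linear_eq_on_keys[where F = "\<lambda>x. \<psi> (iota x * t)"])
  show "is_linear (*) (\<lambda>x. \<psi> (iota x * t))" "is_linear (*) (\<lambda>x. chi lam x * \<psi> t + \<psi> (der \<mu> x t))"
    by (auto intro!: is_linearI simp: psi_simps iota_simps scal_mult chi_simps is_linear_add[OF is_linear_der_left]
        is_linear_scal[OF is_linear_der_left] algebra_simps)
  show "\<psi> (iota (bv a) * t) = chi lam (bv a) * \<psi> t + \<psi> (der \<mu> (bv a) t)"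
    if "a \<in> Poly_Mapping.keys x" for a
    using assms that psi_borel_mult[of a P \<mu> lam t] by (auto simp: chi_single)
qed

lemma psi_non_borel:
  assumes "Poly_Mapping.keys x \<inter> B = {}"
  shows "\<psi> (iota x * t) = 0"
proof (rule is_linear_zeroI[where F = "\<lambda>x. \<psi> (iota x * t)"])
  show "is_linear (*) (\<lambda>x. \<psi> (iota x * t))"
    by (auto intro!: is_linearI simp: psi_simps iota_simps scal_mult algebra_simps)
  show "\<psi> (iota (bv a) * t) = 0"
    if "a \<in> Poly_Mapping.keys x" for a
    using assms that psi_non_borel_mult[of a P \<mu> lam t] by (auto simp: chi_single)
qed auto

text \<open>For two Borel letters this says that character plus derivation is a representation,
  which is \<open>der_commutator\<close> together with the vanishing of \<open>chi\<close> on
  brackets. With one Borel letter the recursion itself produces the bracket term. With none, every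
  term starts outside the Borel subalgebra.\<close>

lemma psi_lie_rel_left: "\<psi> (lie_rel \<mu> (bv a) (bv b) * t) = 0"
proof -
  let ?br = "bracket \<mu> (bv a) (bv b)"
  have br: "?br = basis_bracket \<mu> a b" by simp
  have exp: "\<psi> (lie_rel \<mu> (bv a) (bv b) * t) =
      \<psi> (iota (bv a) * (iota (bv b) * t)) - \<psi> (iota (bv b) * (iota (bv a) * t)) - \<psi> (iota ?br * t)"
    by (simp add: lie_rel_def algebra_simps psi_simps)
  have mixed: "\<psi> (lie_rel \<mu> (bv a) (bv b) * t) = 0" if "a \<in> B" "b \<notin> B" for a b
    using that by (simp add: lie_rel_def algebra_simps psi_simps psi_borel_mult psi_non_borel_mult der_mult der_iota mult.assoc)
  have anti: "lie_rel \<mu> (bv a) (bv b) = - lie_rel \<mu> (bv b) (bv a)"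
    using bracket_antisym[of \<mu> "bv a" "bv b"] by (simp add: lie_rel_def iota_simps)
  consider "a \<in> B" "b \<in> B" | "a \<in> B" "b \<notin> B" | "a \<notin> B" "b \<in> B" | "a \<notin> B" "b \<notin> B" by blast
  then show ?thesis
  proof cases
    case 1
    have "\<psi> (der \<mu> (bv a) (der \<mu> (bv b) t)) - \<psi> (der \<mu> (bv b) (der \<mu> (bv a) t)) = \<psi> (der \<mu> ?br t)"
      by (simp only: der_commutator[symmetric] psi_simps)
    moreover have "\<psi> (iota ?br * t) = \<psi> (der \<mu> ?br t)"
      using borel_bracket[OF 1] by (simp add: psi_borel)
    moreover have "iota (bracket \<mu> (bv b) (bv a)) = - iota ?br"
      by (simp add: bracket_antisym[of \<mu> "bv b"] iota_simps del: bracket_single_single)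
    ultimately show ?thesis
      unfolding exp using 1
      by (simp add: psi_borel_mult der_mult der_iota psi_simps algebra_simps del: bracket_single_single)
  next
    case 2 then show ?thesis by (rule mixed)
  next
    case 3 then show ?thesis by (subst anti) (simp add: mixed psi_simps)
  next
    case 4 then show ?thesis
      unfolding exp using non_borel_bracket[of a b] by (simp add: psi_non_borel_mult psi_non_borel)
  qed
qed

text \<open>Moving a letter to the right produces \<open>der_word\<close>, which is homogeneous but
  not a word. This passage lets an induction hypothesis on words be applied to it.\<close>

lemma psi_lie_rel_homog:
  assumes W: "\<And>a b xs ys. length xs + length ys = n \<Longrightarrow> \<psi> (wd xs * lie_rel \<mu> (bv a) (bv b) * wd ys) = 0"
    and "homog p s" "homog q t" "p + q = n"
  shows "\<psi> (s * lie_rel \<mu> x y * t) = 0"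
proof -
  have lin: "is_linear (*) (\<lambda>s. \<psi> (s * lie_rel \<mu> x y * t))" "is_linear (*) (\<lambda>t. \<psi> (s * lie_rel \<mu> x y * t))"
    "is_linear (*) (\<lambda>x. \<psi> (s * lie_rel \<mu> x y * t))" "is_linear (*) (\<lambda>y. \<psi> (s * lie_rel \<mu> x y * t))" for s t x y
    by (auto intro!: is_linearI simp: psi_simps scal_mult algebra_simps
        is_linear_add[OF is_linear_lie_rel(1)] is_linear_add[OF is_linear_lie_rel(2)]
        is_linear_scal[OF is_linear_lie_rel(1)] is_linear_scal[OF is_linear_lie_rel(2)])
  have 1: "\<psi> (s * lie_rel \<mu> (bv a) (bv b) * t) = 0" for a b
  proof (rule is_linear_zeroI[OF lin(1)])
    fix w assume w: "w \<in> Poly_Mapping.keys s"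
    show "\<psi> (Poly_Mapping.single w 1 * lie_rel \<mu> (bv a) (bv b) * t) = 0"
    proof (rule is_linear_zeroI[OF lin(2)])
      fix v assume v: "v \<in> Poly_Mapping.keys t"
      show "\<psi> (Poly_Mapping.single w 1 * lie_rel \<mu> (bv a) (bv b) * Poly_Mapping.single v 1) = 0"
        using W[of "letters w" "letters v" a b] w v assms(2-4) by (simp add: homog_def)
    qed simp
  qed simp
  have "\<psi> (s * lie_rel \<mu> x (bv b) * t) = 0" for b
    by (rule is_linear_zeroI[OF lin(3)]) (simp_all add: 1)
  then show ?thesis
    by (rule is_linear_zeroI[OF lin(4)]) simp_all
qed

text \<open>Induction on the total length of the two outer words. A leading Borel letter either acts
  by its character or differentiates one of the three factors; each resulting term again contains a
  relator, with outer factors one letter shorter in total.\<close>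

lemma psi_lie_rel_words: "\<psi> (wd xs * lie_rel \<mu> (bv a) (bv b) * wd ys) = 0"
proof (induction "length xs + length ys" arbitrary: xs ys a b rule: less_induct)
  case less
  show ?case
  proof (cases xs)
    case Nil then show ?thesis by (simp add: wd_Nil psi_lie_rel_left)
  next
    case (Cons c zs)
    have IH: "\<psi> (s * lie_rel \<mu> x y * t) = 0" if "homog (length zs) s" "homog (length ys) t" for s t x y
      by (rule psi_lie_rel_homog[OF less(1) that refl]) (simp_all add: Cons)
    show ?thesis
    proof (cases "c \<in> B")
      case True
      show ?thesis
        unfolding Cons wd_Cons
        using IH[OF homog_wd homog_wd] IH[OF homog_der_word homog_wd] IH[OF homog_wd homog_der_word]
        by (simp add: mult.assoc psi_borel_mult[OF True] der_mult der_lie_rel distrib_left distrib_right psi_simps del: bracket_single_single)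
    next
      case False
      then show ?thesis
        by (simp add: Cons wd_Cons psi_non_borel_mult mult.assoc)
    qed
  qed
qed

lemma psi_lie_rel: "\<psi> (s * lie_rel \<mu> x y * t) = 0"
proof -
  have lin: "is_linear (*) (\<lambda>s. \<psi> (s * lie_rel \<mu> x y * t))" "is_linear (*) (\<lambda>t. \<psi> (s * lie_rel \<mu> x y * t))"
    "is_linear (*) (\<lambda>t. 0 :: complex)" for s t
    by (auto intro!: is_linearI simp: psi_simps scal_mult algebra_simps)
  have 1: "\<psi> (wd xs * lie_rel \<mu> x y * wd ys) = 0" for xs ys
    by (rule psi_lie_rel_homog[OF _ homog_wd homog_wd refl]) (rule psi_lie_rel_words)
  have "\<psi> (s * lie_rel \<mu> x y * wd ys) = 0" for ys
    by (rule tensor_eqI[OF lin(1,3)]) (rule 1)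
  then show ?thesis
    by (rule tensor_eqI[OF lin(2,3)])
qed

text \<open>The recursion eats words from the left, so the behaviour at the right end needs its own
  induction. A leading Borel letter \<open>c\<close> is moved through the whole product; the new
  term contains the bracket of \<open>c\<close> and \<open>b\<close>, on which \<open>chi\<close>
  vanishes.\<close>

lemma psi_borel_right_word: "b \<in> B \<Longrightarrow> \<psi> (wd xs * iota (bv b)) = weight_char lam b * \<psi> (wd xs)"
proof (induction "length xs" arbitrary: xs b rule: less_induct)
  case less
  \<comment> \<open>The induction hypothesis is extended from words to homogeneous tensors and from
    letters to vectors of the Borel subalgebra.\<close>
  have ext: "\<psi> (s * iota x) = chi lam x * \<psi> s" if "homog n s" "n < length xs" "Poly_Mapping.keys x \<subseteq> B" for s x n
  proof (rule is_linear_eq_on_keys[where F = "\<lambda>x. \<psi> (s * iota x)"])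
    show "is_linear (*) (\<lambda>x. \<psi> (s * iota x))" "is_linear (*) (\<lambda>x. chi lam x * \<psi> s)"
      by (auto intro!: is_linearI simp: psi_simps scal_mult iota_simps chi_simps algebra_simps)
    fix a assume a: "a \<in> Poly_Mapping.keys x"
    show "\<psi> (s * iota (bv a)) = chi lam (bv a) * \<psi> s"
    proof (rule is_linear_eq_on_keys[where F = "\<lambda>s. \<psi> (s * iota (bv a))"])
      show "is_linear (*) (\<lambda>s. \<psi> (s * iota (bv a)))" "is_linear (*) (\<lambda>s. chi lam (bv a) * \<psi> s)"
        by (auto intro!: is_linearI simp: psi_simps scal_mult algebra_simps)
      fix w assume w: "w \<in> Poly_Mapping.keys s"
      show "\<psi> (Poly_Mapping.single w 1 * iota (bv a)) = chi lam (bv a) * \<psi> (Poly_Mapping.single w 1)"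
        using less(1)[of "letters w" a] w that a by (auto simp: homog_def chi_single)
    qed
  qed
  show ?case
  proof (cases xs)
    case Nil
    then show ?thesis using less(2) psi_borel_mult[of b P \<mu> lam 1] by (simp add: wd_Nil psi_simps)
  next
    case (Cons c zs)
    show ?thesis
    proof (cases "c \<in> B")
      case True
      show ?thesis
        using ext[OF homog_wd, of zs "bv b"] ext[OF homog_der_word, of zs "bv b"]
          ext[OF homog_wd, of zs "bracket \<mu> (bv c) (bv b)"] borel_bracket[OF True less(2)] less(2)
        by (simp add: Cons wd_Cons mult.assoc psi_borel_mult[OF True] der_mult der_iota psi_simps chi_single algebra_simps)
    next
      case False
      then show ?thesis
        by (simp add: Cons wd_Cons psi_non_borel_mult mult.assoc)
    qed
  qed
qed

lemma psi_borel_right: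
  assumes "b \<in> B"
  shows "\<psi> (s * iota (bv b)) = weight_char lam b * \<psi> s"
proof (rule tensor_eqI[where F = "\<lambda>s. \<psi> (s * iota (bv b))"])
  show "is_linear (*) (\<lambda>s. \<psi> (s * iota (bv b)))" "is_linear (*) (\<lambda>s. weight_char lam b * \<psi> s)"
    by (auto intro!: is_linearI simp: psi_simps scal_mult algebra_simps)
qed (rule psi_borel_right_word[OF assms])

end

lemma scal_diff_left: "scal (c - d) s = scal c s - scal d s"
  by (rule poly_mapping_eqI) (simp add: lookup_scal lookup_minus algebra_simps)

section \<open>Weights\<close>

fun wtb :: "'n hv_basis \<Rightarrow> int ^ 'n" where
  "wtb (E \<alpha>) = \<alpha>" | "wtb (H \<alpha>) = \<alpha>" | "wtb C1 = 0" | "wtb C2 = 0" | "wtb C3 = 0"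

definition wt :: "'n hv_basis list \<Rightarrow> int ^ 'n" where
  "wt xs = sum_list (map wtb xs)"

lemma wt_simps [simp]: "wt [] = 0" "wt (x # xs) = wtb x + wt xs" "wt (xs @ ys) = wt xs + wt ys"
  by (simp_all add: wt_def)

definition wt_homog :: "int ^ 'n \<Rightarrow> 'n hv_tensor \<Rightarrow> bool" where
  "wt_homog \<alpha> t \<longleftrightarrow> (\<forall>w\<in>Poly_Mapping.keys t. wt (letters w) = \<alpha>)"

lemma wt_homog_add: "wt_homog \<alpha> s \<Longrightarrow> wt_homog \<alpha> t \<Longrightarrow> wt_homog \<alpha> (s + t)"
  using keys_add[of s t] by (auto simp: wt_homog_def)

lemma wt_homog_wd: "wt_homog (wt xs) (wd xs)"
  by (simp add: wt_homog_def)

lemma wt_homog_mult: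
  assumes "wt_homog \<alpha> s" "wt_homog \<beta> t"
  shows "wt_homog (\<alpha> + \<beta>) (s * t)"
  unfolding wt_homog_def
proof
  fix w assume "w \<in> Poly_Mapping.keys (s * t)"
  then obtain u v where "w = u + v" "u \<in> Poly_Mapping.keys s" "v \<in> Poly_Mapping.keys t"
    using keys_mult[of s t] by auto
  then show "wt (letters w) = \<alpha> + \<beta>"
    using assms by (auto simp: wt_homog_def plus_free_word_def)
qed

lemma keys_basis_bracket: "c \<in> Poly_Mapping.keys (basis_bracket \<mu> a b) \<Longrightarrow> wtb c = wtb a + wtb b"
  by (cases a; cases b)
    (auto simp: in_keys_iff lookup_add lookup_single when_def lookup_minus split: if_splits)

lemma wt_homog_iota: "(\<And>a. a \<in> Poly_Mapping.keys x \<Longrightarrow> wtb a = \<alpha>) \<Longrightarrow> wt_homog \<alpha> (iota x)"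
  using keys_iota[of x] by (auto simp: wt_homog_def)

lemma wt_homog_der_word: "wt_homog (wtb a + wt xs) (der_word \<mu> (bv a) xs)"
proof (induction xs)
  case (Cons b xs)
  have 1: "wt_homog (wtb a + wtb b + wt xs) (iota (bracket \<mu> (bv a) (bv b)) * wd xs)"
    by (intro wt_homog_mult wt_homog_wd wt_homog_iota) (simp add: keys_basis_bracket)
  have "wt_homog (wtb b + (wtb a + wt xs)) (iota (bv b) * der_word \<mu> (bv a) xs)"
    by (intro wt_homog_mult Cons wt_homog_iota) simp
  then have 2: "wt_homog (wtb a + wtb b + wt xs) (iota (bv b) * der_word \<mu> (bv a) xs)"
    by (simp only: ac_simps)
  show ?case
    using wt_homog_add[OF 1 2] by (simp add: ac_simps del: bracket_single_single)
qed (simp add: wt_homog_def)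

lemma bracket_E_0: "basis_bracket \<mu> (E 0) b = Poly_Mapping.single b (mu_dot \<mu> (wtb b))"
  by (cases b) auto

declare scal_simps(5) [simp del]

lemma der_E_0: "der \<mu> (bv (E 0)) (wd xs) = scal (mu_dot \<mu> (wt xs)) (wd xs)"
proof (induction xs)
  case (Cons b xs)
  have "iota (Poly_Mapping.single b (mu_dot \<mu> (wtb b))) = scal (mu_dot \<mu> (wtb b)) (iota (bv b))"
    by (simp add: scal_simps(5) flip: is_linear_scal[OF is_linear_iota])
  then show ?case
    unfolding wd_Cons der_mult der_iota Cons by (simp add: bracket_E_0 scal_mult scal_add_left)
qed (simp add: wd_Nil)

lemma weight_char_nonzero: "weight_char lam b \<noteq> 0 \<Longrightarrow> wtb b = 0"
  using weight_char_E_neq_0[of _ lam] weight_char_H_neq_0[of _ lam] by (cases b) (auto simp del: weight_char.simps)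

context hv_triangular
begin

lemma non_borel_wt: "b \<notin> B \<Longrightarrow> - wtb b \<in> P"
  using not_P by (cases b) auto

text \<open>Both terms of the recursion respect the weight: a letter with nonzero character has
  weight zero, and \<open>der_word\<close> absorbs the weight of the letter that is removed.\<close>

lemma psi_nonzero_wt: "wt xs \<noteq> 0 \<Longrightarrow> \<psi> (wd xs) = 0"
proof (induction "length xs" arbitrary: xs rule: less_induct)
  case less
  show ?case
  proof (cases xs)
    case Nil then show ?thesis using less by simp
  next
    case (Cons b ys)
    show ?thesis
    proof (cases "b \<in> B")
      case True
      have 1: "weight_char lam b * \<psi> (wd ys) = 0"
        using less(1)[of ys] less(2) weight_char_nonzero[of lam b] by (cases "weight_char lam b = 0") (simp_all add: Cons del: psi_wd)
      have 2: "\<psi> (der_word \<mu> (bv b) ys) = 0"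
      proof (rule is_linear_zeroI[OF is_linear_psi])
        fix w assume "w \<in> Poly_Mapping.keys (der_word \<mu> (bv b) ys)"
        then have "length (letters w) = length ys" "wt (letters w) = wt xs"
          using homog_der_word[of ys \<mu> "bv b"] wt_homog_der_word[of b ys \<mu>]
          by (auto simp: homog_def wt_homog_def Cons)
        then show "\<psi> (Poly_Mapping.single w 1) = 0"
          using less(1)[of "letters w"] less(2) by (simp add: Cons)
      qed simp
      show ?thesis unfolding Cons wd_Cons psi_borel_mult[OF True] der_wd 1 2 by simp
    next
      case False show ?thesis unfolding Cons wd_Cons psi_non_borel_mult[OF False] ..
    qed
  qed
qed

end

section \<open>The annihilator of the highest weight vector\<close>

text \<open>\<open>I\<close> stands for the annihilator of the generator \<open>v\<close>, that is,
  the kernel of t \<mapsto> t v. Properness is hidden in \<open>I_psi\<close>, because \<psi> takes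
  the value 1 at 1.\<close>

locale hw_ideal = hv_triangular \<mu> P lam
  for \<mu> :: "complex ^ ('n::finite)" and P :: "(int ^ 'n) set" and lam :: hv_weight +
  fixes I :: "'n hv_tensor set"
  assumes I_zero: "0 \<in> I"
    and I_add: "s \<in> I \<Longrightarrow> t \<in> I \<Longrightarrow> s + t \<in> I"
    and I_mult: "t \<in> I \<Longrightarrow> s * t \<in> I"
    and I_lie_rel: "s * lie_rel \<mu> x y * t \<in> I"
    and I_borel: "b \<in> B \<Longrightarrow> s * iota (bv b) - scal (weight_char lam b) s \<in> I"
    and I_psi: "t \<in> I \<Longrightarrow> \<psi> t = 0"
begin

lemma I_scal: "t \<in> I \<Longrightarrow> scal c t \<in> I"
  by (simp add: scal_eq_single_mult I_mult)

lemma I_minus: "t \<in> I \<Longrightarrow> - t \<in> I"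
  using I_mult[of t "- 1"] by simp

lemma I_sum: "(\<And>a. a \<in> A \<Longrightarrow> f a \<in> I) \<Longrightarrow> sum f A \<in> I"
  by (induction A rule: infinite_finite_induct) (auto simp: I_zero I_add)

lemma I_linear:
  assumes "is_linear scal F" "\<And>w. w \<in> Poly_Mapping.keys t \<Longrightarrow> F (Poly_Mapping.single w 1) \<in> I"
  shows "F t \<in> I"
  using is_linear_expand[OF assms(1), of t] by (simp add: I_sum I_scal assms(2))

text \<open>Each letter that \<open>x\<close> passes costs one relator, so modulo \<open>I\<close>
  the derivation is the commutator with \<open>x\<close>.\<close>

lemma commute_mod_I: "iota x * wd xs - wd xs * iota x - der \<mu> x (wd xs) \<in> I"
proof (induction xs)
  case Nil then show ?case by (simp add: wd_Nil I_zero)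
next
  case (Cons b xs)
  have "iota x * wd (b # xs) - wd (b # xs) * iota x - der \<mu> x (wd (b # xs)) =
      1 * lie_rel \<mu> x (bv b) * wd xs + iota (bv b) * (iota x * wd xs - wd xs * iota x - der \<mu> x (wd xs))"
    unfolding wd_Cons der_mult der_iota lie_rel_def by (simp add: algebra_simps)
  then show ?case
    using I_lie_rel[of 1 x "bv b" "wd xs"] I_mult[OF Cons] by (simp add: I_add)
qed

lemma borel_mod_I:
  assumes "b \<in> B"
  shows "wd (b # xs) - (scal (weight_char lam b) (wd xs) + der_word \<mu> (bv b) xs) \<in> I"
  using I_add[OF commute_mod_I[of "bv b" xs] I_borel[OF assms, of "wd xs"]]
  by (simp add: wd_Cons algebra_simps)

text \<open>Words of positive weight annihilate \<open>v\<close>. A leading Borel letter is moved to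
  the right, leaving shorter words of positive weight; a leading letter outside the Borel subalgebra
  has negative weight, so the tail already has positive weight.\<close>

lemma vanish_mod_I: "wt xs \<in> P \<Longrightarrow> wd xs \<in> I"
proof (induction "length xs" arbitrary: xs rule: less_induct)
  case less
  show ?case
  proof (cases xs)
    case Nil then show ?thesis using less P_zero by simp
  next
    case (Cons b ys)
    show ?thesis
    proof (cases "b \<in> B")
      case True
      have 1: "scal (weight_char lam b) (wd ys) \<in> I"
        using less(1)[of ys] less(2) weight_char_nonzero[of lam b]
        by (cases "weight_char lam b = 0") (auto simp: Cons I_zero intro: I_scal)
      have 2: "der_word \<mu> (bv b) ys \<in> I"
      proof (rule I_linear[where F = "\<lambda>t. t"])
        fix w assume "w \<in> Poly_Mapping.keys (der_word \<mu> (bv b) ys)"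
        then have "length (letters w) = length ys" "wt (letters w) = wt xs"
          using homog_der_word[of ys \<mu> "bv b"] wt_homog_der_word[of b ys \<mu>]
          by (auto simp: homog_def wt_homog_def Cons)
        then show "Poly_Mapping.single w 1 \<in> I"
          using less(1)[of "letters w"] less(2) by (simp add: Cons)
      qed (rule is_linear_multI)
      show ?thesis
        using I_add[OF borel_mod_I[OF True, of ys] I_add[OF 1 2]] by (simp add: Cons)
    next
      case False
      then have "wt ys \<in> P"
        using P_add[of "- wtb b" "wt xs"] non_borel_wt less(2) by (simp add: Cons)
      then show ?thesis
        using less(1)[of ys] I_mult[of "wd ys" "iota (bv b)"] by (simp add: Cons wd_Cons)
    qed
  qed
qed

text \<open>The vectors of highest weight are multiples of \<open>v\<close>, and \<psi> is the
  coefficient: the recursion for \<psi> is replayed modulo \<open>I\<close>. If the first letter is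
  not in the Borel subalgebra, the tail has positive weight and annihilates
  \<open>v\<close>.\<close>

lemma zero_wt_mod_I: "wt xs = 0 \<Longrightarrow> wd xs - scal (\<psi> (wd xs)) 1 \<in> I"
proof (induction "length xs" arbitrary: xs rule: less_induct)
  case less
  have lin: "is_linear scal (\<lambda>t. t - scal (\<psi> t) 1)"
    by (auto intro!: is_linearI simp: psi_simps scal_add_left scal_diff algebra_simps)
  show ?case
  proof (cases xs)
    case Nil then show ?thesis by (simp add: wd_Nil I_zero)
  next
    case (Cons b ys)
    show ?thesis
    proof (cases "b \<in> B")
      case True
      have 1: "scal (weight_char lam b) (wd ys - scal (\<psi> (wd ys)) 1) \<in> I"
        using less(1)[of ys] less(2) weight_char_nonzero[of lam b]
        by (cases "weight_char lam b = 0") (auto simp: Cons I_zero intro: I_scal simp del: psi_wd)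
      have 2: "der_word \<mu> (bv b) ys - scal (\<psi> (der_word \<mu> (bv b) ys)) 1 \<in> I"
      proof (rule I_linear[OF lin])
        fix w assume "w \<in> Poly_Mapping.keys (der_word \<mu> (bv b) ys)"
        then have "length (letters w) = length ys" "wt (letters w) = wt xs"
          using homog_der_word[of ys \<mu> "bv b"] wt_homog_der_word[of b ys \<mu>]
          by (auto simp: homog_def wt_homog_def Cons)
        then show "Poly_Mapping.single w 1 - scal (\<psi> (Poly_Mapping.single w 1)) 1 \<in> I"
          using less(1)[of "letters w"] less(2) by (simp add: Cons)
      qed
      have "\<psi> (wd xs) = weight_char lam b * \<psi> (wd ys) + \<psi> (der_word \<mu> (bv b) ys)"
        by (simp only: Cons wd_Cons psi_borel_mult[OF True] der_wd)
      then have eq: "scal (\<psi> (wd xs)) 1 = scal (weight_char lam b * \<psi> (wd ys)) 1 + scal (\<psi> (der_word \<mu> (bv b) ys)) (1 :: 'n hv_tensor)"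
        by (simp only: scal_add_left)
      show ?thesis
        using I_add[OF borel_mod_I[OF True, of ys] I_add[OF 1 2]] eq
        by (simp add: Cons scal_diff algebra_simps del: psi_wd)
    next
      case False
      then have "wt ys \<in> P"
        using non_borel_wt[of b] less(2) by (simp add: Cons add_eq_0_iff)
      then have "wd xs \<in> I"
        using vanish_mod_I[of ys] I_mult[of "wd ys" "iota (bv b)"] by (simp add: Cons wd_Cons)
      moreover have "\<psi> (wd xs) = 0"
        by (simp only: Cons wd_Cons psi_non_borel_mult[OF False])
      ultimately show ?thesis by simp
    qed
  qed
qed

abbreviation d :: "'n hv_tensor" where "d \<equiv> iota (bv (E 0))"

lemma weight_char_E_0: "weight_char lam (E 0) = fst lam"
  by (cases lam) simp

lemma weight_mod_I: "d * wd xs - scal (fst lam + mu_dot \<mu> (wt xs)) (wd xs) \<in> I"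
  using borel_mod_I[of "E 0" xs] der_E_0[of \<mu> xs] by (simp add: wd_Cons scal_add_left weight_char_E_0)

section \<open>The largest proper left ideal above the annihilator\<close>

definition J :: "'n hv_tensor set" where
  "J = {t. \<forall>s. \<psi> (s * t) = 0}"

lemma I_subset_J: "I \<subseteq> J"
  by (auto simp: J_def I_mult I_psi)

lemma J_zero: "0 \<in> J" and J_add: "s \<in> J \<Longrightarrow> t \<in> J \<Longrightarrow> s + t \<in> J"
  and J_mult: "t \<in> J \<Longrightarrow> s * t \<in> J" and J_one: "1 \<notin> J"
  by (auto simp: J_def psi_simps distrib_left mult.assoc[symmetric] intro!: exI[of _ 1])

text \<open>If \<psi> were nonzero at some \<open>t\<close> in \<open>N\<close>, the weight zero
  component of \<open>t\<close> would lie in \<open>N\<close>, and modulo \<open>I\<close> it is a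
  nonzero multiple of 1. So \<psi> vanishes on \<open>N\<close>, hence on all \<open>s * t\<close>,
  because \<open>N\<close> is a left ideal.\<close>

lemma J_maximal:
  assumes N_add: "\<And>s t. s \<in> N \<Longrightarrow> t \<in> N \<Longrightarrow> s + t \<in> N" and N_mult: "\<And>s t. t \<in> N \<Longrightarrow> s * t \<in> N"
    and IN: "I \<subseteq> N" and proper: "N \<noteq> UNIV"
  shows "N \<subseteq> J"
proof -
  have N_scal: "scal c t \<in> N" if "t \<in> N" for c t
    using that by (simp add: scal_eq_single_mult N_mult)
  have N_minus: "- t \<in> N" if "t \<in> N" for t
    using N_scal[OF that, of "- 1"] by (simp add: scal_minus)
  have N_diff: "s - t \<in> N" if "s \<in> N" "t \<in> N" for s t
    using N_add[OF that(1) N_minus[OF that(2)]] by simp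
  \<comment> \<open>Applying \<open>d\<close> minus an eigenvalue removes the weight vectors \<open>m w\<close> one at a time.\<close>
  have separate: "t0 \<in> N"
    if "finite A" "d * t0 - scal (fst lam) t0 \<in> I" "\<And>w. w \<in> A \<Longrightarrow> d * m w - scal (a w) (m w) \<in> I"
      "\<And>w. w \<in> A \<Longrightarrow> a w \<noteq> fst lam" "t0 + sum m A \<in> N" for A t0 m and a :: "'n hv_basis free_word \<Rightarrow> complex"
    using that
  proof (induction A arbitrary: t0 m rule: finite_induct)
    case empty then show ?case by simp
  next
    case (insert w A)
    \<comment> \<open>Applying \<open>d\<close> minus \<open>a w\<close> scales the component at
      \<open>v\<close> by \<open>a v - a w\<close>. Repeated eigenvalues inside \<open>A\<close> do
      no harm, since the only factor to be inverted is \<open>fst lam - a w\<close>.\<close>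
    define m' where "m' = (\<lambda>v. scal (a v - a w) (m v))"
    let ?t = "scal (fst lam - a w) t0"
    have split: "d * (t0 + sum m (insert w A)) - scal (a w) (t0 + sum m (insert w A)) =
        (?t + sum m' A) + ((d * t0 - scal (fst lam) t0) + (\<Sum>v\<in>insert w A. d * m v - scal (a v) (m v)))"
    proof -
      have 1: "sum m' (insert w A) = (\<Sum>v\<in>insert w A. scal (a v) (m v)) - scal (a w) (sum m (insert w A))"
        by (simp only: m'_def scal_diff_left sum_subtractf scal_sum)
      have 2: "sum m' (insert w A) = sum m' A"
        using insert(1,2) by (simp add: m'_def)
      have 3: "?t = scal (fst lam) t0 - scal (a w) t0"
        by (rule scal_diff_left)
      have 4: "d * sum m (insert w A) = (\<Sum>v\<in>insert w A. d * m v)"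
        by (rule sum_distrib_left)
      have "d * (t0 + sum m (insert w A)) - scal (a w) (t0 + sum m (insert w A)) =
          d * t0 + (\<Sum>v\<in>insert w A. d * m v) - (scal (a w) t0 + scal (a w) (sum m (insert w A)))"
        by (simp only: distrib_left scal_add 4)
      also have "\<dots> = (?t + sum m' A) + ((d * t0 - scal (fst lam) t0) +
          ((\<Sum>v\<in>insert w A. d * m v) - (\<Sum>v\<in>insert w A. scal (a v) (m v))))"
        using 1 unfolding 2 3 by simp
      finally show ?thesis by (simp only: sum_subtractf)
    qed
    have rest: "(d * t0 - scal (fst lam) t0) + (\<Sum>v\<in>insert w A. d * m v - scal (a v) (m v)) \<in> N"
      by (rule subsetD[OF IN], rule I_add[OF insert(4)], rule I_sum, rule insert(5))
    have "d * (t0 + sum m (insert w A)) - scal (a w) (t0 + sum m (insert w A)) \<in> N"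
      by (rule N_diff[OF N_mult[OF insert(7)] N_scal[OF insert(7)]])
    from N_diff[OF this[unfolded split] rest] have sum_N: "?t + sum m' A \<in> N"
      by (simp only: add_diff_cancel_right')
    have "d * ?t - scal (fst lam) ?t = scal (fst lam - a w) (d * t0 - scal (fst lam) t0)"
      by (simp only: scal_mult scal_diff scal_simps mult.commute)
    then have t_wt: "d * ?t - scal (fst lam) ?t \<in> I"
      using I_scal[OF insert(4)] by simp
    have "d * m' v - scal (a v) (m' v) = scal (a v - a w) (d * m v - scal (a v) (m v))" for v
      by (simp only: m'_def scal_mult scal_diff scal_simps mult.commute)
    then have m_wt: "d * m' v - scal (a v) (m' v) \<in> I" if "v \<in> A" for v
      using I_scal[OF insert(5)[of v]] that by simp
    have "?t \<in> N"
      by (rule insert.IH[OF t_wt m_wt insert(6) sum_N]) simp_all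
    then have "scal (inverse (fst lam - a w)) ?t \<in> N" by (rule N_scal)
    then show ?case using insert(6)[of w] by simp
  qed
  have one: "\<psi> t = 0" if t: "t \<in> N" for t
  proof (rule ccontr)
    assume nz: "\<psi> t \<noteq> 0"
    define Z where "Z = {w \<in> Poly_Mapping.keys t. wt (letters w) = 0}"
    define A where "A = {w \<in> Poly_Mapping.keys t. wt (letters w) \<noteq> 0}"
    define m where "m w = scal (Poly_Mapping.lookup t w) (Poly_Mapping.single w 1)" for w
    define t0 where "t0 = sum m Z"
    have fin: "finite Z" "finite A" "Z \<inter> A = {}" "Poly_Mapping.keys t = Z \<union> A"
      by (auto simp: Z_def A_def)
    have t_eq: "t = t0 + sum m A"
      using sum_single[of t] sum.union_disjoint[OF fin(1-3), of m] fin(4) by (simp add: t0_def m_def scal_simps(5))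
    have wm: "d * m w - scal (fst lam + mu_dot \<mu> (wt (letters w))) (m w) \<in> I" for w
      using I_scal[OF weight_mod_I[of "letters w"], of "Poly_Mapping.lookup t w"]
      by (simp only: m_def scal_diff scal_mult scal_simps(4) free_word.collapse mult.commute)
    have "d * t0 - scal (fst lam) t0 = (\<Sum>w\<in>Z. d * m w - scal (fst lam + mu_dot \<mu> (wt (letters w))) (m w))"
      by (simp add: t0_def sum_distrib_left scal_sum sum_subtractf Z_def)
    then have "d * t0 - scal (fst lam) t0 \<in> I" using wm by (simp add: I_sum)
    have neq: "fst lam + mu_dot \<mu> (wt (letters w)) \<noteq> fst lam" if "w \<in> A" for w
      using gen that by (simp add: A_def generic_def)
    have "t0 \<in> N"
      by (rule separate[OF fin(2) \<open>d * t0 - scal (fst lam) t0 \<in> I\<close> wm neq]) (use t t_eq in simp_all)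
    have lin: "is_linear scal (\<lambda>t. t - scal (\<psi> t) 1)"
      by (auto intro!: is_linearI simp: psi_simps scal_add_left scal_diff algebra_simps)
    have "m w - scal (\<psi> (m w)) 1 \<in> I" if "w \<in> Z" for w
      using I_scal[OF zero_wt_mod_I[of "letters w"], of "Poly_Mapping.lookup t w"] that
      by (simp add: m_def scal_diff psi_simps Z_def del: psi_wd)
    then have "t0 - scal (\<psi> t0) 1 \<in> I"
      unfolding t0_def is_linear_sum[OF lin] by (intro I_sum)
    then have "scal (\<psi> t0) 1 \<in> N"
      using IN N_diff[OF \<open>t0 \<in> N\<close>, of "t0 - scal (\<psi> t0) 1"] by auto
    moreover have "\<psi> (m w) = 0" if "w \<in> A" for w
      using psi_nonzero_wt[of "letters w"] that by (simp add: m_def A_def psi_simps del: psi_wd)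
    then have "\<psi> t0 = \<psi> t"
      unfolding t_eq by (simp add: psi_simps is_linear_sum[OF is_linear_psi])
    ultimately have "scal (\<psi> t) 1 \<in> N" by simp
    then have "scal (inverse (\<psi> t)) (scal (\<psi> t) 1) \<in> N" by (rule N_scal)
    then have "1 \<in> N" using nz by simp
    then have "N = UNIV" using N_mult[of 1] by auto
    then show False using proper by simp
  qed
  then show ?thesis using N_mult by (auto simp: J_def)
qed

end

section \<open>Modules presented by the tensor algebra\<close>

text \<open>\<open>presents Q M\<close>: the module \<open>M\<close> is the quotient of the regular module of the tensor algebra by a
  left ideal, with quotient map \<open>Q\<close>.\<close>

definition presents :: "('n hv_tensor \<Rightarrow> 'v) \<Rightarrow> ('n hvir, 'v) lie_module \<Rightarrow> bool" where
  "presents Q M \<longleftrightarrow> carrier M = range Q \<and> (\<forall>s t. Q s \<oplus>\<^bsub>M\<^esub> Q t = Q (s + t)) \<and> \<zero>\<^bsub>M\<^esub> = Q 0 \<and>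
     (\<forall>c t. c \<odot>\<^bsub>M\<^esub> Q t = Q (scal c t)) \<and> (\<forall>x t. act M x (Q t) = Q (iota x * t))"

lemma presentsD:
  assumes "presents Q M"
  shows "carrier M = range Q" "Q s \<oplus>\<^bsub>M\<^esub> Q t = Q (s + t)" "\<zero>\<^bsub>M\<^esub> = Q 0"
    "c \<odot>\<^bsub>M\<^esub> Q t = Q (scal c t)" "act M x (Q t) = Q (iota x * t)"
  using assms by (auto simp: presents_def)

lemma field_type_ring: "field (type_ring :: 'a :: field ring)"
proof (rule cring.cring_fieldI)
  show cring: "cring (type_ring :: 'a ring)"
  proof (rule cringI)
    show "abelian_group (type_ring :: 'a ring)"
      by (rule abelian_groupI) (auto simp: ac_simps intro: exI[of _ "- _"] left_minus)
    show "comm_monoid (type_ring :: 'a ring)"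
      by (rule comm_monoidI) (auto simp: ac_simps)
  qed (simp add: distrib_right)
  interpret cring "type_ring :: 'a ring" by (rule cring)
  show "Units (type_ring :: 'a ring) = carrier type_ring - {\<zero>\<^bsub>type_ring\<^esub>}"
    by (auto simp: Units_def) (metis left_inverse right_inverse)
qed

text \<open>The subspace \<open>W\<close> is left general because the lemma serves a whole module,
  with \<open>W = UNIV\<close>, and also a weight space, with \<open>W\<close> its preimage.\<close>

lemma module_image:
  fixes M :: "(complex, 'v, 'm) module_scheme" and Q :: "('b \<Rightarrow>\<^sub>0 complex) \<Rightarrow> 'v"
  assumes car: "carrier M = Q ` W"
    and W: "0 \<in> W" "\<And>s t. s \<in> W \<Longrightarrow> t \<in> W \<Longrightarrow> s + t \<in> W" "\<And>c t. t \<in> W \<Longrightarrow> scal c t \<in> W"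
    and ops: "\<And>s t. Q s \<oplus>\<^bsub>M\<^esub> Q t = Q (s + t)" "\<zero>\<^bsub>M\<^esub> = Q 0" "\<And>c t. c \<odot>\<^bsub>M\<^esub> Q t = Q (scal c t)"
  shows "module type_ring M"
proof (rule moduleI)
  show "cring (type_ring :: complex ring)"
    using field_type_ring by (rule fieldE)
  show "abelian_group M"
  proof (rule abelian_groupI)
    fix x assume "x \<in> carrier M"
    then obtain t where t: "t \<in> W" "x = Q t" using car by auto
    then show "\<exists>y\<in>carrier M. y \<oplus>\<^bsub>M\<^esub> x = \<zero>\<^bsub>M\<^esub>"
      using W(3)[of t "- 1"] by (intro bexI[of _ "Q (scal (- 1) t)"]) (auto simp: ops car scal_minus)
  qed (use car W in \<open>auto simp: ops ac_simps\<close>)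
qed (use car W in \<open>auto simp: ops scal_add scal_add_left\<close>)

lemma presents_module: "presents Q M \<Longrightarrow> module type_ring M"
  by (rule module_image[where W = UNIV]) (auto simp: presentsD)

lemma presents_eq_iff:
  assumes "presents Q M"
  shows "Q s = Q t \<longleftrightarrow> Q (s - t) = Q 0"
proof
  note p = presentsD[OF assms]
  show "Q (s - t) = Q 0" if "Q s = Q t"
    using p(2)[of s "- t"] p(2)[of t "- t"] that by simp
  show "Q s = Q t" if "Q (s - t) = Q 0"
    using p(2)[of "s - t" t] p(2)[of 0 t] that by simp
qed

lemma lie_submodule_image:
  assumes "presents Q M" and N: "0 \<in> N" "\<And>s t. s \<in> N \<Longrightarrow> t \<in> N \<Longrightarrow> s + t \<in> N" "\<And>s t. t \<in> N \<Longrightarrow> s * t \<in> N"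
  shows "lie_submodule (Q ` N) M"
  unfolding lie_submodule_def
proof (intro conjI submodule.intro)
  note p = presentsD[OF assms(1)]
  show "module type_ring M" by (rule presents_module[OF assms(1)])
  show "Q ` N \<subseteq> carrier M" using p by auto
  show "\<zero>\<^bsub>M\<^esub> \<in> Q ` N" using p N by auto
  show "\<forall>x. \<forall>v\<in>Q ` N. act M x v \<in> Q ` N" using p N by auto
  show "v \<oplus>\<^bsub>M\<^esub> w \<in> Q ` N" if "v \<in> Q ` N" "w \<in> Q ` N" for v w
    using that p N by auto
  show "c \<odot>\<^bsub>M\<^esub> v \<in> Q ` N" if "v \<in> Q ` N" for c v
    using that p N by (auto simp: scal_eq_single_mult)
qed

text \<open>Letters generate the tensor algebra, so stability under the Lie algebra and scalars is
  stability under all tensors: submodules correspond to left ideals.\<close>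

lemma lie_submodule_vimage:
  assumes p: "presents Q M" and "lie_submodule N M"
  shows "\<And>s t. Q s \<in> N \<Longrightarrow> Q t \<in> N \<Longrightarrow> Q (s + t) \<in> N" "\<And>s t. Q t \<in> N \<Longrightarrow> Q (s * t) \<in> N"
    "Q 0 \<in> N" "N = Q ` (Q -` N)"
proof -
  note p = presentsD[OF p]
  have sub: "submodule type_ring N M" and act: "\<And>x v. v \<in> N \<Longrightarrow> act M x v \<in> N"
    using assms(2) by (auto simp: lie_submodule_def)
  interpret submodule "type_ring :: complex ring" N M by (rule sub)
  show add: "Q (s + t) \<in> N" if "Q s \<in> N" "Q t \<in> N" for s t
    using m_closed[OF that] by (simp add: p)
  show zero: "Q 0 \<in> N" using zero_closed by (simp add: p)
  have scal: "Q (scal c t) \<in> N" if "Q t \<in> N" for c t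
    using smult_closed[of c "Q t"] that by (simp add: p)
  have wd: "Q (wd xs * t) \<in> N" if "Q t \<in> N" for xs t
  proof (induction xs)
    case Nil then show ?case using that by (simp add: wd_Nil)
  next
    case (Cons b xs)
    then show ?case using act[OF Cons, of "bv b"] by (simp add: p wd_Cons mult.assoc)
  qed
  show "Q (s * t) \<in> N" if "Q t \<in> N" for s t
  proof -
    have sums: "Q (sum f A) \<in> N" if "\<And>a. a \<in> A \<Longrightarrow> Q (f a) \<in> N" for A and f :: "'a hv_basis free_word \<Rightarrow> _"
      using that by (induction A rule: infinite_finite_induct) (auto simp: zero add)
    have "is_linear scal (\<lambda>s. s * t)" by (rule is_linear_multI)+
    note e = is_linear_expand[OF this, of s]
    show ?thesis unfolding e
    proof (rule sums)
      fix w
      show "Q (scal (Poly_Mapping.lookup s w) (Poly_Mapping.single w 1 * t)) \<in> N"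
        using scal[OF wd[OF that, of "letters w"]] by simp
    qed
  qed
  show "N = Q ` (Q -` N)" using subset p(1) by auto
qed

text \<open>The facts about the Verma module on which the weight space argument rests, with its
  cosets hidden behind \<open>Q\<close>. The last one says that \<psi> descends to the
  module.\<close>

locale hw_module = hv_triangular \<mu> P lam
  for \<mu> :: "complex ^ ('n::finite)" and P :: "(int ^ 'n) set" and lam :: hv_weight +
  fixes Q :: "'n hv_tensor \<Rightarrow> 'v" and M :: "('n hvir, 'v) lie_module"
  assumes pres: "presents Q M"
    and Q_lie_rel: "Q (s * lie_rel \<mu> x y * t) = Q 0"
    and Q_borel: "b \<in> B \<Longrightarrow> Q (s * iota (bv b)) = Q (scal (weight_char lam b) s)"
    and Q_psi: "Q t = Q 0 \<Longrightarrow> \<psi> t = 0"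
begin

sublocale hw_ideal \<mu> P lam "{t. Q t = Q 0}"
proof
  note p = presentsD[OF pres]
  have z: "lie_submodule {Q 0} M"
    using lie_submodule_image[OF pres, of "{0}"] by simp
  show "0 \<in> {t. Q t = Q 0}" by simp
  show "s + t \<in> {t. Q t = Q 0}" if "s \<in> {t. Q t = Q 0}" "t \<in> {t. Q t = Q 0}" for s t
    using lie_submodule_vimage(1)[OF pres z] that by auto
  show "s * t \<in> {t. Q t = Q 0}" if "t \<in> {t. Q t = Q 0}" for s t
    using lie_submodule_vimage(2)[OF pres z] that by auto
  show "s * iota (bv b) - scal (weight_char lam b) s \<in> {t. Q t = Q 0}" if "b \<in> B" for b s
    using Q_borel[OF that, of s] presents_eq_iff[OF pres] by auto
qed (auto simp: Q_lie_rel Q_psi)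

lemma mem_J_cong: "Q s = Q t \<Longrightarrow> s \<in> J \<longleftrightarrow> t \<in> J"
proof -
  assume "Q s = Q t"
  then have "s - t \<in> J" using presents_eq_iff[OF pres, of s t] I_subset_J by auto
  then show ?thesis
    using J_add[of "s - t" t] J_add[of "- (s - t)" s] J_mult[of "s - t" "- 1"] by auto
qed

lemma maximal_proper_submodule_iff: "maximal_proper_submodule N M \<longleftrightarrow> N = Q ` J"
proof -
  note p = presentsD[OF pres]
  have J: "lie_submodule (Q ` J) M"
    by (rule lie_submodule_image[OF pres J_zero J_add J_mult])
  have proper: "Q ` J \<noteq> carrier M"
  proof
    assume "Q ` J = carrier M"
    then obtain j where "j \<in> J" "Q 1 = Q j" using p(1) by (metis imageE rangeI)
    then show False using mem_J_cong J_one by blast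
  qed
  have below: "N \<subseteq> Q ` J" if N: "lie_submodule N M" "N \<noteq> carrier M" for N
  proof -
    note v = lie_submodule_vimage[OF pres N(1)]
    have "Q -` N \<subseteq> J"
    proof (rule J_maximal)
      show "Q -` N \<noteq> UNIV" using v(4) N(2) p(1) by metis
      show "{t. Q t = Q 0} \<subseteq> Q -` N" using v(3) by auto
    qed (use v in auto)
    then show ?thesis using v(4) by blast
  qed
  show ?thesis
    unfolding maximal_proper_submodule_def using J proper below by blast
qed

definition QV :: "'n hv_tensor \<Rightarrow> 'v set" where
  "QV t = Q ` {s. s - t \<in> J}"

lemma QV_eq_iff: "QV s = QV t \<longleftrightarrow> s - t \<in> J"
proof -
  have J_minus: "- j \<in> J" if "j \<in> J" for j using J_mult[OF that, of "- 1"] by simp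
  show ?thesis
  proof
    assume "QV s = QV t"
    then have "Q s \<in> QV t" using J_zero by (auto simp: QV_def)
    then obtain r where r: "r - t \<in> J" "Q s = Q r" by (auto simp: QV_def)
    then have "s - r \<in> J" using presents_eq_iff[OF pres, of s r] I_subset_J by auto
    then show "s - t \<in> J" using J_add[OF _ r(1), of "s - r"] by simp
  next
    assume *: "s - t \<in> J"
    have "r - s \<in> J \<longleftrightarrow> r - t \<in> J" for r
      using J_add[OF _ *, of "r - s"] J_add[OF _ J_minus[OF *], of "r - t"] by auto
    then show "QV s = QV t" by (simp add: QV_def)
  qed
qed

lemma QV_coset: "Q ` J +>\<^bsub>M\<^esub> Q t = QV t"
proof -
  note p = presentsD[OF pres]
  have "Q ` J +>\<^bsub>M\<^esub> Q t = (\<Union>j\<in>J. {Q (j + t)})"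
    by (auto simp: a_r_coset_def r_coset_def p)
  also have "\<dots> = QV t"
  proof
    show "(\<Union>j\<in>J. {Q (j + t)}) \<subseteq> QV t" by (auto simp: QV_def)
    show "QV t \<subseteq> (\<Union>j\<in>J. {Q (j + t)})"
    proof
      fix x assume "x \<in> QV t"
      then obtain s where "x = Q s" "s - t \<in> J" by (auto simp: QV_def)
      then show "x \<in> (\<Union>j\<in>J. {Q (j + t)})" by (intro UN_I[of "s - t"]) auto
    qed
  qed
  finally show ?thesis .
qed

text \<open>The operations of a quotient module add the submodule back because the image of a coset,
  for instance under scaling by 0, can fail to be a full coset. The map \<open>f\<close> stands for
  a scaling or a Lie algebra action.\<close>

lemma QV_set_add:
  assumes "\<And>s. f (Q s) = Q (F s)" "\<And>s. s - t \<in> J \<Longrightarrow> F s - r \<in> J" "F t = r"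
  shows "Q ` J <+>\<^bsub>M\<^esub> (f ` QV t) = QV r"
proof -
  note p = presentsD[OF pres]
  have "Q ` J <+>\<^bsub>M\<^esub> (f ` QV t) = {Q (j + F s) | j s. j \<in> J \<and> s - t \<in> J}"
    unfolding set_add_def set_mult_def QV_def by (auto simp: p assms(1))
  also have "\<dots> = QV r"
  proof
    show "{Q (j + F s) | j s. j \<in> J \<and> s - t \<in> J} \<subseteq> QV r"
      unfolding QV_def using J_add assms(2) by (auto intro!: image_eqI simp: add_diff_eq[symmetric])
    show "QV r \<subseteq> {Q (j + F s) | j s. j \<in> J \<and> s - t \<in> J}"
    proof
      fix x assume "x \<in> QV r"
      then obtain s where "x = Q s" "s - r \<in> J" by (auto simp: QV_def)
      then show "x \<in> {Q (j + F s) | j s. j \<in> J \<and> s - t \<in> J}"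
        using assms(3) J_zero by (intro CollectI exI[of _ "s - r"] exI[of _ t]) auto
    qed
  qed
  finally show ?thesis .
qed

lemma irreducible_quotient_eq: "irreducible_quotient M = quotient_module M (Q ` J)"
  by (simp add: irreducible_quotient_def maximal_proper_submodule_iff)

lemma presents_QV: "presents QV (irreducible_quotient M)"
proof -
  note p = presentsD[OF pres]
  have z: "QV 0 = Q ` J" by (simp add: QV_def)
  have add: "QV s <+>\<^bsub>M\<^esub> QV t = QV (s + t)" for s t
  proof -
    have "QV s <+>\<^bsub>M\<^esub> QV t = {Q (a + b) | a b. a - s \<in> J \<and> b - t \<in> J}"
      unfolding set_add_def set_mult_def QV_def by (auto simp: p)
    also have "\<dots> = QV (s + t)"
    proof
      show "{Q (a + b) | a b. a - s \<in> J \<and> b - t \<in> J} \<subseteq> QV (s + t)"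
        unfolding QV_def using J_add by (fastforce simp: add_diff_add[symmetric])
      show "QV (s + t) \<subseteq> {Q (a + b) | a b. a - s \<in> J \<and> b - t \<in> J}"
      proof
        fix x assume "x \<in> QV (s + t)"
        then obtain r where "x = Q r" "r - (s + t) \<in> J" by (auto simp: QV_def)
        then show "x \<in> {Q (a + b) | a b. a - s \<in> J \<and> b - t \<in> J}"
          using J_zero by (intro CollectI exI[of _ "r - t"] exI[of _ t]) (auto simp: diff_diff_eq add.commute)
      qed
    qed
    finally show ?thesis .
  qed
  have car: "a_rcosets\<^bsub>M\<^esub> (Q ` J) = range QV"
    unfolding A_RCOSETS_def RCOSETS_def a_r_coset_def[symmetric] using QV_coset p(1) by auto
  have smult: "Q ` J <+>\<^bsub>M\<^esub> ((\<lambda>v. c \<odot>\<^bsub>M\<^esub> v) ` QV t) = QV (scal c t)" for c t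
    by (rule QV_set_add[where F = "scal c"])
      (auto simp: p scal_diff[symmetric] scal_eq_single_mult right_diff_distrib[symmetric] J_mult)
  have act: "Q ` J <+>\<^bsub>M\<^esub> (act M x ` QV t) = QV (iota x * t)" for x t
    by (rule QV_set_add[where F = "\<lambda>s. iota x * s"]) (auto simp: p right_diff_distrib[symmetric] J_mult)
  show ?thesis
    unfolding irreducible_quotient_eq quotient_module_def presents_def
    using add car smult act z by simp
qed

end

section \<open>Linear independence from triangular families of functionals\<close>

lemma finsum_image:
  fixes V :: "(complex, 'v, 'm) module_scheme"
  assumes "module type_ring V" and f: "\<And>x y. x \<in> carrier V \<Longrightarrow> y \<in> carrier V \<Longrightarrow> f (x \<oplus>\<^bsub>V\<^esub> y) = f x + (f y :: complex)"
    and "finite A" "\<And>a. a \<in> A \<Longrightarrow> g a \<in> carrier V"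
  shows "f (finsum V g A) = (\<Sum>a\<in>A. f (g a))"
proof -
  interpret module "type_ring :: complex ring" V by (rule assms(1))
  have zero: "f \<zero>\<^bsub>V\<^esub> = 0" using f[of "\<zero>\<^bsub>V\<^esub>" "\<zero>\<^bsub>V\<^esub>"] by simp
  show ?thesis
    using assms(3,4) by (induction A rule: finite_induct) (auto simp: f zero Pi_def finsum_closed)
qed

text \<open>In a linear relation let \<open>n\<close> be the largest index with nonzero coefficient.
  The functional \<open>f n\<close> kills all smaller indices, so only the diagonal term remains, a
  contradiction. Triangularity also makes \<open>u\<close> injective, so its range is
  infinite.\<close>

lemma infinite_dim_triangular:
  fixes V :: "(complex, 'v, 'm) module_scheme" and u :: "nat \<Rightarrow> 'v" and f :: "nat \<Rightarrow> 'v \<Rightarrow> complex"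
  assumes mod: "module type_ring V" and u: "\<And>n. u n \<in> carrier V"
    and f_add: "\<And>n x y. x \<in> carrier V \<Longrightarrow> y \<in> carrier V \<Longrightarrow> f n (x \<oplus>\<^bsub>V\<^esub> y) = f n x + f n y"
    and f_smult: "\<And>n c x. x \<in> carrier V \<Longrightarrow> f n (c \<odot>\<^bsub>V\<^esub> x) = c * f n x"
    and tri: "\<And>k n. k < n \<Longrightarrow> f n (u k) = 0" and diag: "\<And>n. f n (u n) \<noteq> 0"
  shows "\<not> vectorspace.fin_dim type_ring V"
proof
  interpret vectorspace "type_ring :: complex ring" V
    using mod field_type_ring by (rule vectorspace.intro)
  assume fd: fin_dim
  have inj: "inj u"
  proof (rule injI)
    fix m n assume "u m = u n"
    then show "m = n" using tri[of m n] tri[of n m] diag by (metis nat_neq_iff)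
  qed
  have "lin_indpt (range u)"
  proof
    assume "lin_dep (range u)"
    then obtain A a v where A: "finite A" "A \<subseteq> range u" "lincomb a A = \<zero>\<^bsub>V\<^esub>" "v \<in> A" "a v \<noteq> 0"
      by (auto simp: lin_dep_def)
    define S where "S = {n. u n \<in> A \<and> a (u n) \<noteq> 0}"
    have "finite S"
      using finite_vimageI[OF A(1) inj] by (rule finite_subset[rotated]) (auto simp: S_def)
    moreover have "S \<noteq> {}" using A by (auto simp: S_def)
    ultimately have n: "Max S \<in> S" "\<And>m. m \<in> S \<Longrightarrow> m \<le> Max S" by auto
    define n where "n = Max S"
    have car: "x \<in> A \<Longrightarrow> x \<in> carrier V" for x using A(2) u by auto
    have "f n (lincomb a A) = (\<Sum>x\<in>A. f n (a x \<odot>\<^bsub>V\<^esub> x))"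
      unfolding lincomb_def by (rule finsum_image[OF mod f_add A(1)]) (auto simp: car)
    also have "\<dots> = (\<Sum>x\<in>A. a x * f n x)"
      by (intro sum.cong refl f_smult car)
    also have "\<dots> = (\<Sum>x\<in>{u n}. a x * f n x)"
    proof (rule sum.mono_neutral_right)
      show "{u n} \<subseteq> A" using n by (auto simp: n_def S_def)
      show "\<forall>x\<in>A - {u n}. a x * f n x = 0"
      proof
        fix x assume x: "x \<in> A - {u n}"
        then obtain m where m: "x = u m" using A(2) by auto
        show "a x * f n x = 0"
        proof (cases "m < n")
          case True then show ?thesis using tri m by simp
        next
          case False
          then have "m > n" using x m by (cases "m = n") auto
          then have "m \<notin> S" using n(2)[of m] by (auto simp: n_def)
          then show ?thesis using x m by (auto simp: S_def)
        qed
      qed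
    qed (rule A)
    also have "\<dots> \<noteq> 0" using n diag by (auto simp: n_def S_def)
    finally have "f n \<zero>\<^bsub>V\<^esub> \<noteq> 0" using A(3) by simp
    moreover have "f n \<zero>\<^bsub>V\<^esub> = 0" using f_add[of "\<zero>\<^bsub>V\<^esub>" "\<zero>\<^bsub>V\<^esub>" n] by simp
    ultimately show False by simp
  qed
  then have "finite (range u)" using fin_dim_li_fin[OF fd] u by blast
  then show False using inj finite_imageD infinite_UNIV_nat by blast
qed

context hw_module
begin

text \<open>By the definition of \<open>J\<close>, left multiplication by \<open>w n\<close>
  followed by \<psi> vanishes on \<open>J\<close> and so descends to the irreducible quotient. The
  eigenvector condition is likewise only required modulo \<open>J\<close>.\<close>

lemma infinite_dim_criterion:
  fixes u w :: "nat \<Rightarrow> 'n hv_tensor"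
  assumes wt: "\<And>n. iota (bv (E 0)) * u n - scal a (u n) \<in> J"
    and tri: "\<And>k n. k < n \<Longrightarrow> \<psi> (w n * u k) = 0" and diag: "\<And>n. \<psi> (w n * u n) \<noteq> 0"
  shows "a \<in> supp (irreducible_quotient M)" "infinite_dim_weight_space (irreducible_quotient M) a"
proof -
  let ?V = "irreducible_quotient M"
  note p = presentsD[OF presents_QV]
  define W where "W = {t. iota (bv (E 0)) * t - scal a t \<in> J}"
  have ws: "weight_space ?V a = QV ` W"
    unfolding weight_space_def W_def d_mu_def by (auto simp: p simp flip: QV_eq_iff)
  have "QV (u 0) \<noteq> QV 0"
    using diag[of 0] by (auto simp: QV_eq_iff J_def)
  then show "a \<in> supp ?V"
    using wt[of 0] by (auto simp: supp_def ws W_def p)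
  have W_zero: "0 \<in> W" by (simp add: W_def J_zero)
  have W_add: "s + t \<in> W" if "s \<in> W" "t \<in> W" for s t
    using J_add[of "iota (bv (E 0)) * s - scal a s" "iota (bv (E 0)) * t - scal a t"] that
    by (simp add: W_def algebra_simps scal_add)
  have W_scal: "scal c t \<in> W" if "t \<in> W" for c t
    using J_mult[of "iota (bv (E 0)) * t - scal a t" "Poly_Mapping.single 0 c"] that
    by (simp add: W_def scal_diff scal_mult mult.commute flip: scal_eq_single_mult)
  \<comment> \<open>An arbitrary representative is chosen; the value does not depend on it because
    two choices differ by an element of \<open>J\<close>.\<close>
  define f where "f n X = \<psi> (w n * (SOME t. QV t = X))" for n X
  have f: "f n (QV t) = \<psi> (w n * t)" for n t
  proof -
    have "QV (SOME s. QV s = QV t) = QV t" by (rule someI[of _ t]) simp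
    then have "\<psi> (w n * ((SOME s. QV s = QV t) - t)) = 0" by (simp add: QV_eq_iff J_def)
    then show ?thesis by (simp add: f_def right_diff_distrib psi_simps)
  qed
  show "infinite_dim_weight_space ?V a"
    unfolding infinite_dim_weight_space_def
  proof (rule infinite_dim_triangular)
    show "module type_ring (?V\<lparr>carrier := weight_space ?V a\<rparr>)"
      by (rule module_image[of _ QV W]) (auto simp: ws W_zero W_add W_scal p)
    show "QV (u n) \<in> carrier (?V\<lparr>carrier := weight_space ?V a\<rparr>)" for n
      using wt[of n] by (simp add: ws W_def)
    show "f n (QV (u k)) = 0" if "k < n" for k n using tri[OF that] by (simp add: f)
    show "f n (QV (u n)) \<noteq> 0" for n using diag by (simp add: f)
  qed (auto simp: ws p f psi_simps distrib_left scal_mult)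
qed

end

section \<open>Enveloping algebras\<close>

abbreviation tens :: "'n hv_basis set \<Rightarrow> 'n hv_tensor set" where
  "tens S \<equiv> {t. \<forall>w\<in>Poly_Mapping.keys t. set (letters w) \<subseteq> S}"

lemma tensor_alg_simps [simp]:
  "carrier (tensor_alg S) = tens S" "s \<otimes>\<^bsub>tensor_alg S\<^esub> t = s * t" "\<one>\<^bsub>tensor_alg S\<^esub> = 1"
  "s \<oplus>\<^bsub>tensor_alg S\<^esub> t = s + t" "\<zero>\<^bsub>tensor_alg S\<^esub> = 0"
  by (simp_all add: tensor_alg_def)

lemma tens_add: "s \<in> tens S \<Longrightarrow> t \<in> tens S \<Longrightarrow> s + t \<in> tens S"
  using keys_add[of s t] by auto

lemma tens_mult:
  assumes "s \<in> tens S" "t \<in> tens S"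
  shows "s * t \<in> tens S"
proof (rule CollectI, rule ballI)
  fix w assume "w \<in> Poly_Mapping.keys (s * t)"
  then obtain u v where "w = u + v" "u \<in> Poly_Mapping.keys s" "v \<in> Poly_Mapping.keys t"
    using keys_mult[of s t] by auto
  then show "set (letters w) \<subseteq> S"
    using assms by (auto simp: plus_free_word_def)
qed

lemma tens_one: "1 \<in> tens S"
  by (simp flip: wd_Nil)

lemma tens_single_0: "Poly_Mapping.single 0 c \<in> tens S"
  by (simp add: zero_free_word_def)

lemma tens_iota: "Poly_Mapping.keys x \<subseteq> S \<Longrightarrow> iota x \<in> tens S"
  using keys_iota[of x] by fastforce

lemma tens_minus: "t \<in> tens S \<Longrightarrow> - t \<in> tens S"
  by simp

lemma tens_diff: "s \<in> tens S \<Longrightarrow> t \<in> tens S \<Longrightarrow> s - t \<in> tens S"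
  using tens_add[OF _ tens_minus, of s S t] by simp

lemma ring_tensor_alg: "ring (tensor_alg S)"
proof (rule ringI)
  show "abelian_group (tensor_alg S)"
  proof (rule abelian_groupI)
    fix t assume "t \<in> carrier (tensor_alg S)"
    then show "\<exists>s\<in>carrier (tensor_alg S). s \<oplus>\<^bsub>tensor_alg S\<^esub> t = \<zero>\<^bsub>tensor_alg S\<^esub>"
      by (intro bexI[of _ "- t"]) simp_all
  qed (simp_all only: tensor_alg_simps tens_add add.assoc add.commute, simp_all)
  show "Group.monoid (tensor_alg S)"
    by (rule Group.monoidI) (simp_all only: tensor_alg_simps tens_mult tens_one mult.assoc, simp_all)
qed (simp_all add: distrib_left distrib_right)

lemma ideal_tensor_algI:
  assumes "X \<subseteq> tens S" "0 \<in> X" "\<And>s t. s \<in> X \<Longrightarrow> t \<in> X \<Longrightarrow> s + t \<in> X"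
    "\<And>s t. s \<in> X \<Longrightarrow> t \<in> tens S \<Longrightarrow> s * t \<in> X" "\<And>s t. s \<in> X \<Longrightarrow> t \<in> tens S \<Longrightarrow> t * s \<in> X"
  shows "ideal X (tensor_alg S)"
proof (rule idealI)
  interpret ring "tensor_alg S" by (rule ring_tensor_alg)
  have minus: "- s \<in> X" if "s \<in> X" for s
    using assms(4)[OF that tens_minus[OF tens_one]] by simp
  show "subgroup X (add_monoid (tensor_alg S))"
  proof (rule add.subgroupI)
    show "\<ominus>\<^bsub>tensor_alg S\<^esub> s \<in> X" if "s \<in> X" for s
    proof -
      have "\<ominus>\<^bsub>tensor_alg S\<^esub> s = - s"
        using that assms(1) by (intro minus_equality) (auto simp: subset_iff)
      then show ?thesis using minus[OF that] by simp
    qed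
  qed (use assms(1-3) in auto)
qed (use assms ring_tensor_alg in auto)

lemma UEA_ideal_lie_rel:
  "UEA_ideal \<mu> S = genideal (tensor_alg S)
     {lie_rel \<mu> x y | x y. Poly_Mapping.keys x \<subseteq> S \<and> Poly_Mapping.keys y \<subseteq> S}"
  by (simp add: UEA_ideal_def lie_rel_def)

definition subalg :: "complex ^ 'n \<Rightarrow> 'n hv_basis set \<Rightarrow> bool" where
  "subalg \<mu> S \<longleftrightarrow> (\<forall>a\<in>S. \<forall>b\<in>S. Poly_Mapping.keys (basis_bracket \<mu> a b) \<subseteq> S)"

lemma subalg_bracket:
  assumes "subalg \<mu> S" "Poly_Mapping.keys x \<subseteq> S" "Poly_Mapping.keys y \<subseteq> S"
  shows "Poly_Mapping.keys (bracket \<mu> x y) \<subseteq> S"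
proof
  fix c assume "c \<in> Poly_Mapping.keys (bracket \<mu> x y)"
  then have "(\<Sum>a\<in>Poly_Mapping.keys x. Poly_Mapping.lookup x a *
      (\<Sum>b\<in>Poly_Mapping.keys y. Poly_Mapping.lookup y b * Poly_Mapping.lookup (basis_bracket \<mu> a b) c)) \<noteq> 0"
    by (simp add: in_keys_iff bracket_scal lookup_sum lookup_scal)
  then obtain a where a: "a \<in> Poly_Mapping.keys x"
    "(\<Sum>b\<in>Poly_Mapping.keys y. Poly_Mapping.lookup y b * Poly_Mapping.lookup (basis_bracket \<mu> a b) c) \<noteq> 0"
    by (metis (no_types, lifting) mult_zero_right sum.neutral)
  then obtain b where "b \<in> Poly_Mapping.keys y" "Poly_Mapping.lookup (basis_bracket \<mu> a b) c \<noteq> 0"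
    by (metis (no_types, lifting) mult_zero_right sum.neutral)
  then show "c \<in> S" using a(1) assms by (auto simp: subalg_def in_keys_iff subset_iff)
qed

lemma tens_lie_rel:
  assumes "subalg \<mu> S" "Poly_Mapping.keys x \<subseteq> S" "Poly_Mapping.keys y \<subseteq> S"
  shows "lie_rel \<mu> x y \<in> tens S"
  unfolding lie_rel_def
  by (intro tens_diff tens_mult tens_iota assms subalg_bracket)

text \<open>The third part acts as an induction principle: a property of all elements of the ideal
  follows once it defines an ideal containing the relators.\<close>

lemma UEA_ideal_props:
  assumes "subalg \<mu> S"
  shows "ideal (UEA_ideal \<mu> S) (tensor_alg S)"
    "\<And>x y. Poly_Mapping.keys x \<subseteq> S \<Longrightarrow> Poly_Mapping.keys y \<subseteq> S \<Longrightarrow> lie_rel \<mu> x y \<in> UEA_ideal \<mu> S"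
    "\<And>X. ideal X (tensor_alg S) \<Longrightarrow>
      (\<And>x y. Poly_Mapping.keys x \<subseteq> S \<Longrightarrow> Poly_Mapping.keys y \<subseteq> S \<Longrightarrow> lie_rel \<mu> x y \<in> X) \<Longrightarrow> UEA_ideal \<mu> S \<subseteq> X"
proof -
  interpret ring "tensor_alg S" by (rule ring_tensor_alg)
  have sub: "{lie_rel \<mu> x y | x y. Poly_Mapping.keys x \<subseteq> S \<and> Poly_Mapping.keys y \<subseteq> S} \<subseteq> carrier (tensor_alg S)"
    using tens_lie_rel[OF assms] by fastforce
  show "ideal (UEA_ideal \<mu> S) (tensor_alg S)"
    unfolding UEA_ideal_lie_rel by (rule genideal_ideal[OF sub])
  show "lie_rel \<mu> x y \<in> UEA_ideal \<mu> S" if "Poly_Mapping.keys x \<subseteq> S" "Poly_Mapping.keys y \<subseteq> S" for x y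
    unfolding UEA_ideal_lie_rel using genideal_self[OF sub] that by auto
  show "UEA_ideal \<mu> S \<subseteq> X" if "ideal X (tensor_alg S)"
    "\<And>x y. Poly_Mapping.keys x \<subseteq> S \<Longrightarrow> Poly_Mapping.keys y \<subseteq> S \<Longrightarrow> lie_rel \<mu> x y \<in> X" for X
    unfolding UEA_ideal_lie_rel by (rule genideal_minimal[OF that(1)]) (use that(2) in auto)
qed

section \<open>The character and \<psi> on the defining ideals\<close>

lemma tensor_char_props:
  fixes s t :: "('n::finite) hv_tensor"
  shows "is_linear (*) (tensor_char lam :: 'n hv_tensor \<Rightarrow> complex)"
    "tensor_char lam (s * t) = tensor_char lam s * tensor_char lam t"
    "tensor_char lam (iota x :: 'n hv_tensor) = chi lam x"
    "tensor_char lam (Poly_Mapping.single 0 c :: 'n hv_tensor) = c"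
proof -
  show lin: "is_linear (*) (tensor_char lam :: 'n hv_tensor \<Rightarrow> complex)"
    unfolding tensor_char_def[abs_def] by (rule is_linear_timesI)
  have wd: "tensor_char lam (wd xs :: 'n hv_tensor) = prod_list (map (weight_char lam) xs)" for xs
    by (simp add: tensor_char_def)
  have lin_mult: "is_linear (*) (\<lambda>t :: 'n hv_tensor. tensor_char lam (s * t))"
    "is_linear (*) (\<lambda>t :: 'n hv_tensor. tensor_char lam s * tensor_char lam t)"
    "is_linear (*) (\<lambda>s :: 'n hv_tensor. tensor_char lam (s * t))"
    "is_linear (*) (\<lambda>s :: 'n hv_tensor. tensor_char lam s * tensor_char lam t)"
    for s t :: "'n hv_tensor"
    using lin by (auto simp: is_linear_def algebra_simps scal_mult)
  have 1: "tensor_char lam (wd xs * wd ys :: 'n hv_tensor) = tensor_char lam (wd xs :: 'n hv_tensor) * tensor_char lam (wd ys :: 'n hv_tensor)" for xs ys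
    unfolding wd_append[symmetric] wd by simp
  have 2: "tensor_char lam (wd xs * t) = tensor_char lam (wd xs :: 'n hv_tensor) * tensor_char lam t" for xs t
    by (rule tensor_eqI[OF lin_mult(1,2)]) (rule 1)
  show "tensor_char lam (s * t) = tensor_char lam s * tensor_char lam t"
    by (rule tensor_eqI[OF lin_mult(3,4)]) (rule 2)
  show "tensor_char lam (iota x :: 'n hv_tensor) = chi lam x"
  proof (rule is_linear_eq_on_keys[where F = "\<lambda>x. tensor_char lam (iota x :: 'n hv_tensor)"])
    show "is_linear (*) (\<lambda>x. tensor_char lam (iota x :: 'n hv_tensor))"
      using lin is_linear_iota by (rule is_linear_comp)
    show "is_linear (*) (chi lam)" by (rule is_linear_chi)
    show "tensor_char lam (iota (bv a) :: 'n hv_tensor) = chi lam (bv a)" for a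
      using wd[of "[a]"] by (simp add: iota_single chi_single)
  qed
  show "tensor_char lam (Poly_Mapping.single 0 c :: 'n hv_tensor) = c"
    by (cases "c = 0") (simp_all add: tensor_char_def zero_free_word_def)
qed

context hv_triangular
begin

abbreviation "IU \<equiv> UEA_ideal \<mu> (UNIV :: 'n hv_basis set)"
abbreviation "IB \<equiv> UEA_ideal \<mu> B"

lemma subalg_UNIV: "subalg \<mu> (UNIV :: 'n hv_basis set)"
  by (simp add: subalg_def)

lemma subalg_B: "subalg \<mu> B"
  by (simp add: subalg_def borel_bracket)

lemma chi_bracket:
  assumes "Poly_Mapping.keys x \<subseteq> B" "Poly_Mapping.keys y \<subseteq> B"
  shows "chi lam (bracket \<mu> x y) = 0"
proof (rule is_linear_zeroI[where F = "\<lambda>x. chi lam (bracket \<mu> x y)"])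
  show "is_linear (*) (\<lambda>x. chi lam (bracket \<mu> x y))"
    by (rule is_linear_comp[OF is_linear_chi is_linear_bracket_left])
  fix a assume a: "a \<in> Poly_Mapping.keys x"
  show "chi lam (bracket \<mu> (bv a) y) = 0"
  proof (rule is_linear_zeroI[where F = "\<lambda>y. chi lam (bracket \<mu> (bv a) y)"])
    show "is_linear (*) (\<lambda>y. chi lam (bracket \<mu> (bv a) y))"
      by (rule is_linear_comp[OF is_linear_chi is_linear_bracket_right])
    show "chi lam (bracket \<mu> (bv a) (bv b)) = 0" if "b \<in> Poly_Mapping.keys y" for b
      using a that assms borel_bracket(2)[of a b] by auto
  qed simp
qed simp

text \<open>The kernel of the character is an ideal and contains the relators, because the scalars
  commute and \<open>chi\<close> kills brackets. Hence \<open>the_elem\<close> in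
  \<open>borel_action\<close> is applied to a singleton.\<close>

lemma tensor_char_IB: "IB \<subseteq> {t \<in> tens B. tensor_char lam t = 0}"
proof (rule UEA_ideal_props(3)[OF subalg_B])
  show "ideal {t \<in> tens B. tensor_char lam t = 0} (tensor_alg B)"
  proof (rule ideal_tensor_algI)
    show "s * t \<in> {t \<in> tens B. tensor_char lam t = 0}" "t * s \<in> {t \<in> tens B. tensor_char lam t = 0}"
      if "s \<in> {t \<in> tens B. tensor_char lam t = 0}" "t \<in> tens B" for s t
      using that tens_mult[of s B t] tens_mult[of t B s] by (simp_all add: tensor_char_props(2))
    show "s + t \<in> {t \<in> tens B. tensor_char lam t = 0}"
      if "s \<in> {t \<in> tens B. tensor_char lam t = 0}" "t \<in> {t \<in> tens B. tensor_char lam t = 0}" for s t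
      using that tens_add[of s B t] by (simp add: is_linear_add[OF tensor_char_props(1)])
  qed (auto simp: is_linear_0[OF tensor_char_props(1)])
  show "lie_rel \<mu> x y \<in> {t \<in> tens B. tensor_char lam t = 0}"
    if "Poly_Mapping.keys x \<subseteq> B" "Poly_Mapping.keys y \<subseteq> B" for x y
    using tens_lie_rel[OF subalg_B that] chi_bracket[OF that]
    by (simp add: lie_rel_def is_linear_diff[OF tensor_char_props(1)] tensor_char_props)
qed

lemma IU_props: "0 \<in> IU" "s \<in> IU \<Longrightarrow> t \<in> IU \<Longrightarrow> s + t \<in> IU" "s \<in> IU \<Longrightarrow> - s \<in> IU"
  "s \<in> IU \<Longrightarrow> a * s * b \<in> IU"
proof -
  interpret ideal IU "tensor_alg (UNIV :: 'n hv_basis set)" by (rule UEA_ideal_props(1)[OF subalg_UNIV])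
  show "0 \<in> IU" using additive_subgroup.zero_closed[OF additive_subgroup_axioms] by simp
  show "s + t \<in> IU" if "s \<in> IU" "t \<in> IU" using additive_subgroup.a_closed[OF additive_subgroup_axioms that] by simp
  show "a * s * b \<in> IU" if "s \<in> IU" for a b s
    using I_r_closed[OF I_l_closed[OF that, of a], of b] by simp
  from this[of s "- 1" 1] show "- s \<in> IU" if "s \<in> IU" using that by simp
qed

text \<open>Ensures that \<open>UEA_incl\<close> sends a coset of the small ideal to exactly one
  coset of the large ideal.\<close>

lemma IB_subset_IU: "IB \<subseteq> IU"
proof -
  have "IB \<subseteq> IU \<inter> tens B"
  proof (rule UEA_ideal_props(3)[OF subalg_B])
    show "ideal (IU \<inter> tens B) (tensor_alg B)"
    proof (rule ideal_tensor_algI)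
      show "s * t \<in> IU \<inter> tens B" "t * s \<in> IU \<inter> tens B" if "s \<in> IU \<inter> tens B" "t \<in> tens B" for s t
        using that tens_mult[of s B t] tens_mult[of t B s] IU_props(4)[of s 1 t] IU_props(4)[of s t 1] by auto
      show "s + t \<in> IU \<inter> tens B" if "s \<in> IU \<inter> tens B" "t \<in> IU \<inter> tens B" for s t
        using that tens_add[of s B t] IU_props(2)[of s t] by auto
    qed (use IU_props(1) in auto)
    show "lie_rel \<mu> x y \<in> IU \<inter> tens B" if "Poly_Mapping.keys x \<subseteq> B" "Poly_Mapping.keys y \<subseteq> B" for x y
      using tens_lie_rel[OF subalg_B that] UEA_ideal_props(2)[OF subalg_UNIV, of x y] by auto
  qed
  then show ?thesis by simp
qed

text \<open>The outer factors are quantified inside the set so that it becomes a two-sided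
  ideal.\<close>

lemma psi_IU: "t \<in> IU \<Longrightarrow> \<psi> (a * t * b) = 0"
proof -
  have "IU \<subseteq> {t. \<forall>a b. \<psi> (a * t * b) = 0}"
  proof (rule UEA_ideal_props(3)[OF subalg_UNIV])
    show "ideal {t. \<forall>a b. \<psi> (a * t * b) = 0} (tensor_alg UNIV)"
    proof (rule ideal_tensor_algI)
      show "s * t \<in> {t. \<forall>a b. \<psi> (a * t * b) = 0}" "t * s \<in> {t. \<forall>a b. \<psi> (a * t * b) = 0}"
        if s: "s \<in> {t. \<forall>a b. \<psi> (a * t * b) = 0}" for s t
      proof -
        have "\<psi> (a * s * (t * b)) = 0" "\<psi> ((a * t) * s * b) = 0" for a b using s by auto
        then show "s * t \<in> {t. \<forall>a b. \<psi> (a * t * b) = 0}" "t * s \<in> {t. \<forall>a b. \<psi> (a * t * b) = 0}"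
          by (simp_all add: mult.assoc)
      qed
    qed (auto simp: distrib_left distrib_right psi_simps)
  qed (simp add: psi_lie_rel)
  then show "t \<in> IU \<Longrightarrow> \<psi> (a * t * b) = 0" by blast
qed

text \<open>This is the compatibility of \<psi> with the balancing relation of the tensor product
  over the Borel enveloping algebra.\<close>

lemma psi_tens_B: "t \<in> tens B \<Longrightarrow> \<psi> (s * t) = tensor_char lam t * \<psi> s"
proof (rule is_linear_eq_on_keys[where F = "\<lambda>t. \<psi> (s * t)"])
  show "is_linear (*) (\<lambda>t. \<psi> (s * t))" "is_linear (*) (\<lambda>t :: 'n hv_tensor. tensor_char lam t * \<psi> s)"
    using tensor_char_props(1)[of lam, where ?'n = 'n] by (auto simp: is_linear_def psi_simps distrib_left distrib_right scal_mult)
  fix w assume w: "t \<in> tens B" "w \<in> Poly_Mapping.keys t"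
  have "\<psi> (s * wd xs) = tensor_char lam (wd xs :: 'n hv_tensor) * \<psi> s" if "set xs \<subseteq> B" for xs s
    using that
  proof (induction xs arbitrary: s)
    case Nil then show ?case by (simp add: wd_Nil tensor_char_props(4)[of lam 1, simplified])
  next
    case (Cons b xs)
    then show ?case
      using psi_borel_right[of b s] by (simp add: wd_Cons tensor_char_props chi_single flip: mult.assoc)
  qed
  from this[of "letters w"] show "\<psi> (s * Poly_Mapping.single w 1) = tensor_char lam (Poly_Mapping.single w 1 :: 'n hv_tensor) * \<psi> s"
    using w by auto
qed

section \<open>Cosets in the two enveloping algebras\<close>

abbreviation "cl \<equiv> UEA_class \<mu> :: 'n hv_tensor \<Rightarrow> 'n hv_tensor set"

lemma cl_eq: "cl t = (\<lambda>i. i + t) ` IU"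
  by (auto simp: UEA_class_def a_r_coset_def r_coset_def tensor_alg_def)

lemma cl_eqI: "s - t \<in> IU \<Longrightarrow> cl s = cl t"
proof -
  have sub: "cl s \<subseteq> cl t" if st: "s - t \<in> IU" for s t
  proof
    fix x assume "x \<in> cl s"
    then obtain i where "i \<in> IU" "x = i + s" by (auto simp: cl_eq)
    then show "x \<in> cl t"
      unfolding cl_eq using IU_props(2)[OF _ st, of i] by (intro image_eqI[of _ _ "i + (s - t)"]) auto
  qed
  assume "s - t \<in> IU"
  then show ?thesis using sub[of s t] sub[of t s] IU_props(3)[of "s - t"] by auto
qed

abbreviation "UU \<equiv> UEA \<mu> (UNIV :: 'n hv_basis set)"

lemma UU_simps: "carrier UU = range cl" "cl s \<otimes>\<^bsub>UU\<^esub> cl t = cl (s * t)" "cl s \<oplus>\<^bsub>UU\<^esub> cl t = cl (s + t)"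
proof -
  interpret ideal IU "tensor_alg (UNIV :: 'n hv_basis set)" by (rule UEA_ideal_props(1)[OF subalg_UNIV])
  show "carrier UU = range cl"
    by (auto simp: UEA_def FactRing_def A_RCOSETS_def RCOSETS_def UEA_class_def a_r_coset_def)
  show "cl s \<otimes>\<^bsub>UU\<^esub> cl t = cl (s * t)"
    using rcoset_mult_add[of s t] by (simp add: UEA_def FactRing_def UEA_class_def)
  show "cl s \<oplus>\<^bsub>UU\<^esub> cl t = cl (s + t)"
    using a_rcos_sum[of s t] by (simp add: UEA_def FactRing_def UEA_class_def)
qed

definition clB :: "'n hv_tensor \<Rightarrow> 'n hv_tensor set" where
  "clB t = (\<lambda>i. i + t) ` IB"

lemma IB_zero: "0 \<in> IB"
proof -
  interpret ideal IB "tensor_alg B" by (rule UEA_ideal_props(1)[OF subalg_B])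
  show ?thesis using additive_subgroup.zero_closed[OF additive_subgroup_axioms] by simp
qed

lemma carrier_UEA_B: "carrier (UEA \<mu> B) = clB ` tens B"
  by (auto simp: UEA_def FactRing_def A_RCOSETS_def RCOSETS_def clB_def r_coset_def image_def)

lemma UEA_incl_clB: "UEA_incl \<mu> (clB t) = cl t"
proof -
  have "UEA_incl \<mu> (clB t) = {i + (j + t) | i j. i \<in> IU \<and> j \<in> IB}"
    by (auto simp: UEA_incl_def clB_def set_add_def set_mult_def)
  also have "\<dots> = cl t"
  proof
    show "{i + (j + t) | i j. i \<in> IU \<and> j \<in> IB} \<subseteq> cl t"
    proof
      fix x assume "x \<in> {i + (j + t) | i j. i \<in> IU \<and> j \<in> IB}"
      then obtain i j where "x = (i + j) + t" "i + j \<in> IU" using IB_subset_IU IU_props(2) by (auto simp: add.assoc)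
      then show "x \<in> cl t" by (auto simp: cl_eq)
    qed
    show "cl t \<subseteq> {i + (j + t) | i j. i \<in> IU \<and> j \<in> IB}"
      unfolding cl_eq using IB_zero by force
  qed
  finally show ?thesis .
qed

lemma borel_action_clB: "t \<in> tens B \<Longrightarrow> borel_action lam (clB t) z = tensor_char lam t * z"
proof -
  have "tensor_char lam ` clB t = {tensor_char lam t}"
    using tensor_char_IB IB_zero by (auto simp: clB_def image_image is_linear_add[OF tensor_char_props(1)] intro!: image_eqI[of _ _ 0] dest: subsetD)
  then show ?thesis by (simp add: borel_action_def)
qed

lemma psi_cl: "\<psi> ` cl t = {\<psi> t}"
proof -
  have "\<psi> i = 0" if "i \<in> IU" for i using psi_IU[OF that, of 1 1] by simp
  then show ?thesis
    using IU_props(1) by (force simp: cl_eq image_image psi_simps)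
qed

end

section \<open>The Verma module\<close>

lemma set_mult_free: "X <#>\<^bsub>free_Abelian_group S\<^esub> Y = {x + y | x y. x \<in> X \<and> y \<in> Y}"
  by (auto simp: set_mult_def)

text \<open>The generators must lie in the carrier for their group inverse to be the negative, which
  is what the condition on keys secures.\<close>

lemma generate_free_minimal:
  assumes "f \<in> generate (free_Abelian_group S) G" "\<And>g. g \<in> G \<Longrightarrow> Poly_Mapping.keys g \<subseteq> S"
    "0 \<in> X" "\<And>f g. f \<in> X \<Longrightarrow> g \<in> X \<Longrightarrow> f + g \<in> X" "\<And>g. g \<in> G \<Longrightarrow> g \<in> X" "\<And>g. g \<in> G \<Longrightarrow> - g \<in> X"
  shows "f \<in> X"
  using assms(1) by induction (simp_all add: assms)

context hv_triangular
begin

abbreviation "pairs \<equiv> range cl \<times> (UNIV :: complex set)"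
abbreviation "FF \<equiv> free_Abelian_group pairs"

definition gen :: "'n hv_tensor \<Rightarrow> complex \<Rightarrow> 'n hv_tensor set \<times> complex \<Rightarrow>\<^sub>0 int" where
  "gen t c = frag_of (cl t, c)"

text \<open>The three families of \<open>tensor_relators\<close>, with elements of the enveloping
  algebras replaced by representing tensors.\<close>

definition relators :: "('n hv_tensor set \<times> complex \<Rightarrow>\<^sub>0 int) set" where
  "relators =
     {frag_of (cl (s + t), c) - frag_of (cl s, c) - frag_of (cl t, c) | s t c. True} \<union>
     {frag_of (cl s, c + d) - frag_of (cl s, c) - frag_of (cl s, d) | s c d. True} \<union>
     {frag_of (cl (s * t), c) - frag_of (cl s, tensor_char lam t * c) | s t c. t \<in> tens B}"

abbreviation "KK \<equiv> generate FF relators"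

lemma tensor_free_eq: "tensor_free UU (type_ring :: complex ring) = FF"
  by (simp add: tensor_free_def UU_simps)

lemma tensor_relators_eq:
  "tensor_relators UU (UEA \<mu> B) (type_ring :: complex ring) (\<lambda>u B. u \<otimes>\<^bsub>UU\<^esub> UEA_incl \<mu> B) (borel_action lam) = KK"
proof -
  have 1: "{frag_of (u \<oplus>\<^bsub>UU\<^esub> u', w) - frag_of (u, w) - frag_of (u', w) | u u' w.
      u \<in> carrier UU \<and> u' \<in> carrier UU \<and> w \<in> carrier (type_ring :: complex ring)} =
    {frag_of (cl (s + t), c) - frag_of (cl s, c) - frag_of (cl t, c) | s t c. True}"
    by (force simp: UU_simps)
  have 2: "{frag_of (u, w \<oplus>\<^bsub>type_ring\<^esub> w') - frag_of (u, w) - frag_of (u, w') | u w w'.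
      u \<in> carrier UU \<and> w \<in> carrier (type_ring :: complex ring) \<and> w' \<in> carrier (type_ring :: complex ring)} =
    {frag_of (cl s, c + d) - frag_of (cl s, c) - frag_of (cl s, d) | s c d. True}"
    by (force simp: UU_simps)
  have 3: "{frag_of (u \<otimes>\<^bsub>UU\<^esub> UEA_incl \<mu> r, w) - frag_of (u, borel_action lam r w) | u r w.
      u \<in> carrier UU \<and> r \<in> carrier (UEA \<mu> B) \<and> w \<in> carrier (type_ring :: complex ring)} =
    {frag_of (cl (s * t), c) - frag_of (cl s, tensor_char lam t * c) | s t c. t \<in> tens B}"
    (is "?L = ?R")
  proof
    show "?L \<subseteq> ?R"
    proof
      fix x assume "x \<in> ?L"
      then obtain s t c where "t \<in> tens B" "x = frag_of (cl s \<otimes>\<^bsub>UU\<^esub> UEA_incl \<mu> (clB t), c) - frag_of (cl s, borel_action lam (clB t) c)"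
        unfolding carrier_UEA_B UU_simps(1) by blast
      then show "x \<in> ?R"
        by (auto simp: UEA_incl_clB UU_simps borel_action_clB simp del: mem_Collect_eq) blast?
    qed
    show "?R \<subseteq> ?L"
    proof
      fix x assume "x \<in> ?R"
      then obtain s t c where t: "t \<in> tens B" and x: "x = frag_of (cl (s * t), c) - frag_of (cl s, tensor_char lam t * c)"
        by blast
      have "x = frag_of (cl s \<otimes>\<^bsub>UU\<^esub> UEA_incl \<mu> (clB t), c) - frag_of (cl s, borel_action lam (clB t) c)"
        unfolding x UEA_incl_clB UU_simps borel_action_clB[OF t] ..
      moreover have "cl s \<in> carrier UU" "clB t \<in> carrier (UEA \<mu> B)"
        unfolding carrier_UEA_B UU_simps(1) using t by blast+
      ultimately show "x \<in> ?L" by auto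
    qed
  qed
  show ?thesis
    unfolding tensor_relators_def 1 2 3 tensor_free_eq relators_def ..
qed

lemma relatorsE:
  assumes "g \<in> relators"
  obtains (add) s t c where "g = gen (s + t) c - gen s c - gen t c"
    | (add_right) s c d where "g = gen s (c + d) - gen s c - gen s d"
    | (balanced) s t c where "g = gen (s * t) c - gen s (tensor_char lam t * c)" "t \<in> tens B"
  using assms unfolding relators_def gen_def[symmetric] by blast

lemma relatorsI:
  "gen (s + t) c - gen s c - gen t c \<in> relators"
  "gen s (c + d) - gen s c - gen s d \<in> relators"
  "t \<in> tens B \<Longrightarrow> gen (s * t) c - gen s (tensor_char lam t * c) \<in> relators"
  unfolding relators_def gen_def[symmetric] by blast+

lemma keys_gen: "Poly_Mapping.keys (gen t c) \<subseteq> pairs"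
  by (simp add: gen_def)

lemma keys_relators: "g \<in> relators \<Longrightarrow> Poly_Mapping.keys g \<subseteq> pairs"
proof -
  have d: "Poly_Mapping.keys (f - g) \<subseteq> pairs"
    if "Poly_Mapping.keys f \<subseteq> pairs" "Poly_Mapping.keys g \<subseteq> pairs" for f g :: "'n hv_tensor set \<times> complex \<Rightarrow>\<^sub>0 int"
    using that keys_diff[of f g] by blast
  show "g \<in> relators \<Longrightarrow> Poly_Mapping.keys g \<subseteq> pairs"
    by (elim relatorsE) (simp_all only: d keys_gen)
qed

lemma KK_minimal:
  assumes "f \<in> KK" "0 \<in> X" "\<And>f g. f \<in> X \<Longrightarrow> g \<in> X \<Longrightarrow> f + g \<in> X"
    "\<And>g. g \<in> relators \<Longrightarrow> g \<in> X" "\<And>g. g \<in> relators \<Longrightarrow> - g \<in> X"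
  shows "f \<in> X"
  using generate_free_minimal[OF assms(1) keys_relators assms(2-5)] .

lemma KK_zero: "0 \<in> KK"
  using generate.one[of FF relators] by simp

lemma KK_add: "f \<in> KK \<Longrightarrow> g \<in> KK \<Longrightarrow> f + g \<in> KK"
  using generate.eng[of f FF relators g] by simp

lemma KK_relator: "g \<in> relators \<Longrightarrow> g \<in> KK" "g \<in> relators \<Longrightarrow> - g \<in> KK"
  using generate.incl[of g relators FF] generate.inv[of g relators FF] keys_relators[of g] by auto

lemma KK_minus:
  assumes "f \<in> KK"
  shows "- f \<in> KK"
proof -
  have "f \<in> {f. - f \<in> KK}"
  proof (rule KK_minimal[OF assms])
    show "f + g \<in> {f. - f \<in> KK}" if "f \<in> {f. - f \<in> KK}" "g \<in> {f. - f \<in> KK}" for f g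
      using KK_add[of "- f" "- g"] that by simp
  qed (simp_all add: KK_zero KK_relator)
  then show ?thesis by simp
qed

definition coset :: "('n hv_tensor set \<times> complex \<Rightarrow>\<^sub>0 int) \<Rightarrow> 'n verma_space" where
  "coset f = (\<lambda>k. k + f) ` KK"

lemma coset_eq: "KK #>\<^bsub>FF\<^esub> f = coset f"
  by (auto simp: r_coset_def coset_def)

lemma coset_eq_iff: "coset f = coset g \<longleftrightarrow> f - g \<in> KK"
proof
  have sub: "coset f \<subseteq> coset g" if fg: "f - g \<in> KK" for f g
  proof
    fix x assume "x \<in> coset f"
    then obtain k where "k \<in> KK" "x = k + f" by (auto simp: coset_def)
    then show "x \<in> coset g"
      unfolding coset_def using KK_add[OF _ fg, of k] by (intro image_eqI[of _ _ "k + (f - g)"]) auto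
  qed
  show "coset f = coset g" if "f - g \<in> KK"
    using sub[of f g] sub[of g f] that KK_minus[OF that] by auto
  assume "coset f = coset g"
  then have "f \<in> coset g" using KK_zero by (force simp: coset_def)
  then show "f - g \<in> KK" by (auto simp: coset_def)
qed

lemma coset_add: "coset f <#>\<^bsub>FF\<^esub> coset g = coset (f + g)"
proof
  show "coset f <#>\<^bsub>FF\<^esub> coset g \<subseteq> coset (f + g)"
  proof
    fix x assume "x \<in> coset f <#>\<^bsub>FF\<^esub> coset g"
    then obtain k l where "k \<in> KK" "l \<in> KK" "x = (k + l) + (f + g)"
      by (auto simp: set_mult_free coset_def ac_simps)
    then show "x \<in> coset (f + g)" using KK_add[of k l] by (auto simp: coset_def)
  qed
  show "coset (f + g) \<subseteq> coset f <#>\<^bsub>FF\<^esub> coset g"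
  proof
    fix x assume "x \<in> coset (f + g)"
    then obtain k where "k \<in> KK" "x = (k + f) + (0 + g)" by (auto simp: coset_def ac_simps)
    then show "x \<in> coset f <#>\<^bsub>FF\<^esub> coset g" using KK_zero unfolding set_mult_free coset_def by blast
  qed
qed

lemma gen_add: "gen (s + t) c - gen s c - gen t c \<in> KK"
  and gen_add_right: "gen s (c + d) - gen s c - gen s d \<in> KK"
  and gen_balanced: "t \<in> tens B \<Longrightarrow> gen (s * t) c - gen s (tensor_char lam t * c) \<in> KK"
  by (rule KK_relator(1), rule relatorsI; assumption?)+

definition qv :: "'n hv_tensor \<Rightarrow> 'n verma_space" where
  "qv t = coset (gen t 1)"

text \<open>Scalars belong to the Borel enveloping algebra, so balancing moves the complex factor of
  a pure tensor into its first factor.\<close>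

lemma coset_gen: "coset (gen t c) = qv (scal c t)"
  using KK_minus[OF gen_balanced[OF tens_single_0[of c], of t 1]]
  by (simp add: qv_def coset_eq_iff tensor_char_props scal_eq_single_mult single_0_mult_commute)

lemma coset_minus: "coset (f - g) = coset h" if "coset f = coset (h + g)" for f g h
  using that by (simp add: coset_eq_iff algebra_simps)

lemma qv_add: "qv s <#>\<^bsub>FF\<^esub> qv t = qv (s + t)"
  using KK_minus[OF gen_add[of s t 1]]
  by (simp add: qv_def coset_add coset_eq_iff algebra_simps)

lemma qv_zero: "qv 0 = KK"
proof -
  have "coset (gen 0 1) = coset 0"
    using KK_minus[OF gen_add[of 0 0 1]] by (simp add: coset_eq_iff)
  then show ?thesis by (simp add: qv_def coset_def)
qed

text \<open>Each pure tensor is some \<open>qv t\<close>, and \<open>qv\<close> is additive, so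
  differences of pure tensors are again of this form. Thus the Verma module is a quotient of the
  tensor algebra.\<close>

lemma coset_in_range: "Poly_Mapping.keys f \<subseteq> pairs \<Longrightarrow> coset f \<in> range qv"
proof (induction f rule: frag_induction)
  case zero
  have "coset 0 = qv 0" by (simp add: qv_zero coset_def)
  then show ?case by simp
next
  case (one x)
  then obtain t c where "x = (cl t, c)" by auto
  then show ?case using coset_gen[of t c] by (simp add: gen_def)
next
  case (diff f g)
  then obtain s t where st: "coset f = qv s" "coset g = qv t" by auto
  have "coset f = coset (gen (s - t) 1 + g)"
    using qv_add[of "s - t" t] coset_add[of "gen (s - t) 1" g] st by (simp add: qv_def)
  then have "coset (f - g) = qv (s - t)" by (simp add: coset_minus qv_def)
  then show ?case by simp
qed

lemma carrier_FF_Mod: "carrier (FF Mod KK) = range qv"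
proof
  show "carrier (FF Mod KK) \<subseteq> range qv"
    using coset_in_range by (auto simp: FactGroup_def RCOSETS_def coset_eq)
  have "qv t \<in> carrier (FF Mod KK)" for t
  proof -
    have "gen t 1 \<in> carrier FF" using keys_gen[of t 1] by simp
    then have "coset (gen t 1) \<in> (\<Union>a\<in>carrier FF. {coset a})" by blast
    then show ?thesis by (simp only: FactGroup_def RCOSETS_def coset_eq qv_def partial_object.simps)
  qed
  then show "range qv \<subseteq> carrier (FF Mod KK)" by blast
qed

text \<open>Left multiplication by \<open>r\<close> commutes with the right action used for
  balancing, so it maps relators to relators and preserves \<open>KK\<close>.\<close>

lemma tensor_map_qv: "tensor_map FF KK (\<lambda>u. cl r \<otimes>\<^bsub>UU\<^esub> u) (qv t) = qv (r * t)"
proof -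
  define L :: "('n hv_tensor set \<times> complex \<Rightarrow>\<^sub>0 int) \<Rightarrow> _" where
    "L = frag_extend (\<lambda>(u, w). frag_of (cl r \<otimes>\<^bsub>UU\<^esub> u, w))"
  have L_gen: "L (gen s c) = gen (r * s) c" for s c
    by (simp add: L_def gen_def UU_simps)
  have L_add: "L (f + g) = L f + L g" and L_minus: "L (- f) = - L f" and L_diff: "L (f - g) = L f - L g"
    and L_zero: "L 0 = 0" for f g
    by (simp_all add: L_def frag_extend_add frag_extend_minus frag_extend_diff)
  have rel: "L g \<in> KK" if "g \<in> relators" for g
    using that
  proof (cases rule: relatorsE)
    case (add s t c)
    then show ?thesis using gen_add[of "r * s" "r * t" c] by (simp add: L_diff L_gen distrib_left)
  next
    case (add_right s c d)
    then show ?thesis using gen_add_right[of "r * s" c d] by (simp add: L_diff L_gen)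
  next
    case (balanced s t c)
    then show ?thesis using gen_balanced[of t "r * s" c] by (simp only: L_diff L_gen mult.assoc)
  qed
  have L_KK: "L k \<in> KK" if "k \<in> KK" for k
  proof -
    have "k \<in> {f. L f \<in> KK}"
      by (rule KK_minimal[OF that]) (simp_all add: KK_zero KK_add KK_minus rel L_add L_minus L_zero)
    then show ?thesis by simp
  qed
  have "tensor_map FF KK (\<lambda>u. cl r \<otimes>\<^bsub>UU\<^esub> u) (qv t) = {k + L f | k f. k \<in> KK \<and> f \<in> qv t}"
    unfolding tensor_map_def L_def[symmetric] set_mult_free by blast
  also have "\<dots> = {k + (L l + gen (r * t) 1) | k l. k \<in> KK \<and> l \<in> KK}"
  proof -
    have "L (l + gen t 1) = L l + gen (r * t) 1" for l by (simp only: L_add L_gen)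
    then have "L ` qv t = (\<lambda>l. L l + gen (r * t) 1) ` KK" by (simp only: qv_def coset_def image_image)
    moreover have "{k + L f | k f. k \<in> KK \<and> f \<in> qv t} = {k + m | k m. k \<in> KK \<and> m \<in> L ` qv t}" by blast
    ultimately have "{k + L f | k f. k \<in> KK \<and> f \<in> qv t} =
        {k + m | k m. k \<in> KK \<and> m \<in> (\<lambda>l. L l + gen (r * t) 1) ` KK}" by (simp only:)
    then show ?thesis by blast
  qed
  also have "\<dots> = qv (r * t)"
  proof
    show "{k + (L l + gen (r * t) 1) | k l. k \<in> KK \<and> l \<in> KK} \<subseteq> qv (r * t)"
    proof
      fix x assume "x \<in> {k + (L l + gen (r * t) 1) | k l. k \<in> KK \<and> l \<in> KK}"
      then obtain k l where "x = (k + L l) + gen (r * t) 1" "k + L l \<in> KK"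
        using KK_add L_KK by (auto simp: add.assoc)
      then show "x \<in> qv (r * t)" by (auto simp: qv_def coset_def)
    qed
    show "qv (r * t) \<subseteq> {k + (L l + gen (r * t) 1) | k l. k \<in> KK \<and> l \<in> KK}"
    proof
      fix x assume "x \<in> qv (r * t)"
      then obtain k where "k \<in> KK" "x = k + (L 0 + gen (r * t) 1)" by (auto simp: qv_def coset_def L_def)
      then show "x \<in> {k + (L l + gen (r * t) 1) | k l. k \<in> KK \<and> l \<in> KK}" using KK_zero by blast
    qed
  qed
  finally show ?thesis .
qed

lemma presents_Verma: "presents qv (Verma \<mu> P lam)"
proof -
  note V = Verma_def[of \<mu> P lam, unfolded Let_def tensor_free_eq tensor_relators_eq]
  have "presents qv \<lparr>carrier = carrier (FF Mod KK), monoid.mult = (\<lambda>_ _. undefined), monoid.one = undefined,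
          ring.zero = \<one>\<^bsub>FF Mod KK\<^esub>, ring.add = monoid.mult (FF Mod KK),
          module.smult = (\<lambda>c. tensor_map FF KK (\<lambda>u. cl (Poly_Mapping.single 0 c) \<otimes>\<^bsub>UU\<^esub> u)),
          act = (\<lambda>x. tensor_map FF KK (\<lambda>u. cl (iota x) \<otimes>\<^bsub>UU\<^esub> u))\<rparr>"
    by (simp add: presents_def carrier_FF_Mod tensor_map_qv scal_eq_single_mult)
      (simp add: FactGroup_def qv_add qv_zero)
  then show ?thesis unfolding V .
qed

lemma qv_cong: "s - t \<in> IU \<Longrightarrow> qv s = qv t"
  by (simp add: qv_def gen_def cl_eqI)

text \<open>The pairing sending (u, w) to w times \<psi> of u is additive in both variables and
  balanced, so it factors through the tensor product. Its extension \<Phi> to the free group reads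
  \<psi> off a coset by \<open>the_elem\<close>, which \<open>psi_cl\<close> justifies.\<close>

lemma qv_psi:
  assumes "qv t = qv 0"
  shows "\<psi> t = 0"
proof -
  define \<Phi> :: "('n hv_tensor set \<times> complex \<Rightarrow>\<^sub>0 int) \<Rightarrow> complex" where
    "\<Phi> f = (\<Sum>p\<in>Poly_Mapping.keys f. of_int (Poly_Mapping.lookup f p) * (snd p * the_elem (\<psi> ` fst p)))" for f
  have add: "\<Phi> (f + g) = \<Phi> f + \<Phi> g" for f g
    unfolding \<Phi>_def by (rule setsum_keys_plus_distrib) (simp_all add: algebra_simps)
  have zero: "\<Phi> 0 = 0" by (simp add: \<Phi>_def)
  have minus: "\<Phi> (- f) = - \<Phi> f" for f
    using add[of f "- f"] zero by (simp add: eq_neg_iff_add_eq_0 add.commute)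
  have diff: "\<Phi> (f - g) = \<Phi> f - \<Phi> g" for f g
    using add[of f "- g"] minus[of g] by simp
  have gen: "\<Phi> (gen s c) = c * \<psi> s" for s c
    by (simp add: \<Phi>_def gen_def psi_cl)
  have rel: "\<Phi> g = 0" if "g \<in> relators" for g
    using that
  proof (cases rule: relatorsE)
    case (balanced s t c)
    show ?thesis unfolding balanced(1) diff gen psi_tens_B[OF balanced(2)] by simp
  next
    case (add s t c)
    show ?thesis unfolding add diff gen psi_simps by (simp add: algebra_simps)
  next
    case (add_right s c d)
    show ?thesis unfolding add_right diff gen by (simp add: algebra_simps)
  qed
  have "\<Phi> k = 0" if "k \<in> KK" for k
  proof -
    have "k \<in> {f. \<Phi> f = 0}"
      by (rule KK_minimal[OF that]) (simp_all add: rel add zero minus)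
    then show ?thesis by simp
  qed
  then have "\<Phi> (gen t 1 - gen 0 1) = 0"
    using assms by (simp add: qv_def coset_eq_iff)
  then show ?thesis by (simp add: diff gen psi_simps)
qed

lemma hw_module_Verma: "hw_module \<mu> P lam qv (Verma \<mu> P lam)"
proof (unfold_locales)
  show "presents qv (Verma \<mu> P lam)" by (rule presents_Verma)
  show "qv (s * lie_rel \<mu> x y * t) = qv 0" for s x y t
    using IU_props(4)[OF UEA_ideal_props(2)[OF subalg_UNIV, of x y], of s t] by (intro qv_cong) simp
  show "qv (s * iota (bv b)) = qv (scal (weight_char lam b) s)" if "b \<in> B" for b s
  proof -
    have "coset (gen (s * iota (bv b)) 1) = coset (gen s (weight_char lam b))"
      using gen_balanced[OF tens_iota[of "bv b" B], of s 1] that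
      by (simp add: coset_eq_iff tensor_char_props chi_single)
    then show ?thesis by (simp add: coset_gen)
  qed
  show "\<psi> t = 0" if "qv t = qv 0" for t using that by (rule qv_psi)
qed

end

section \<open>Infinite-dimensional weight spaces\<close>

lemma finite_poly_zeros:
  fixes p :: "complex poly" and f :: "nat \<Rightarrow> complex"
  assumes "p \<noteq> 0" "inj f"
  shows "finite {n. poly p (f n) = 0}"
  using finite_vimageI[OF poly_roots_finite[OF assms(1)] assms(2)] by (simp add: vimage_def)

lemma mu_dot_nonzero: "generic \<mu> \<Longrightarrow> \<alpha> \<noteq> 0 \<Longrightarrow> mu_dot \<mu> \<alpha> \<noteq> 0"
  by (simp add: generic_def)

lemma weight_char_simps:
  assumes "lam = (l, c0, c1, c2, c3)"
  shows "weight_char lam (E \<alpha>) = (if \<alpha> = 0 then l else 0)" "weight_char lam (H \<alpha>) = (if \<alpha> = 0 then c0 else 0)"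
    "weight_char lam C1 = c1" "weight_char lam C2 = c2" "weight_char lam C3 = c3"
  by (simp_all add: assms)

context hv_triangular
begin

lemma psi_swap: "\<psi> (s * (iota x * (iota y * t))) = \<psi> (s * (iota y * (iota x * t))) + \<psi> (s * (iota (bracket \<mu> x y) * t))"
  using psi_lie_rel[of s x y t] by (simp add: lie_rel_def algebra_simps psi_simps)

lemma psi_swap2:
  assumes "x \<in> B"
  shows "\<psi> (s * (iota (bv x) * iota y)) = weight_char lam x * \<psi> (s * iota y) + \<psi> (s * iota (bracket \<mu> (bv x) y))"
  using psi_swap[of s "bv x" y 1] psi_borel_right[OF assms, of "s * iota y"] by (simp add: mult.assoc)

text \<open>A Borel vector travels through two letters until it acts on \<open>v\<close>. The prefix
  \<open>s\<close> stays untouched, so Gram entries are evaluated from the inside.\<close>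

lemma psi_swap3:
  assumes "x \<in> B"
  shows "\<psi> (s * (iota (bv x) * (iota y * iota z))) = weight_char lam x * \<psi> (s * (iota y * iota z)) +
    \<psi> (s * (iota (bracket \<mu> (bv x) y) * iota z)) + \<psi> (s * (iota y * iota (bracket \<mu> (bv x) z)))"
  using psi_swap[of s "bv x" y "iota z"] psi_swap2[OF assms, of "s * iota y" z] by (simp add: mult.assoc)

end

text \<open>The condition on \<open>\<gamma>\<close> says that \<open>\<beta>\<close> is
  infinitesimal compared with it: no integer multiple of \<open>\<beta>\<close>, of either sign,
  takes \<open>\<gamma>\<close> out of the positive cone.\<close>

locale hv_direction = hv_triangular \<mu> P lam
  for \<mu> :: "complex ^ ('n::finite)" and P :: "(int ^ 'n) set" and lam :: hv_weight +
  fixes \<beta> \<gamma> :: "int ^ 'n" and l c0 c1 c2 c3 :: complex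
  assumes beta: "\<beta> \<in> P" and gamma: "\<And>k. \<gamma> + k *s \<beta> \<in> P" and lam: "lam = (l, c0, c1, c2, c3)"
begin

abbreviation "b \<equiv> mu_dot \<mu> \<beta>"
abbreviation "g \<equiv> mu_dot \<mu> \<gamma>"

lemma beta_nonzero: "\<beta> \<noteq> 0" using beta P_zero by auto

lemma b_nonzero: "b \<noteq> 0" using mu_dot_nonzero[OF gen beta_nonzero] .

lemma smult_beta_eq_0: "k *s \<beta> = 0 \<longleftrightarrow> k = 0"
  using beta_nonzero by simp

lemma smult_beta_eq: "k *s \<beta> = m *s \<beta> \<longleftrightarrow> k = m"
  using smult_beta_eq_0[of "k - m"] by (simp add: vector_sub_rdistrib)

lemma smult_beta_P: "k > 0 \<Longrightarrow> k *s \<beta> \<in> P"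
proof (induction k rule: int_gr_induct)
  case base then show ?case using beta by simp
next
  case (step k) then show ?case using P_add[of "k *s \<beta>" \<beta>] beta by (simp add: vector_sadd_rdistrib)
qed

lemma gamma_nonzero: "\<gamma> + k *s \<beta> \<noteq> 0" using gamma[of k] P_zero by auto

lemma g_nonzero: "g - of_nat k * b \<noteq> 0"
  using mu_dot_nonzero[OF gen gamma_nonzero[of "- int k"]] by simp

text \<open>The letters of weight \<open>k \<beta>\<close>, \<open>\<gamma> - k \<beta>\<close> and \<open>k \<beta> - \<gamma>\<close>.\<close>

definition eb :: "int \<Rightarrow> 'n hv_basis" where "eb k = E (k *s \<beta>)"
definition eg :: "int \<Rightarrow> 'n hv_basis" where "eg k = E (\<gamma> + (- k) *s \<beta>)"
definition em :: "int \<Rightarrow> 'n hv_basis" where "em k = E (- (\<gamma> + (- k) *s \<beta>))"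
definition hb :: "int \<Rightarrow> 'n hv_basis" where "hb k = H (k *s \<beta>)"
definition hg :: "int \<Rightarrow> 'n hv_basis" where "hg k = H (\<gamma> + (- k) *s \<beta>)"
definition hm :: "int \<Rightarrow> 'n hv_basis" where "hm k = H (- (\<gamma> + (- k) *s \<beta>))"

lemmas letter_defs = eb_def eg_def em_def hb_def hg_def hm_def

lemma letters_B: "k \<ge> 0 \<Longrightarrow> eb k \<in> B" "k \<ge> 0 \<Longrightarrow> hb k \<in> B" "eg k \<in> B" "hg k \<in> B"
  unfolding letter_defs using smult_beta_P[of k] gamma[of "- k"] by (cases "k = 0"; simp)+

lemma letters_chi: "weight_char lam (eb k) = (if k = 0 then l else 0)" "weight_char lam (hb k) = (if k = 0 then c0 else 0)"
  "weight_char lam (eg k) = 0" "weight_char lam (hg k) = 0"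
  unfolding letter_defs using gamma_nonzero[of "- k"] smult_beta_eq_0[of k] by (simp_all add: weight_char_simps[OF lam])

lemma smult_add: "k *s \<beta> + m *s \<beta> = (k + m) *s \<beta>"
  by (simp add: vector_sadd_rdistrib)

lemma smult_neg: "k *s \<beta> = - (m *s \<beta>) \<longleftrightarrow> k = - m"
  using smult_beta_eq[of k "- m"] by (simp add: vector_smult_lneg)

lemma gm_add: "(\<gamma> + (- j) *s \<beta>) + - (\<gamma> + (- k) *s \<beta>) = (k - j) *s \<beta>"
  by (simp add: vector_smult_lneg vector_sub_rdistrib)

lemma gm_eq: "\<gamma> + (- j) *s \<beta> = - (- (\<gamma> + (- k) *s \<beta>)) \<longleftrightarrow> j = k"
  using smult_beta_eq[of "- j" "- k"] by (simp only: minus_minus add_left_cancel neg_equal_iff_equal)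

lemma gb_add: "(\<gamma> + (- j) *s \<beta>) + k *s \<beta> = \<gamma> + (- (j - k)) *s \<beta>"
  by (simp add: vector_smult_lneg vector_sub_rdistrib)

lemma gb_eq: "\<gamma> + (- j) *s \<beta> = - (k *s \<beta>) \<longleftrightarrow> False"
  using gamma_nonzero[of "k - j"] by (simp add: eq_neg_iff_add_eq_0 gb_add)

text \<open>Letters along \<open>\<gamma>\<close> and letters along \<open>\<beta>\<close> have no
  central term in their bracket, because \<open>\<gamma>\<close> plus a multiple of
  \<open>\<beta>\<close> is never zero.\<close>

lemma brackets:
  "basis_bracket \<mu> (eb j) (eb k) = Poly_Mapping.single (eb (j + k)) (of_int (k - j) * b) +
    (if j = - k then Poly_Mapping.single C1 (((of_int j * b) ^ 3 - of_int j * b) / 12) else 0)"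
  "basis_bracket \<mu> (eb j) (hb k) = Poly_Mapping.single (hb (j + k)) (of_int k * b) +
    (if j = - k then Poly_Mapping.single C2 ((of_int j * b) ^ 2 - of_int j * b) else 0)"
  "basis_bracket \<mu> (hb j) (hb k) = (if j = - k then Poly_Mapping.single C3 (of_int j * b / 3) else 0)"
  "basis_bracket \<mu> (eg j) (eb k) = Poly_Mapping.single (eg (j - k)) (of_int (j + k) * b - g)"
  "basis_bracket \<mu> (eg j) (hb k) = Poly_Mapping.single (hg (j - k)) (of_int k * b)"
  "basis_bracket \<mu> (hg j) (hb k) = 0"
  "basis_bracket \<mu> (eg j) (em k) = Poly_Mapping.single (eb (k - j)) (of_int (j + k) * b - 2 * g) +
    (if j = k then Poly_Mapping.single C1 (((g - of_int j * b) ^ 3 - (g - of_int j * b)) / 12) else 0)"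
  "basis_bracket \<mu> (eg j) (hm k) = Poly_Mapping.single (hb (k - j)) (of_int k * b - g) +
    (if j = k then Poly_Mapping.single C2 ((g - of_int j * b) ^ 2 - (g - of_int j * b)) else 0)"
  "basis_bracket \<mu> (hg j) (hm k) = (if j = k then Poly_Mapping.single C3 ((g - of_int j * b) / 3) else 0)"
  unfolding letter_defs basis_bracket.simps smult_add smult_neg gm_add gm_eq gb_add gb_eq if_False
  by (simp_all add: algebra_simps)

section \<open>Entries of the Gram matrices\<close>

definition ev :: "'n hv_basis \<Rightarrow> 'n hv_tensor" where "ev a = iota (bv a)"

lemma iota_single_ev: "iota (Poly_Mapping.single a c) = scal c (ev a)"
  by (simp add: scal_simps(5) ev_def flip: is_linear_scal[OF is_linear_iota])

lemmas psi_expand = iota_simps(1) iota_single_ev distrib_left distrib_right scal_mult psi_simps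

lemma psi_bv: "a \<in> B \<Longrightarrow> \<psi> (s * ev a) = weight_char lam a * \<psi> s"
  unfolding ev_def by (rule psi_borel_right)

lemma psi_swap2_ev:
  assumes "x \<in> B"
  shows "\<psi> (s * (ev x * ev y)) = weight_char lam x * \<psi> (s * ev y) + \<psi> (s * iota (basis_bracket \<mu> x y))"
  using psi_swap2[OF assms, of s "bv y"] by (simp add: ev_def)

lemma psi_swap3_ev:
  assumes "x \<in> B"
  shows "\<psi> (s * (ev x * (ev y * ev z))) = weight_char lam x * \<psi> (s * (ev y * ev z)) +
    \<psi> (s * (iota (basis_bracket \<mu> x y) * ev z)) + \<psi> (s * (ev y * iota (basis_bracket \<mu> x z)))"
  using psi_swap3[OF assms, of s "bv y" "bv z"] by (simp add: ev_def)

lemma psi_central: "a \<in> {C1, C2, C3} \<Longrightarrow> \<psi> (s * (ev a * ev y)) = weight_char lam a * \<psi> (s * ev y)"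
  using psi_swap2_ev[of a s y] by (auto simp: basis_bracket_central iota_simps psi_simps)

text \<open>The expectation of an \<open>E\<close> letter times the \<open>E\<close> letter of
  opposite weight, \<open>x\<close> being the image under \<open>mu_dot \<mu>\<close> of the
  positive weight; \<open>ph\<close> is its analogue for \<open>E\<close> times \<open>H\<close>. A
  complex argument is used because the values at \<open>g - of_int k * b\<close> also occur.\<close>

definition pe :: "complex \<Rightarrow> complex" where "pe x = (x ^ 3 - x) / 12 * c1 - 2 * x * l"
definition ph :: "complex \<Rightarrow> complex" where "ph x = (x ^ 2 - x) * c2 - x * c0"

lemma pair_ee: "k > 0 \<Longrightarrow> \<psi> (ev (eb k) * ev (eb (- k))) = pe (of_int k * b)"
  using psi_swap2_ev[of "eb k" 1 "eb (- k)"] letters_B(1)[of k] letters_B(1)[of 0] psi_bv[of "eb 0" 1] psi_bv[of C1 1]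
  by (simp add: letters_chi brackets psi_expand weight_char_simps[OF lam] pe_def algebra_simps)

lemma pair_eh: "k > 0 \<Longrightarrow> \<psi> (ev (eb k) * ev (hb (- k))) = ph (of_int k * b)"
  using psi_swap2_ev[of "eb k" 1 "hb (- k)"] letters_B(1)[of k] letters_B(2)[of 0] psi_bv[of "hb 0" 1] psi_bv[of C2 1]
  by (simp add: letters_chi brackets psi_expand weight_char_simps[OF lam] ph_def algebra_simps)

lemma pair_hh: "k > 0 \<Longrightarrow> \<psi> (ev (hb k) * ev (hb (- k))) = of_int k * b / 3 * c3"
  using psi_swap2_ev[of "hb k" 1 "hb (- k)"] letters_B(2)[of k] psi_bv[of C3 1]
  by (simp add: letters_chi brackets psi_expand weight_char_simps[OF lam] algebra_simps)

lemma psi_ev_zero: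
  assumes "a \<in> B" "weight_char lam a = 0"
  shows "\<psi> (ev x * ev a) = 0" "\<psi> (ev x * (ev y * ev a)) = 0"
  using psi_bv[OF assms(1), of "ev x"] psi_bv[OF assms(1), of "ev x * ev y"] assms(2) by (simp_all add: mult.assoc)

text \<open>Passing \<open>em k\<close>, the letter \<open>eg j\<close> becomes
  \<open>eb (k - j)\<close> plus a central term. Passing \<open>eb (- k)\<close>, it becomes a
  multiple of \<open>eg (j + k)\<close>, which is still positive and kills \<open>v\<close>. So only
  letters along \<open>\<beta>\<close> remain.\<close>

lemma gram_ee:
  "\<psi> (ev (eb j) * (ev (eg j) * (ev (em k) * ev (eb (- k))))) =
    (of_int (j + k) * b - 2 * g) * \<psi> (ev (eb j) * (ev (eb (k - j)) * ev (eb (- k)))) +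
    (if j = k then ((g - of_int j * b) ^ 3 - (g - of_int j * b)) / 12 * c1 * \<psi> (ev (eb j) * ev (eb (- k))) else 0)"
  using psi_swap3_ev[of "eg j" "ev (eb j)" "em k" "eb (- k)"] letters_B(3)
    psi_central[of C1 "ev (eb j)" "eb (- k)"]
  by (cases "j = k") (simp_all add: psi_ev_zero letters_chi brackets psi_expand weight_char_simps[OF lam])

text \<open>Heisenberg letters commute up to the centre, so this matrix is even diagonal.\<close>

lemma gram_hh:
  "\<psi> (ev (hb j) * (ev (hg j) * (ev (hm k) * ev (hb (- k))))) =
    (if j = k then (g - of_int j * b) / 3 * c3 * \<psi> (ev (hb j) * ev (hb (- k))) else 0)"
  using psi_swap3_ev[of "hg j" "ev (hb j)" "hm k" "hb (- k)"] letters_B(4)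
    psi_central[of C3 "ev (hb j)" "hb (- k)"]
  by (cases "j = k") (simp_all add: psi_ev_zero letters_chi brackets psi_expand iota_simps(5) weight_char_simps[OF lam])

lemma gram_eh:
  "\<psi> (ev (eb j) * (ev (eg j) * (ev (hm k) * ev (hb (- k))))) =
    (of_int k * b - g) * \<psi> (ev (eb j) * (ev (hb (k - j)) * ev (hb (- k)))) +
    (if j = k then ((g - of_int j * b) ^ 2 - (g - of_int j * b)) * c2 * \<psi> (ev (eb j) * ev (hb (- k))) else 0)"
  using psi_swap3_ev[of "eg j" "ev (eb j)" "hm k" "hb (- k)"] letters_B(3,4)
    psi_central[of C2 "ev (eb j)" "hb (- k)"]
  by (cases "j = k") (simp_all add: psi_ev_zero letters_chi brackets psi_expand weight_char_simps[OF lam])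

text \<open>For \<open>k < j\<close> the letter \<open>eb j\<close> becomes a multiple of
  \<open>eb k\<close> in the middle, which pairs with \<open>eb (- k)\<close>; past the last letter
  it becomes \<open>eb (j - k)\<close>, which kills \<open>v\<close>. On the diagonal the middle
  letter is \<open>eb 0\<close>, acting by an eigenvalue, and this breaks the polynomial pattern in
  \<open>j\<close>.\<close>

lemma triple_eee:
  "0 < k \<Longrightarrow> k < j \<Longrightarrow> \<psi> (ev (eb j) * (ev (eb (k - j)) * ev (eb (- k)))) = of_int (k - 2 * j) * b * pe (of_int k * b)"
  "0 < k \<Longrightarrow> \<psi> (ev (eb k) * (ev (eb 0) * ev (eb (- k)))) = (l - of_int k * b) * pe (of_int k * b)"
proof -
  show "\<psi> (ev (eb j) * (ev (eb (k - j)) * ev (eb (- k)))) = of_int (k - 2 * j) * b * pe (of_int k * b)"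
    if "0 < k" "k < j"
    using that psi_swap3_ev[of "eb j" 1 "eb (k - j)" "eb (- k)"] letters_B(1)[of j] letters_B(1)[of "j - k"]
    by (simp add: psi_ev_zero letters_chi brackets psi_expand pair_ee algebra_simps)
  show "\<psi> (ev (eb k) * (ev (eb 0) * ev (eb (- k)))) = (l - of_int k * b) * pe (of_int k * b)" if "0 < k"
    using that psi_swap2_ev[of "eb 0" "ev (eb k)" "eb (- k)"] letters_B(1)[of 0]
    by (simp add: letters_chi brackets psi_expand pair_ee algebra_simps)
qed

text \<open>For \<open>k < j\<close> the surviving term is a pairing of two \<open>H\<close>
  letters, proportional to \<open>c3\<close>.\<close>

lemma triple_ehh:
  "0 < k \<Longrightarrow> k < j \<Longrightarrow> c3 = 0 \<Longrightarrow> \<psi> (ev (eb j) * (ev (hb (k - j)) * ev (hb (- k)))) = 0"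
  "0 < k \<Longrightarrow> \<psi> (ev (eb k) * (ev (hb 0) * ev (hb (- k)))) = c0 * ph (of_int k * b)"
proof -
  show "\<psi> (ev (eb j) * (ev (hb (k - j)) * ev (hb (- k)))) = 0" if "0 < k" "k < j" "c3 = 0"
    using that psi_swap3_ev[of "eb j" 1 "hb (k - j)" "hb (- k)"] letters_B(1)[of j] letters_B(2)[of "j - k"]
    by (simp add: psi_ev_zero letters_chi brackets psi_expand pair_hh algebra_simps)
  show "\<psi> (ev (eb k) * (ev (hb 0) * ev (hb (- k)))) = c0 * ph (of_int k * b)" if "0 < k"
    using that psi_swap2_ev[of "hb 0" "ev (eb k)" "hb (- k)"] letters_B(2)[of 0]
    by (simp add: letters_chi brackets psi_expand iota_simps(5) pair_eh algebra_simps)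
qed

text \<open>\<open>\<psi> (wee j * uee k)\<close> is a quadratic polynomial in \<open>j\<close> for \<open>j > k\<close>, so the third difference of
  the functionals \<open>wee j\<close> is triangular with respect to the vectors \<open>uee k\<close>.\<close>

definition "uee k = ev (em k) * ev (eb (- k))"
definition "wee j = ev (eb j) * ev (eg j)"
definition "dee j = wee j - scal 3 (wee (j + 1)) + scal 3 (wee (j + 2)) - wee (j + 3)"

lemma wee_uee:
  "0 < k \<Longrightarrow> k < j \<Longrightarrow> \<psi> (wee j * uee k) = (of_int (j + k) * b - 2 * g) * (of_int (k - 2 * j) * b) * pe (of_int k * b)"
  "0 < k \<Longrightarrow> \<psi> (wee k * uee k) = ((2 * of_int k * b - 2 * g) * (l - of_int k * b) +
      ((g - of_int k * b) ^ 3 - (g - of_int k * b)) / 12 * c1) * pe (of_int k * b)"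
proof -
  show "\<psi> (wee j * uee k) = (of_int (j + k) * b - 2 * g) * (of_int (k - 2 * j) * b) * pe (of_int k * b)"
    if "0 < k" "k < j"
    using gram_ee[of j k] triple_eee(1)[OF that] that by (simp add: wee_def uee_def mult.assoc)
  show "\<psi> (wee k * uee k) = ((2 * of_int k * b - 2 * g) * (l - of_int k * b) +
      ((g - of_int k * b) ^ 3 - (g - of_int k * b)) / 12 * c1) * pe (of_int k * b)" if "0 < k"
    using gram_ee[of k k] triple_eee(2)[OF that] pair_ee[OF that] that
    by (simp add: wee_def uee_def mult.assoc algebra_simps)
qed

text \<open>Third differences annihilate quadratic polynomials, so the diagonal value is the defect
  between the true entry at \<open>j = k\<close> and the extrapolated one. The contributions
  containing \<open>l\<close> and \<open>c1\<close> combine to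
  \<open>pe (g - of_int k * b)\<close>.\<close>

lemma dee_uee:
  "0 < k \<Longrightarrow> k < j \<Longrightarrow> \<psi> (dee j * uee k) = 0"
  "0 < k \<Longrightarrow> \<psi> (dee k * uee k) = pe (g - of_int k * b) * pe (of_int k * b)"
proof -
  have exp: "\<psi> (dee j * uee k) = \<psi> (wee j * uee k) - 3 * \<psi> (wee (j + 1) * uee k) +
      3 * \<psi> (wee (j + 2) * uee k) - \<psi> (wee (j + 3) * uee k)" for j
    by (simp add: dee_def left_diff_distrib distrib_right scal_mult psi_simps)
  show "\<psi> (dee j * uee k) = 0" if "0 < k" "k < j"
    using that unfolding exp by (simp add: wee_uee) (simp add: algebra_simps)
  show "\<psi> (dee k * uee k) = pe (g - of_int k * b) * pe (of_int k * b)" if "0 < k"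
    using that unfolding exp by (simp add: wee_uee pe_def[of "g - _"]) (simp add: algebra_simps)
qed

definition "uhh k = ev (hm k) * ev (hb (- k))"
definition "whh j = ev (hb j) * ev (hg j)"

lemma whh_uhh:
  "0 < k \<Longrightarrow> k < j \<Longrightarrow> \<psi> (whh j * uhh k) = 0"
  "0 < k \<Longrightarrow> \<psi> (whh k * uhh k) = (g - of_int k * b) / 3 * c3 * (of_int k * b / 3 * c3)"
  using gram_hh[of j k] gram_hh[of k k] pair_hh[of k] by (simp_all add: whh_def uhh_def mult.assoc)

lemma wee_uhh:
  "0 < k \<Longrightarrow> k < j \<Longrightarrow> c3 = 0 \<Longrightarrow> \<psi> (wee j * uhh k) = 0"
  "0 < k \<Longrightarrow> \<psi> (wee k * uhh k) = ph (g - of_int k * b) * ph (of_int k * b)"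
  using gram_eh[of j k] gram_eh[of k k] triple_ehh(1)[of k j] triple_ehh(2)[of k] pair_eh[of k]
  by (simp_all add: wee_def uhh_def mult.assoc ph_def[of "g - _"] algebra_simps)

text \<open>The polynomial is zero only for \<open>l = c1 = 0\<close>, and the one for
  \<open>ph\<close> only for \<open>c0 = c2 = 0\<close>. Otherwise each has finitely many roots,
  which bounds the zeros on the diagonal.\<close>

lemma pe_poly: "pe x = poly [:0, - 2 * l - c1 / 12, 0, c1 / 12:] x"
  by (simp add: pe_def field_simps power3_eq_cube)

lemma ph_poly: "ph x = poly [:0, - c0 - c2, c2:] x"
  by (simp add: ph_def algebra_simps power2_eq_square)

lemma inj_kb: "inj (\<lambda>n. of_nat n * b)" "inj (\<lambda>n. g - of_nat n * b)"
  using b_nonzero by (auto simp: inj_def)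

definition triangular :: "(int \<Rightarrow> 'n hv_tensor) \<Rightarrow> (int \<Rightarrow> 'n hv_tensor) \<Rightarrow> bool" where
  "triangular u w \<longleftrightarrow> (\<forall>k j. 0 < k \<longrightarrow> k < j \<longrightarrow> \<psi> (w j * u k) = 0) \<and>
     finite {n. n > 0 \<and> \<psi> (w (int n) * u (int n)) = 0}"

lemma triangular_dee:
  assumes "l \<noteq> 0 \<or> c1 \<noteq> 0"
  shows "triangular uee dee"
proof -
  let ?p = "[:0, - 2 * l - c1 / 12, 0, c1 / 12:]"
  have "?p \<noteq> 0" using assms by auto
  then have "finite ({n. pe (of_nat n * b) = 0} \<union> {n. pe (g - of_nat n * b) = 0})"
    unfolding pe_poly by (intro finite_UnI finite_poly_zeros inj_kb)
  then have "finite {n. n > 0 \<and> \<psi> (dee (int n) * uee (int n)) = 0}"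
    by (rule rev_finite_subset) (auto simp: dee_uee)
  then show ?thesis
    by (simp add: triangular_def dee_uee)
qed

lemma triangular_whh:
  assumes "c3 \<noteq> 0"
  shows "triangular uhh whh"
proof -
  have "{n. n > 0 \<and> \<psi> (whh (int n) * uhh (int n)) = 0} = {}"
    using assms b_nonzero g_nonzero by (auto simp: whh_uhh)
  then have "finite {n. n > 0 \<and> \<psi> (whh (int n) * uhh (int n)) = 0}"
    by (simp only: finite.emptyI)
  then show ?thesis
    unfolding triangular_def using whh_uhh(1) by blast
qed

text \<open>When \<open>c3 = 0\<close> the pairings of \<open>H\<close> with \<open>H\<close>
  vanish, so the vectors built from \<open>H\<close> letters are tested with functionals built from
  \<open>E\<close> letters. The diagonal entry factors into two values of \<open>ph\<close>.\<close>

lemma triangular_wee: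
  assumes "c0 \<noteq> 0 \<or> c2 \<noteq> 0" "c3 = 0"
  shows "triangular uhh wee"
proof -
  let ?p = "[:0, - c0 - c2, c2:]"
  have "?p \<noteq> 0" using assms by auto
  then have "finite ({n. ph (of_nat n * b) = 0} \<union> {n. ph (g - of_nat n * b) = 0})"
    unfolding ph_poly by (intro finite_UnI finite_poly_zeros inj_kb)
  then have "finite {n. n > 0 \<and> \<psi> (wee (int n) * uhh (int n)) = 0}"
    by (rule rev_finite_subset) (auto simp: wee_uhh)
  then show ?thesis
    using assms(2) by (simp add: triangular_def wee_uhh)
qed

end

locale hw_direction = hw_module \<mu> P lam Q M + hv_direction \<mu> P lam \<beta> \<gamma> l c0 c1 c2 c3
  for \<mu> :: "complex ^ ('n::finite)" and P :: "(int ^ 'n) set" and lam :: hv_weight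
    and Q :: "'n hv_tensor \<Rightarrow> 'v" and M and \<beta> \<gamma> l c0 c1 c2 c3
begin

lemma weight_u: "iota (bv (E 0)) * uee k - scal (l - g) (uee k) \<in> J" "iota (bv (E 0)) * uhh k - scal (l - g) (uhh k) \<in> J"
proof -
  have "iota (bv (E 0)) * wd [x, y] - scal (l - g) (wd [x, y]) \<in> J" if "wtb x + wtb y = - \<gamma>" for x y
    using weight_mod_I[of "[x, y]"] I_subset_J that by (auto simp: lam)
  moreover have "wd [x, y] = ev x * ev y" for x y :: "'n hv_basis"
    by (simp add: wd_Cons wd_Nil ev_def)
  moreover have "wtb (em k) + wtb (eb (- k)) = - \<gamma>" "wtb (hm k) + wtb (hb (- k)) = - \<gamma>"
    by (simp_all add: letter_defs vector_smult_lneg)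
  ultimately show "iota (bv (E 0)) * uee k - scal (l - g) (uee k) \<in> J" "iota (bv (E 0)) * uhh k - scal (l - g) (uhh k) \<in> J"
    by (metis uee_def, metis uhh_def)
qed

lemma infinite_dim_triangular_family:
  assumes "triangular u w" "\<And>k. iota (bv (E 0)) * u k - scal a (u k) \<in> J"
  shows "a \<in> supp (irreducible_quotient M)" "infinite_dim_weight_space (irreducible_quotient M) a"
proof -
  obtain N where N: "\<And>n. n > 0 \<Longrightarrow> \<psi> (w (int n) * u (int n)) = 0 \<Longrightarrow> n < N"
    using assms(1) finite_nat_set_iff_bounded[of "{n. n > 0 \<and> \<psi> (w (int n) * u (int n)) = 0}"]
    by (auto simp: triangular_def)
  \<comment> \<open>\<open>Suc\<close> makes the index positive, and the shift by \<open>N\<close>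
    skips the finitely many zeros on the diagonal.\<close>
  have tri: "\<psi> (w (int (Suc n + N)) * u (int (Suc k + N))) = 0" if "k < n" for k n
    using assms(1) that by (simp add: triangular_def)
  have diag: "\<psi> (w (int (Suc n + N)) * u (int (Suc n + N))) \<noteq> 0" for n
    using N[of "Suc n + N"] by auto
  show "a \<in> supp (irreducible_quotient M)" "infinite_dim_weight_space (irreducible_quotient M) a"
    using infinite_dim_criterion[where u = "\<lambda>n. u (int (Suc n + N))" and w = "\<lambda>n. w (int (Suc n + N))",
        OF assms(2) tri diag] by blast+
qed

lemma exists_infinite_dim:
  assumes "lam \<noteq> (0, 0, 0, 0, 0)"
  shows "\<exists>a\<in>supp (irreducible_quotient M). infinite_dim_weight_space (irreducible_quotient M) a"
proof -
  consider "l \<noteq> 0 \<or> c1 \<noteq> 0" | "c3 \<noteq> 0" | "c0 \<noteq> 0 \<or> c2 \<noteq> 0" "c3 = 0"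
    using assms lam by auto
  then show ?thesis
  proof cases
    case 1 then show ?thesis using infinite_dim_triangular_family[OF triangular_dee weight_u(1)] by blast
  next
    case 2 then show ?thesis using infinite_dim_triangular_family[OF triangular_whh weight_u(2)] by blast
  next
    case 3 then show ?thesis using infinite_dim_triangular_family[OF triangular_wee weight_u(2)] by blast
  qed
qed

end

lemma (in hv_triangular) exists_infinite_dim:
  assumes "\<beta> \<in> P" "\<And>k. \<gamma> + k *s \<beta> \<in> P" "lam \<noteq> (0, 0, 0, 0, 0)"
  shows "\<exists>a\<in>supp (irreducible_quotient (Verma \<mu> P lam)). infinite_dim_weight_space (irreducible_quotient (Verma \<mu> P lam)) a"
proof -
  obtain l c0 c1 c2 c3 where lam: "lam = (l, c0, c1, c2, c3)" by (cases lam)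
  interpret M: hw_module \<mu> P lam qv "Verma \<mu> P lam" by (rule hw_module_Verma)
  interpret hw_direction \<mu> P lam qv "Verma \<mu> P lam" \<beta> \<gamma> l c0 c1 c2 c3
    by unfold_locales (use assms lam in auto)
  show ?thesis using assms(3) by (rule exists_infinite_dim)
qed

section \<open>The lexicographic order\<close>

lemma lex_add: "lex_less 0 \<alpha> \<Longrightarrow> lex_less 0 \<beta> \<Longrightarrow> lex_less 0 (\<alpha> + \<beta>)"
proof -
  assume "lex_less 0 \<alpha>" "lex_less 0 \<beta>"
  then obtain i j where i: "0 < \<alpha> $ i" "\<And>k. k < i \<Longrightarrow> \<alpha> $ k = 0" and j: "0 < \<beta> $ j" "\<And>k. k < j \<Longrightarrow> \<beta> $ k = 0"
    by (auto simp: lex_less_def)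
  show "lex_less 0 (\<alpha> + \<beta>)"
    unfolding lex_less_def
    by (rule exI[of _ "min i j"]) (use i j in \<open>auto simp: min_def not_le order.order_iff_strict\<close>)
qed

lemma lex_total: "\<alpha> \<noteq> 0 \<Longrightarrow> lex_less 0 \<alpha> \<or> lex_less 0 (- \<alpha>)"
proof -
  assume "\<alpha> \<noteq> 0"
  then have ne: "{i. \<alpha> $ i \<noteq> 0} \<noteq> {}" by (auto simp: vec_eq_iff)
  define i where "i = Min {i. \<alpha> $ i \<noteq> 0}"
  have "\<alpha> $ i \<noteq> 0" using Min_in[OF _ ne] by (simp add: i_def)
  moreover have "\<alpha> $ j = 0" if "j < i" for j
    using Min_le[of "{i. \<alpha> $ i \<noteq> 0}" j] that by (fastforce simp: i_def not_less[symmetric])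
  ultimately show ?thesis
    unfolding lex_less_def by (cases "\<alpha> $ i > 0") (auto intro!: exI[of _ i])
qed

lemma lex_less_minus: "lex_less \<alpha> 0 \<longleftrightarrow> lex_less 0 (- \<alpha>)"
  by (simp add: lex_less_def)

theorem theorem4p1:
  fixes \<mu> :: "complex ^ ('n::{finite,linorder})" and lam :: hv_weight
  assumes "generic \<mu>"
    and "CARD('n) \<ge> 2"
    and "lam \<noteq> (0, 0, 0, 0, 0)"
  shows "(\<exists>\<alpha>\<in>supp (highest_weight_module \<mu> lam).
            infinite_dim_weight_space (highest_weight_module \<mu> lam) \<alpha>) \<and>
         (\<exists>\<alpha>\<in>supp (lowest_weight_module \<mu> lam).
            infinite_dim_weight_space (lowest_weight_module \<mu> lam) \<alpha>)"
proof
  have "\<exists>i j :: 'n. i < j"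
  proof (rule ccontr)
    assume "\<nexists>i j :: 'n. i < j"
    then have "\<And>i j :: 'n. i = j" by (meson linorder_less_linear)
    then have "is_singleton (UNIV :: 'n set)" by (auto simp: is_singleton_def)
    then show False using assms(2) by (simp add: is_singleton_altdef)
  qed
  then obtain i j :: 'n where ij: "i < j" by blast
  \<comment> \<open>The coordinate \<open>i\<close> is compared before \<open>j\<close>, so
    multiples of \<open>\<beta>\<close> cannot change the sign of \<open>\<gamma>\<close>.\<close>
  define \<beta> \<gamma> :: "(int, 'n) vec" where "\<beta> = axis j 1" and "\<gamma> = axis i 1"
  have beta: "lex_less 0 \<beta>"
    unfolding lex_less_def by (rule exI[of _ j]) (auto simp: \<beta>_def axis_def)
  have gamma: "lex_less 0 (\<gamma> + k *s \<beta>)" for k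
    unfolding lex_less_def by (rule exI[of _ i]) (use ij in \<open>auto simp: \<beta>_def \<gamma>_def axis_def\<close>)
  have irrefl: "\<not> lex_less 0 (0 :: (int, 'n) vec)" by (simp add: lex_less_def)
  interpret hp: hv_triangular \<mu> Delta_pos lam
    by unfold_locales (use assms(1) irrefl in \<open>auto simp: Delta_pos_def lex_add lex_total\<close>)
  interpret hn: hv_triangular \<mu> Delta_neg lam
  proof
    show "\<alpha> + \<beta> \<in> Delta_neg" if "\<alpha> \<in> Delta_neg" "\<beta> \<in> Delta_neg" for \<alpha> \<beta> :: "(int, 'n) vec"
      using lex_add[of "- \<alpha>" "- \<beta>"] that by (simp add: Delta_neg_def lex_less_minus add.commute)
    show "\<alpha> \<in> Delta_neg \<or> - \<alpha> \<in> Delta_neg" if "\<alpha> \<noteq> 0" for \<alpha> :: "(int, 'n) vec"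
      using lex_total[OF that] by (auto simp: Delta_neg_def lex_less_minus)
  qed (use assms(1) irrefl in \<open>auto simp: Delta_neg_def\<close>)
  show "\<exists>\<alpha>\<in>supp (highest_weight_module \<mu> lam). infinite_dim_weight_space (highest_weight_module \<mu> lam) \<alpha>"
    unfolding highest_weight_module_def
    by (rule hp.exists_infinite_dim[of \<beta> \<gamma>]) (use beta gamma assms(3) in \<open>auto simp: Delta_pos_def\<close>)
  \<comment> \<open>In the reversed order the negatives of \<open>\<beta>\<close> and
    \<open>\<gamma>\<close> take over their roles.\<close>
  have gamma': "lex_less (- \<gamma> + k *s (- \<beta>)) 0" for k
    using gamma[of k] by (simp add: lex_less_minus vector_smult_rneg add.commute)
  show "\<exists>\<alpha>\<in>supp (lowest_weight_module \<mu> lam). infinite_dim_weight_space (lowest_weight_module \<mu> lam) \<alpha>"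
    unfolding lowest_weight_module_def
    by (rule hn.exists_infinite_dim[of "- \<beta>" "- \<gamma>"]) (use beta gamma' assms(3) in \<open>auto simp: Delta_neg_def lex_less_minus\<close>)
qed

end
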